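(* There is an $\mathrm{REA}[\omega]$ set $C\subseteq\omega$ which is not computable and such that $C$ and $\emptyset'$ form a minimal pair: every set $X\subseteq\omega$ with $X\le_T C$ and $X\le_T \emptyset'$ is computable (i.e. $\deg(C)\wedge \mathbf{0}'=\mathbf{0}$).
   Context: Let $\langle x,y\rangle$ denote a standard computable pairing function. For $X\subseteq\omega$, the $n$-th column is $X^{[n]}=\{y:\langle n,y\rangle\in X\}$ and $X^{[<n]}=\{\langle m,y\rangle\in X: m<n\}$ (so $X^{[<0]}=\emptyset$). $W_e^Z$ denotes the $e$-th set computably enumerable relative to $Z$. A set $C\subseteq\omega$ is $\mathrm{REA}[\omega]$ iff there is a computable function $f$ such that for every $n$, $C^{[n]}=W^{C^{[<n]}}_{f(n)}$. $\emptyset'$ is the halting set. *)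

theory Defs
  imports Main "HOL-Library.Nat_Bijection"
begin

datatype recf =
    Zero
  | Succ
  | Proj nat
  | Oracle
  | Comp recf "recf list"
  | PRec recf recf
  | Mu recf

definition arg :: "nat \<Rightarrow> nat list \<Rightarrow> nat" where
  "arg i xs = (if i < length xs then xs ! i else 0)"

inductive eval :: "nat set \<Rightarrow> recf \<Rightarrow> nat list \<Rightarrow> nat \<Rightarrow> bool" for A :: "nat set" where
  ev_zero: "eval A Zero xs 0"
| ev_succ: "eval A Succ xs (Suc (arg 0 xs))"
| ev_proj: "eval A (Proj i) xs (arg i xs)"
| ev_oracle: "eval A Oracle xs (if arg 0 xs \<in> A then 1 else 0)"
| ev_comp: "\<lbrakk>length ys = length gs; \<forall>i<length gs. eval A (gs ! i) xs (ys ! i); eval A f ys z\<rbrakk>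
            \<Longrightarrow> eval A (Comp f gs) xs z"
| ev_prec0: "eval A f xs y \<Longrightarrow> eval A (PRec f g) (0 # xs) y"
| ev_precS: "\<lbrakk>eval A (PRec f g) (n # xs) y; eval A g (n # y # xs) z\<rbrakk>
            \<Longrightarrow> eval A (PRec f g) (Suc n # xs) z"
| ev_mu: "\<lbrakk>eval A f (n # xs) 0; \<forall>m<n. \<exists>y. eval A f (m # xs) y \<and> y \<noteq> 0\<rbrakk>
            \<Longrightarrow> eval A (Mu f) xs n"

fun enc_list :: "nat list \<Rightarrow> nat" where
  "enc_list [] = 0"
| "enc_list (x # xs) = Suc (prod_encode (x, enc_list xs))"

fun enc :: "recf \<Rightarrow> nat" where
  "enc Zero = prod_encode (0, 0)"
| "enc Succ = prod_encode (1, 0)"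
| "enc (Proj i) = prod_encode (2, i)"
| "enc Oracle = prod_encode (3, 0)"
| "enc (Comp f gs) = prod_encode (4, prod_encode (enc f, enc_list (map enc gs)))"
| "enc (PRec f g) = prod_encode (5, prod_encode (enc f, enc g))"
| "enc (Mu f) = prod_encode (6, enc f)"

text \<open>W e Z: the e-th set c.e. relative to Z (domain of the e-th oracle program on input x;
  empty if e codes no program).\<close>
definition W :: "nat \<Rightarrow> nat set \<Rightarrow> nat set" where
  "W e Z = {x. \<exists>p y. enc p = e \<and> eval Z p [x] y}"

definition halting_set :: "nat set" where
  "halting_set = {e. e \<in> W e {}}"

definition turing_le :: "nat set \<Rightarrow> nat set \<Rightarrow> bool" where
  "turing_le X Z \<longleftrightarrow> (\<exists>p. \<forall>x. eval Z p [x] (if x \<in> X then 1 else 0))"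

definition computable_set :: "nat set \<Rightarrow> bool" where
  "computable_set X \<longleftrightarrow> turing_le X {}"

definition computable_fun :: "(nat \<Rightarrow> nat) \<Rightarrow> bool" where
  "computable_fun f \<longleftrightarrow> (\<exists>p. \<forall>x. eval {} p [x] (f x))"

definition column :: "nat set \<Rightarrow> nat \<Rightarrow> nat set" where
  "column X n = {y. prod_encode (n, y) \<in> X}"

definition below :: "nat set \<Rightarrow> nat \<Rightarrow> nat set" where
  "below X n = {z \<in> X. fst (prod_decode z) < n}"

definition REA_omega :: "nat set \<Rightarrow> bool" where
  "REA_omega C \<longleftrightarrow> (\<exists>f. computable_fun f \<and> (\<forall>n. column C n = W (f n) (below C n)))"

end

theory Submission
  imports Defs
begin

text \<open>A block for a pair \<open>(\<Phi>, \<Psi>)\<close>, sitting on finitely many columns, has to make sure that a set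
  \<open>X = \<Phi>(C) = \<Psi>(\<emptyset>')\<close> is computable. It searches for a finite oracle \<open>F\<close> on which \<open>\<Phi>\<close> converges on
  \<open>{0..j}\<close>, where \<open>F\<close> is consistent with the columns below and closed under everything the later blocks would
  enumerate with oracle \<open>F\<close>. Having found one, it waits until the stage approximation of \<open>\<Psi>(\<emptyset>')\<close> agrees with
  the answers; then level \<open>j + 1\<close> is confirmed, provided the answers extend those confirmed at level \<open>j\<close>.
  The outcome of the search is visible in the matrix \<open>D\<close>: its full rows are those from some \<open>p\<close> on, and the
  length of row \<open>p - 1\<close> identifies the witness. As later columns are enumerated relative to the earlier ones, the
  later blocks read off the outcome and start beyond the witness, so that \<open>F\<close> is an initial segment of \<open>C\<close>.
  If the level is bounded, then \<open>\<Phi>(C)\<close> diverges, or \<open>\<Psi>(\<emptyset>')\<close> differs from the answers \<open>\<Phi>(C)\<close> of the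
  witness. If it is unbounded, then \<open>X\<close> is the union of the confirmed answers, hence computable from the columns
  below the block, and these are computable because each outcome leaves only computable columns behind.\<close>

section \<open>Oracle programs\<close>

text \<open>The difficulty is that a block has to predict columns of \<open>C\<close> that are built
  later, and relative to its own columns. A guess F becomes self-fulfilling from two sides. What
  later blocks enumerate before the witness is known, possibly from a wrong base column, cannot be
  retracted, so F must already contain it; what F contains besides is copied into the columns that
  they then skip. Skipping as many columns as F is long suffices, since a number is at least its
  column index. A guess also depends on the final shape of D, hence on the future of the search. A
  witness sought at level j presumes that exactly the rows from j + 1 on will be full. This comes
  true in both bounded outcomes that use the witness: if the attempt at level j never ends, and if,
  after the witness has confirmed level j + 1, conflicts recur there forever and fill row j + 1. Row
  lengths can name attempts because every attempt starts at a stage larger than the earlier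
  ones.\<close>

inductive_cases evZeroE: "eval A Zero xs y"
inductive_cases evSuccE: "eval A Succ xs y"
inductive_cases evProjE: "eval A (Proj i) xs y"
inductive_cases evOracleE: "eval A Oracle xs y"
inductive_cases evCompE: "eval A (Comp f gs) xs y"
inductive_cases evPRec0E: "eval A (PRec f g) (0 # xs) y"
inductive_cases evPRecSE: "eval A (PRec f g) (Suc n # xs) y"
inductive_cases evMuE: "eval A (Mu f) xs y"

lemma eval_det: "eval A p xs y \<Longrightarrow> eval A p xs z \<Longrightarrow> y = z"
proof (induction arbitrary: z rule: eval.induct)
  case (ev_comp ys gs xs f v)
  from ev_comp.prems obtain ys' where 1: "length ys' = length gs"
    "\<forall>i<length gs. eval A (gs ! i) xs (ys' ! i)" "eval A f ys' z"
    by (auto elim: evCompE)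
  have "ys = ys'"
    using ev_comp.hyps ev_comp.IH 1 by (intro nth_equalityI) auto
  then show ?case using ev_comp.IH(2) 1 by blast
next
  case (ev_precS f g n xs y v)
  from ev_precS.prems show ?case
    by (rule evPRecSE) (use ev_precS.IH in blast)
next
  case (ev_mu f n xs)
  from ev_mu.prems have 1: "eval A f (z # xs) 0" "\<forall>m<z. \<exists>y. eval A f (m # xs) y \<and> y \<noteq> 0"
    by (auto elim: evMuE)
  show ?case
  proof (rule linorder_cases[of n z])
    assume "n < z" then show ?thesis using 1(2) ev_mu.IH(1) by blast
  next
    assume "z < n" then show ?thesis using 1(1) ev_mu.IH(2) by blast
  qed
next
  case (ev_prec0 f xs y g)
  from ev_prec0.prems show ?case
    by (rule evPRec0E) (use ev_prec0.IH in blast)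
next
  case (ev_zero xs) then show ?case by (rule evZeroE) simp
next
  case (ev_succ xs) then show ?case by (rule evSuccE) simp
next
  case (ev_proj i xs) then show ?case by (rule evProjE) simp
next
  case (ev_oracle xs) then show ?case by (rule evOracleE) simp
qed

lemma enc_list_eq: "enc_list = list_encode"
proof
  fix xs show "enc_list xs = list_encode xs" by (induction xs) auto
qed

lemma enc_inj: "enc p = enc q \<Longrightarrow> p = q"
proof (induction p arbitrary: q)
  case (Comp f gs)
  then obtain f' gs' where q: "q = Comp f' gs'" by (cases q) auto
  with Comp.prems have 1: "enc f = enc f'" "map enc gs = map enc gs'"
    by (simp_all add: enc_list_eq list_encode_eq)
  have "map enc gs = map enc gs' \<Longrightarrow> gs = gs'"
    using Comp.IH(2)
  proof (induction gs arbitrary: gs')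
    case (Cons g gs)
    then obtain h hs where gs': "gs' = h # hs" by (cases gs') auto
    with Cons.prems(1) have "enc g = enc h" "map enc gs = map enc hs" by simp_all
    moreover have "g = h" by (rule Cons.prems(2)[OF _ \<open>enc g = enc h\<close>]) simp
    moreover have "gs = hs" by (rule Cons.IH[OF \<open>map enc gs = map enc hs\<close>]) (rule Cons.prems(2), simp_all)
    ultimately show ?case using gs' by simp
  qed simp
  then have "gs = gs'" using 1(2) by blast
  then show ?case using q 1 Comp.IH(1) by simp
next
  case Zero then show ?case by (cases q) auto
next
  case Succ then show ?case by (cases q) auto
next
  case (Proj i) then show ?case by (cases q) auto
next
  case Oracle then show ?case by (cases q) auto
next
  case (PRec f g) then show ?case by (cases q) auto
next
  case (Mu f) then show ?case by (cases q) auto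
qed

lemma W_enc: "W (enc p) Z = {x. \<exists>y. eval Z p [x] y}"
  unfolding W_def using enc_inj by blast

lemma eval_Proj: "i < length xs \<Longrightarrow> xs ! i = y \<Longrightarrow> eval A (Proj i) xs y"
  using ev_proj[of A i xs] by (simp add: arg_def)

lemma eval_Succ: "eval A Succ (x # xs) (Suc x)"
  using ev_succ[of A "x # xs"] by (simp add: arg_def)

lemma eval_Comp1: "eval A g xs a \<Longrightarrow> eval A f [a] z \<Longrightarrow> eval A (Comp f [g]) xs z"
  by (rule ev_comp[of "[a]"]) auto

lemma eval_Comp2: "eval A g xs a \<Longrightarrow> eval A h xs b \<Longrightarrow> eval A f [a, b] z \<Longrightarrow> eval A (Comp f [g, h]) xs z"
  by (rule ev_comp[of "[a, b]"]) (auto simp: less_Suc_eq)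

lemma eval_PRec:
  assumes "eval A f xs (r 0)" and "\<And>n. eval A g (n # r n # xs) (r (Suc n))"
  shows "eval A (PRec f g) (n # xs) (r n)"
  by (induction n) (auto intro: ev_prec0 ev_precS assms)

text \<open>\<open>q\<close> is specified on one-element lists only, while \<open>Oracle\<close> may
  meet a list of any length; \<open>Proj 0\<close> passes on the first entry, with the same default
  \<open>0\<close> for the empty list.\<close>

fun oracle_subst :: "recf \<Rightarrow> recf \<Rightarrow> recf" where
  "oracle_subst q Oracle = Comp q [Proj 0]"
| "oracle_subst q (Comp f gs) = Comp (oracle_subst q f) (map (oracle_subst q) gs)"
| "oracle_subst q (PRec f g) = PRec (oracle_subst q f) (oracle_subst q g)"
| "oracle_subst q (Mu f) = Mu (oracle_subst q f)"
| "oracle_subst q p = p"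

lemma eval_oracle_subst:
  assumes q: "\<And>x. eval B q [x] (if x \<in> A then 1 else 0)"
  shows "eval A p xs y \<Longrightarrow> eval B (oracle_subst q p) xs y"
proof (induction rule: eval.induct)
  case (ev_oracle xs)
  show ?case unfolding oracle_subst.simps
    by (rule eval_Comp1[OF ev_proj q])
next
  case (ev_comp ys gs xs f z)
  then show ?case by (auto intro!: eval.ev_comp[of ys])
qed (auto intro: eval.intros)

lemma turing_le_trans: "turing_le X Y \<Longrightarrow> turing_le Y Z \<Longrightarrow> turing_le X Z"
  unfolding turing_le_def using eval_oracle_subst by metis

section \<open>Programs for arithmetic and for the pairing function\<close>

abbreviation "pr a b \<equiv> prod_encode (a, b)"
abbreviation "p1 z \<equiv> fst (prod_decode z)"
abbreviation "p2 z \<equiv> snd (prod_decode z)"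

definition addp :: recf where "addp = PRec (Proj 0) (Comp Succ [Proj 1])"
definition trip :: recf where "trip = PRec Zero (Comp addp [Comp Succ [Proj 0], Proj 1])"
definition prp :: recf where "prp = Comp addp [Comp trip [addp], Proj 0]"
definition predp :: recf where "predp = PRec Zero (Proj 0)"
text \<open>\<open>PRec\<close> recurses on its first argument, so the arguments are swapped before
  the predecessor is iterated.\<close>

definition subp :: recf where "subp = Comp (PRec (Proj 0) (Comp predp [Proj 1])) [Proj 1, Proj 0]"
definition eqp :: recf where
  "eqp = Comp subp [Comp Succ [Zero], Comp addp [subp, Comp subp [Proj 1, Proj 0]]]"

lemma eval_addp: "eval A addp [m, n] (m + n)"
  unfolding addp_def
  by (rule eval_PRec[where r = "\<lambda>m. m + n"]) (auto intro!: eval_Comp1 eval_Succ eval_Proj)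

lemma eval_trip: "eval A trip [n] (triangle n)"
  unfolding trip_def
proof (rule eval_PRec)
  show "eval A Zero [] (triangle 0)" using ev_zero by simp
  fix n
  have "eval A addp [Suc n, triangle n] (triangle (Suc n))"
    using eval_addp[of A "Suc n" "triangle n"] by (simp add: add.commute)
  then show "eval A (Comp addp [Comp Succ [Proj 0], Proj 1]) [n, triangle n] (triangle (Suc n))"
    by (auto intro!: eval_Comp2 eval_Comp1 eval_Succ eval_Proj)
qed

lemma eval_prp: "eval A prp [m, n] (pr m n)"
  unfolding prp_def prod_encode_def
  by (auto intro!: eval_Comp2[OF eval_Comp1[OF eval_addp eval_trip]] eval_addp eval_Proj)

lemma eval_predp: "eval A predp [n] (n - 1)"
  unfolding predp_def
  by (rule eval_PRec) (auto intro: eval_Proj ev_zero)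

lemma eval_subp: "eval A subp [m, n] (m - n)"
proof -
  have "eval A (PRec (Proj 0) (Comp predp [Proj 1])) [n, m] (m - n)"
  proof (rule eval_PRec[where r = "\<lambda>n. m - n"])
    show "eval A (Proj 0) [m] (m - 0)" by (auto intro: eval_Proj)
    fix n
    have "eval A predp [m - n] (m - Suc n)" using eval_predp[of A "m - n"] by simp
    then show "eval A (Comp predp [Proj 1]) [n, m - n, m] (m - Suc n)"
      by (auto intro!: eval_Comp1 eval_Proj)
  qed
  then show ?thesis unfolding subp_def by (auto intro!: eval_Comp2 eval_Proj)
qed

lemma eval_eqp: "eval A eqp [m, n] (if m = n then 1 else 0)"
proof -
  have "eval A eqp [m, n] (Suc 0 - ((m - n) + (n - m)))"
    unfolding eqp_def
    by (auto intro!: eval_Comp2[OF eval_Comp1[OF ev_zero eval_Succ] eval_Comp2[OF eval_subp eval_Comp2]]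
        eval_Proj eval_addp eval_subp)
  moreover have "Suc 0 - ((m - n) + (n - m)) = (if m = n then 1 else 0)" by auto
  ultimately show ?thesis by simp
qed

text \<open>The antidiagonal of the pairing function on which a number lies, i.e. the sum of its two components.\<close>

primrec diag_row :: "nat \<Rightarrow> nat" where
  "diag_row 0 = 0"
| "diag_row (Suc z) = diag_row z + (if Suc z = triangle (Suc (diag_row z)) then 1 else 0)"

lemma diag_row_bounds: "triangle (diag_row z) \<le> z \<and> z < triangle (Suc (diag_row z))"
  by (induction z) auto

lemma triangle_mono: "i \<le> j \<Longrightarrow> triangle i \<le> triangle j"
  by (induction j) (auto simp: le_Suc_eq)

lemma diag_row_pr: "diag_row (pr m n) = m + n"
proof -
  let ?z = "pr m n" and ?r = "diag_row (pr m n)"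
  have b: "triangle (m + n) \<le> ?z" "?z < triangle (Suc (m + n))"
    by (auto simp: prod_encode_def)
  have "\<not> Suc ?r \<le> m + n" using diag_row_bounds[of ?z] b(1) triangle_mono[of "Suc ?r" "m + n"] by linarith
  moreover have "\<not> Suc (m + n) \<le> ?r" using diag_row_bounds[of ?z] b(2) triangle_mono[of "Suc (m + n)" ?r] by linarith
  ultimately show ?thesis by linarith
qed

text \<open>Cantor pairing is \<open>triangle (a + b) + a\<close>; once the antidiagonal
  \<open>a + b\<close> is known, both components are differences.\<close>

lemma p1_eq: "p1 z = z - triangle (diag_row z)" and p2_eq: "p2 z = diag_row z - p1 z"
proof -
  have r: "diag_row z = p1 z + p2 z" using diag_row_pr[of "p1 z" "p2 z"] by simp
  have "triangle (p1 z + p2 z) + p1 z = prod_encode (prod_decode z)"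
    unfolding prod_encode_def by (simp add: case_prod_beta)
  then show "p1 z = z - triangle (diag_row z)" using r by simp
  show "p2 z = diag_row z - p1 z" using r by simp
qed

definition rowp :: recf where
  "rowp = PRec Zero (Comp addp [Proj 1, Comp eqp [Comp Succ [Proj 0], Comp trip [Comp Succ [Proj 1]]]])"

lemma eval_rowp: "eval A rowp [z] (diag_row z)"
  unfolding rowp_def
proof (rule eval_PRec)
  fix n
  show "eval A (Comp addp [Proj 1, Comp eqp [Comp Succ [Proj 0], Comp trip [Comp Succ [Proj 1]]]])
     [n, diag_row n] (diag_row (Suc n))"
    unfolding diag_row.simps
    by (rule eval_Comp2[OF _ eval_Comp2[OF eval_Comp1[OF _ eval_Succ] eval_Comp1[OF eval_Comp1[OF _ eval_Succ] eval_trip] eval_eqp] eval_addp])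
      (auto intro: eval_Proj)
qed (auto intro: ev_zero)

definition fstp :: recf where "fstp = Comp subp [Proj 0, Comp trip [rowp]]"
definition sndp :: recf where "sndp = Comp subp [rowp, fstp]"

lemma eval_fstp: "eval A fstp [z] (p1 z)"
  unfolding fstp_def p1_eq
  by (rule eval_Comp2[OF _ eval_Comp1[OF eval_rowp eval_trip] eval_subp]) (auto intro: eval_Proj)

lemma eval_sndp: "eval A sndp [z] (p2 z)"
  unfolding sndp_def p2_eq by (rule eval_Comp2[OF eval_rowp eval_fstp eval_subp])

section \<open>Functions computable uniformly over a class of oracles\<close>

text \<open>One program serves all oracles in \<open>Zs\<close>. The class is \<open>UNIV\<close>
  for the operator that enumerates the columns, a singleton for a reduction, and \<open>{{}}\<close>
  for plain computability. The class matters in \<open>cf_Least\<close>, whose search has to halt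
  for each of its oracles.\<close>

definition cf :: "nat set set \<Rightarrow> (nat set \<Rightarrow> nat \<Rightarrow> nat) \<Rightarrow> bool" where
  "cf Zs G \<longleftrightarrow> (\<exists>p. \<forall>Z\<in>Zs. \<forall>x. eval Z p [x] (G Z x))"

definition dp :: "nat set set \<Rightarrow> (nat set \<Rightarrow> nat \<Rightarrow> bool) \<Rightarrow> bool" where
  "dp Zs P \<longleftrightarrow> cf Zs (\<lambda>Z x. if P Z x then 1 else 0)"

primrec constp :: "nat \<Rightarrow> recf" where
  "constp 0 = Zero"
| "constp (Suc n) = Comp Succ [constp n]"

lemma eval_constp: "eval A (constp n) xs n"
  by (induction n) (auto intro: ev_zero eval_Comp1 eval_Succ)

lemma cf_id: "cf Zs (\<lambda>Z x. x)"
  unfolding cf_def by (rule exI[of _ "Proj 0"]) (auto intro: eval_Proj)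

lemma cf_const: "cf Zs (\<lambda>Z x. c)"
  unfolding cf_def by (rule exI[of _ "constp c"]) (auto intro: eval_constp)

lemma cf_comp1:
  assumes p: "\<And>A a. eval A p [a] (h a)" and "cf Zs f"
  shows "cf Zs (\<lambda>Z x. h (f Z x))"
proof -
  from assms(2) obtain q where "\<forall>Z\<in>Zs. \<forall>x. eval Z q [x] (f Z x)" unfolding cf_def by blast
  then show ?thesis unfolding cf_def by (intro exI[of _ "Comp p [q]"]) (auto intro!: eval_Comp1 p)
qed

lemma cf_comp2:
  assumes p: "\<And>A a b. eval A p [a, b] (h a b)" and "cf Zs f" "cf Zs g"
  shows "cf Zs (\<lambda>Z x. h (f Z x) (g Z x))"
proof -
  from assms(2,3) obtain q q' where "\<forall>Z\<in>Zs. \<forall>x. eval Z q [x] (f Z x)" "\<forall>Z\<in>Zs. \<forall>x. eval Z q' [x] (g Z x)"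
    unfolding cf_def by blast
  then show ?thesis unfolding cf_def by (intro exI[of _ "Comp p [q, q']"]) (auto intro!: eval_Comp2 p)
qed

lemmas cf_Suc = cf_comp1[OF eval_Succ]
lemmas cf_p1 = cf_comp1[OF eval_fstp]
lemmas cf_p2 = cf_comp1[OF eval_sndp]
lemmas cf_pr = cf_comp2[OF eval_prp]
lemmas cf_add = cf_comp2[OF eval_addp]
lemmas cf_sub = cf_comp2[OF eval_subp]

lemma cf_substitute:
  assumes "cf Zs (\<lambda>Z x. G Z x)" "cf Zs f" shows "cf Zs (\<lambda>Z x. G Z (f Z x))"
proof -
  from assms obtain p q where "\<forall>Z\<in>Zs. \<forall>x. eval Z p [x] (G Z x)" "\<forall>Z\<in>Zs. \<forall>x. eval Z q [x] (f Z x)"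
    unfolding cf_def by blast
  then show ?thesis unfolding cf_def by (intro exI[of _ "Comp p [q]"]) (auto intro!: eval_Comp1)
qed

lemma dp_substitute:
  assumes "dp Zs (\<lambda>Z x. P Z x)" "cf Zs f" shows "dp Zs (\<lambda>Z x. P Z (f Z x))"
  using assms cf_substitute unfolding dp_def by fast

text \<open>Functions are kept unary, so the step function reads argument, counter and previous
  value from nested pairs. Conditionals, bounded quantifiers, finite sets and bounded minimisation
  are all obtained from this recursion.\<close>

lemma cf_rec:
  assumes f: "cf Zs f" and g: "cf Zs (\<lambda>Z w. g Z (p1 (p1 w)) (p2 (p1 w)) (p2 w))" and h: "cf Zs h"
  shows "cf Zs (\<lambda>Z x. rec_nat (f Z x) (\<lambda>n y. g Z x n y) (h Z x))"
proof -
  from f obtain pf where pf: "\<forall>Z\<in>Zs. \<forall>x. eval Z pf [x] (f Z x)" unfolding cf_def by blast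
  from h obtain ph where ph: "\<forall>Z\<in>Zs. \<forall>x. eval Z ph [x] (h Z x)" unfolding cf_def by blast
  from g obtain pg where pg: "\<forall>Z\<in>Zs. \<forall>w. eval Z pg [w] (g Z (p1 (p1 w)) (p2 (p1 w)) (p2 w))"
    unfolding cf_def by blast
  let ?g = "Comp pg [Comp prp [Comp prp [Proj 2, Proj 0], Proj 1]]"
  have "eval Z (Comp (PRec pf ?g) [ph, Proj 0]) [x] (rec_nat (f Z x) (\<lambda>n y. g Z x n y) (h Z x))"
    if Z: "Z \<in> Zs" for Z x
  proof -
    have "eval Z ?g [n, y, x] (g Z x n y)" for n y
    proof -
      have "eval Z (Comp prp [Comp prp [Proj 2, Proj 0], Proj 1]) [n, y, x] (pr (pr x n) y)"
        by (rule eval_Comp2[OF eval_Comp2[OF _ _ eval_prp] _ eval_prp]) (auto intro: eval_Proj)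
      moreover have "eval Z pg [pr (pr x n) y] (g Z x n y)"
        using pg Z by (metis fst_conv prod_encode_inverse snd_conv)
      ultimately show ?thesis by (rule eval_Comp1)
    qed
    then have "eval Z (PRec pf ?g) [h Z x, x] (rec_nat (f Z x) (\<lambda>n y. g Z x n y) (h Z x))"
      using pf Z by (intro eval_PRec[where r = "rec_nat (f Z x) (\<lambda>n y. g Z x n y)"]) auto
    then show ?thesis using ph Z by (auto intro!: eval_Comp2 eval_Proj)
  qed
  then show ?thesis unfolding cf_def by blast
qed

lemma dp_eq: "cf Zs f \<Longrightarrow> cf Zs g \<Longrightarrow> dp Zs (\<lambda>Z x. f Z x = g Z x)"
  unfolding dp_def by (rule cf_comp2[OF eval_eqp])

lemma dp_oracle: "cf Zs f \<Longrightarrow> dp Zs (\<lambda>Z x. f Z x \<in> Z)"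
proof -
  assume "cf Zs f"
  then obtain q where q: "\<forall>Z\<in>Zs. \<forall>x. eval Z q [x] (f Z x)" unfolding cf_def by blast
  have "eval Z Oracle [a] (if a \<in> Z then 1 else 0)" for Z a
    using ev_oracle[of Z "[a]"] by (simp add: arg_def)
  then show ?thesis unfolding dp_def cf_def using q by (intro exI[of _ "Comp Oracle [q]"]) (blast intro: eval_Comp1)
qed

lemma dp_not: "dp Zs P \<Longrightarrow> dp Zs (\<lambda>Z x. \<not> P Z x)"
proof -
  assume "dp Zs P"
  then have "cf Zs (\<lambda>Z x. 1 - (if P Z x then 1 else 0))" unfolding dp_def by (intro cf_sub cf_const)
  moreover have "(\<lambda>Z x. 1 - (if P Z x then 1 else (0::nat))) = (\<lambda>Z x. if \<not> P Z x then 1 else 0)" by (auto simp: fun_eq_iff)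
  ultimately show ?thesis unfolding dp_def by simp
qed

lemma dp_conj: "dp Zs P \<Longrightarrow> dp Zs Q \<Longrightarrow> dp Zs (\<lambda>Z x. P Z x \<and> Q Z x)"
proof -
  assume "dp Zs P" "dp Zs Q"
  then have "cf Zs (\<lambda>Z x. (if P Z x then 1 else 0) + (if Q Z x then 1 else 0) - 1)"
    unfolding dp_def by (intro cf_sub cf_add cf_const)
  moreover have "(\<lambda>Z x. (if P Z x then 1 else 0) + (if Q Z x then 1 else 0) - 1) =
    (\<lambda>Z x. if P Z x \<and> Q Z x then 1 else (0::nat))" by (auto simp: fun_eq_iff)
  ultimately show ?thesis unfolding dp_def by simp
qed

lemma dp_disj: "dp Zs P \<Longrightarrow> dp Zs Q \<Longrightarrow> dp Zs (\<lambda>Z x. P Z x \<or> Q Z x)"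
proof -
  assume "dp Zs P" "dp Zs Q"
  then have "dp Zs (\<lambda>Z x. \<not> (\<not> P Z x \<and> \<not> Q Z x))" by (intro dp_not dp_conj)
  then show ?thesis by simp
qed

lemma dp_imp: "dp Zs P \<Longrightarrow> dp Zs Q \<Longrightarrow> dp Zs (\<lambda>Z x. P Z x \<longrightarrow> Q Z x)"
  unfolding imp_conv_disj by (intro dp_disj dp_not)

lemma dp_iff: "dp Zs P \<Longrightarrow> dp Zs Q \<Longrightarrow> dp Zs (\<lambda>Z x. P Z x \<longleftrightarrow> Q Z x)"
  unfolding iff_conv_conj_imp by (intro dp_conj dp_imp)

lemma dp_le: "cf Zs f \<Longrightarrow> cf Zs g \<Longrightarrow> dp Zs (\<lambda>Z x. f Z x \<le> g Z x)"
proof -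
  assume "cf Zs f" "cf Zs g"
  then have "dp Zs (\<lambda>Z x. f Z x - g Z x = 0)" by (intro dp_eq cf_sub cf_const)
  then show ?thesis by simp
qed

lemma dp_less: "cf Zs f \<Longrightarrow> cf Zs g \<Longrightarrow> dp Zs (\<lambda>Z x. f Z x < g Z x)"
  unfolding not_le[symmetric] by (intro dp_not dp_le)

lemma cf_if: "dp Zs P \<Longrightarrow> cf Zs f \<Longrightarrow> cf Zs g \<Longrightarrow> cf Zs (\<lambda>Z x. if P Z x then f Z x else g Z x)"
proof -
  assume P: "dp Zs P" and f: "cf Zs f" and g: "cf Zs g"
  \<comment> \<open>A conditional is a recursion of length \<open>1\<close> or
    \<open>0\<close>.\<close>
  have "cf Zs (\<lambda>Z x. rec_nat (g Z x) (\<lambda>n y. f Z x) (if P Z x then 1 else 0))"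
    by (rule cf_rec[OF g cf_substitute[OF f cf_p1[OF cf_p1[OF cf_id]]] P[unfolded dp_def]])
  moreover have "(\<lambda>Z x. rec_nat (g Z x) (\<lambda>n y. f Z x) (if P Z x then 1 else 0)) =
    (\<lambda>Z x. if P Z x then f Z x else g Z x)" by (auto simp: fun_eq_iff)
  ultimately show ?thesis by simp
qed

lemma dp_if: "dp Zs P \<Longrightarrow> dp Zs Q \<Longrightarrow> dp Zs R \<Longrightarrow> dp Zs (\<lambda>Z x. if P Z x then Q Z x else R Z x)"
  unfolding if_bool_eq_conj by (intro dp_conj dp_imp dp_not)

lemma cf_cong: "cf Zs f \<Longrightarrow> (\<And>Z x. Z \<in> Zs \<Longrightarrow> f Z x = g Z x) \<Longrightarrow> cf Zs g"
  unfolding cf_def by metis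

lemma dp_ex:
  assumes P: "dp Zs (\<lambda>Z w. P Z (p1 w) (p2 w))" and h: "cf Zs h"
  shows "dp Zs (\<lambda>Z x. \<exists>i<h Z x. P Z x i)"
proof -
  have "cf Zs (\<lambda>Z x. rec_nat 0 (\<lambda>n y. if P Z x n then 1 else y) (h Z x))"
    using dp_substitute[OF P cf_p1[OF cf_id]] by (intro cf_rec cf_const h cf_if cf_p2 cf_id)
  moreover have "rec_nat 0 (\<lambda>n y. if P Z x n then 1 else y) m = (if \<exists>i<m. P Z x i then 1 else (0::nat))" for Z x m
    by (induction m) (auto simp: less_Suc_eq)
  ultimately show ?thesis unfolding dp_def by simp
qed

lemma dp_all:
  assumes P: "dp Zs (\<lambda>Z w. P Z (p1 w) (p2 w))" and h: "cf Zs h"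
  shows "dp Zs (\<lambda>Z x. \<forall>i<h Z x. P Z x i)"
proof -
  have "dp Zs (\<lambda>Z x. \<not> (\<exists>i<h Z x. \<not> P Z x i))" by (intro dp_not dp_ex P h)
  then show ?thesis by simp
qed

lemma cf_pow2: "cf Zs f \<Longrightarrow> cf Zs (\<lambda>Z x. 2 ^ f Z x)"
proof -
  assume f: "cf Zs f"
  have "cf Zs (\<lambda>Z x. rec_nat 1 (\<lambda>n y. y + y) (f Z x))"
    by (intro cf_rec cf_const f cf_add cf_p2 cf_id)
  moreover have "rec_nat 1 (\<lambda>n y. y + y) m = (2 ^ m :: nat)" for m by (induction m) auto
  ultimately show ?thesis by simp
qed

text \<open>Together with \<open>dp_set_decode\<close> this lets finite sets, coded by their
  characteristic bits, be values and parameters of computable functions.\<close>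

lemma cf_set_encode:
  assumes P: "dp Zs (\<lambda>Z w. P Z (p1 w) (p2 w))" and h: "cf Zs h"
  shows "cf Zs (\<lambda>Z x. set_encode {i. i < h Z x \<and> P Z x i})"
proof -
  have "cf Zs (\<lambda>Z x. rec_nat 0 (\<lambda>n y. if P Z x n then 2 ^ n + y else y) (h Z x))"
    using dp_substitute[OF P cf_p1[OF cf_id]] by (intro cf_rec cf_const h cf_if cf_add cf_pow2 cf_p2 cf_p1 cf_id)
  moreover have "rec_nat 0 (\<lambda>n y. if P Z x n then 2 ^ n + y else y) m = set_encode {i. i < m \<and> P Z x i}" for Z x m
  proof (induction m)
    case (Suc m)
    have "{i. i < Suc m \<and> P Z x i} = (if P Z x m then insert m {i. i < m \<and> P Z x i} else {i. i < m \<and> P Z x i})"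
      by (auto simp: less_Suc_eq)
    then show ?case using Suc by (simp add: set_encode_insert)
  qed simp
  ultimately show ?thesis by simp
qed

lemma dp_set_decode:
  assumes f: "cf Zs f" and g: "cf Zs g"
  shows "dp Zs (\<lambda>Z x. f Z x \<in> set_decode (g Z x))"
proof -
  have odd': "rec_nat 0 (\<lambda>n y. 1 - y) m = (if odd m then 1 else (0::nat))" for m by (induction m) auto
  have codd: "dp Zs (\<lambda>Z x. odd (k Z x))" if k: "cf Zs k" for k
  proof -
    have "cf Zs (\<lambda>Z x. rec_nat 0 (\<lambda>n y. 1 - y) (k Z x))"
      by (intro cf_rec cf_const cf_sub k cf_p2 cf_id)
    then show ?thesis unfolding dp_def odd' .
  qed
  have half: "rec_nat 0 (\<lambda>n y. if odd n then Suc y else y) m = m div 2" for m :: nat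
    by (induction m) auto
  have chalf: "cf Zs (\<lambda>Z x. k Z x div 2)" if k: "cf Zs k" for k
  proof -
    have "cf Zs (\<lambda>Z x. rec_nat 0 (\<lambda>n y. if odd n then Suc y else y) (k Z x))"
      by (intro cf_rec cf_const cf_if codd cf_Suc k cf_p1 cf_p2 cf_id)
    then show ?thesis unfolding half .
  qed
  have it: "rec_nat m (\<lambda>n y. y div 2) k = m div 2 ^ k" for m k :: nat
    by (induction k) (auto simp: mult.commute simp flip: div_mult2_eq)
  have "cf Zs (\<lambda>Z x. rec_nat (g Z x) (\<lambda>n y. y div 2) (f Z x))"
    by (intro cf_rec chalf f g cf_p2 cf_id)
  then have "dp Zs (\<lambda>Z x. odd (g Z x div 2 ^ f Z x))" unfolding it by (rule codd)
  then show ?thesis unfolding set_decode_def by simp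
qed

text \<open>The bound doubles as a default value, which makes the operator total. The recursion
  counts upwards until the first success and then stands still.\<close>

lemma cf_bounded_Least:
  assumes P: "dp Zs (\<lambda>Z w. P Z (p1 w) (p2 w))" and h: "cf Zs h"
  shows "cf Zs (\<lambda>Z x. LEAST i. P Z x i \<or> i = h Z x)"
proof -
  have "cf Zs (\<lambda>Z x. rec_nat 0 (\<lambda>n y. if \<exists>i<Suc n. P Z x i then y else Suc y) (h Z x))"
  proof (intro cf_rec cf_const h cf_if)
    have "cf Zs (\<lambda>Z w. pr (p1 (p1 (p1 w))) (p2 w))" by (intro cf_pr cf_p1 cf_p2 cf_id)
    from dp_substitute[OF P this] have "dp Zs (\<lambda>Z w. P Z (p1 (p1 (p1 w))) (p2 w))" by simp
    then show "dp Zs (\<lambda>Z w. \<exists>i<Suc (p2 (p1 w)). P Z (p1 (p1 w)) i)"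
      by (rule dp_ex) (intro cf_Suc cf_p2 cf_p1 cf_id)
  qed (intro cf_p2 cf_p1 cf_id cf_Suc)+
  moreover have "rec_nat 0 (\<lambda>n y. if \<exists>i<Suc n. P Z x i then y else Suc y) m = (LEAST i. P Z x i \<or> i = m)"
    (is "?r m = _") for Z x m
  proof -
    have ne: "(\<forall>i<m. \<not> P Z x i) \<Longrightarrow> ?r m = m" for m by (induction m) (auto simp: less_Suc_eq)
    have ex: "(\<exists>i<m. P Z x i) \<Longrightarrow> ?r m = (LEAST i. P Z x i)" for m
    proof (induction m)
      case (Suc m)
      show ?case
      proof (cases "\<exists>i<m. P Z x i")
        case True then show ?thesis using Suc by auto
      next
        case False
        then have "P Z x m" "?r m = m" using Suc.prems ne by (auto simp: less_Suc_eq)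
        moreover have "(LEAST i. P Z x i) = m"
          using False \<open>P Z x m\<close> by (intro Least_equality) (auto simp: not_less[symmetric])
        ultimately show ?thesis by auto
      qed
    qed simp
    show ?thesis
    proof (cases "\<exists>i<m. P Z x i")
      case True
      then obtain k where k: "k < m" "P Z x k" by blast
      then have l: "P Z x (LEAST i. P Z x i)" "(LEAST i. P Z x i) \<le> k" by (auto intro: LeastI Least_le)
      have "(LEAST i. P Z x i \<or> i = m) = (LEAST i. P Z x i)"
        using l k by (intro Least_equality) (auto intro: Least_le)
      then show ?thesis using ex True by simp
    next
      case False
      then have "(LEAST i. P Z x i \<or> i = m) = m"
        by (intro Least_equality) (auto simp: not_less[symmetric])
      then show ?thesis using ne False by simp
    qed
  qed
  ultimately show ?thesis by simp
qed

lemma cf_Least: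
  assumes P: "dp Zs (\<lambda>Z w. P Z (p1 w) (p2 w))" and ex: "\<And>Z x. Z \<in> Zs \<Longrightarrow> \<exists>i. P Z x i"
  shows "cf Zs (\<lambda>Z x. LEAST i. P Z x i)"
proof -
  from dp_not[OF P] obtain q where q: "\<forall>Z\<in>Zs. \<forall>w. eval Z q [w] (if \<not> P Z (p1 w) (p2 w) then 1 else 0)"
    unfolding dp_def cf_def by blast
  let ?f = "Comp q [Comp prp [Proj 1, Proj 0]]"
  have "eval Z (Mu ?f) [x] (LEAST i. P Z x i)" if Z: "Z \<in> Zs" for Z x
  proof -
    have f: "eval Z ?f [i, x] (if \<not> P Z x i then 1 else 0)" for i
    proof -
      have "eval Z q [pr x i] (if \<not> P Z x i then 1 else 0)"
        using q Z by (metis fst_conv prod_encode_inverse snd_conv)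
      then show ?thesis by (auto intro!: eval_Comp1 eval_Comp2[OF _ _ eval_prp] eval_Proj)
    qed
    have "P Z x (LEAST i. P Z x i)" using ex[OF Z] by (auto intro: LeastI)
    then have "eval Z ?f [LEAST i. P Z x i, x] 0" using f[of "LEAST i. P Z x i"] by simp
    moreover have "\<forall>m<(LEAST i. P Z x i). \<exists>y. eval Z ?f [m, x] y \<and> y \<noteq> 0"
    proof (intro allI impI)
      fix m assume "m < (LEAST i. P Z x i)"
      then have "\<not> P Z x m" by (rule not_less_Least)
      then show "\<exists>y. eval Z ?f [m, x] y \<and> y \<noteq> 0" using f[of m] by auto
    qed
    ultimately show ?thesis by (rule ev_mu)
  qed
  then show ?thesis unfolding cf_def by blast
qed

lemma cf_max: "cf Zs f \<Longrightarrow> cf Zs g \<Longrightarrow> cf Zs (\<lambda>Z x. max (f Z x) (g Z x))"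
  unfolding max_def by (intro cf_if dp_le)

lemma dp_True: "dp Zs (\<lambda>Z x. b)"
  unfolding dp_def by (rule cf_const)

lemmas cf_rules = cf_id cf_const cf_Suc cf_p1 cf_p2 cf_pr cf_add cf_sub cf_if cf_pow2 cf_set_encode
  cf_max dp_True dp_eq dp_oracle dp_not dp_conj dp_disj dp_imp dp_iff dp_le dp_less dp_if dp_ex dp_all
  dp_set_decode

lemma turing_le_dp: "turing_le X Z \<longleftrightarrow> dp {Z} (\<lambda>_ x. x \<in> X)"
  unfolding turing_le_def dp_def cf_def by simp

section \<open>Finite approximations to the evaluation relation\<close>

definition J :: "nat set \<Rightarrow> nat \<Rightarrow> nat \<Rightarrow> nat \<Rightarrow> bool" where
  "J T e xs y \<longleftrightarrow> pr e (pr xs y) \<in> T"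

text \<open>A judgement \<open>J T e xs y\<close> says that the program coded by \<open>e\<close> maps the list coded by \<open>xs\<close> to \<open>y\<close>.
  Two further tags occur besides those of \<open>enc\<close>: \<open>7\<close> evaluates a list of programs to a list of values, and
  \<open>8\<close> asserts that a number codes a program (or a list of programs, tagged by \<open>7\<close>).\<close>

definition is_prog :: "nat set \<Rightarrow> nat \<Rightarrow> bool" where
  "is_prog T c \<longleftrightarrow> ((p1 c = 0 \<or> p1 c = 1 \<or> p1 c = 3) \<and> p2 c = 0
      \<or> p1 c = 2
      \<or> p1 c = 4 \<and> J T (pr 8 (p1 (p2 c))) 0 0 \<and> p1 (p1 (p2 c)) < 7 \<and> J T (pr 8 (pr 7 (p2 (p2 c)))) 0 0
      \<or> p1 c = 5 \<and> J T (pr 8 (p1 (p2 c))) 0 0 \<and> p1 (p1 (p2 c)) < 7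
          \<and> J T (pr 8 (p2 (p2 c))) 0 0 \<and> p1 (p2 (p2 c)) < 7
      \<or> p1 c = 6 \<and> J T (pr 8 (p2 c)) 0 0 \<and> p1 (p2 c) < 7
      \<or> p1 c = 7 \<and> (p2 c = 0 \<or> J T (pr 8 (p1 (p2 c - 1))) 0 0 \<and> p1 (p1 (p2 c - 1)) < 7
          \<and> J T (pr 8 (pr 7 (p2 (p2 c - 1)))) 0 0))"

text \<open>The empty argument list has code \<open>0\<close>, and \<open>0 - 1 = 0\<close> decodes
  to a pair of zeros, so \<open>p1 (xs - 1)\<close> yields the default of \<open>arg\<close> without
  a case split. Recursion has no rule for the empty list, hence its condition
  \<open>xs \<noteq> 0\<close>.\<close>

definition derivable :: "nat set \<Rightarrow> nat set \<Rightarrow> nat \<Rightarrow> nat \<Rightarrow> nat \<Rightarrow> nat \<Rightarrow> bool" where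
  "derivable A T k e xs y \<longleftrightarrow>
     p1 e = 0 \<and> p2 e = 0 \<and> y = 0
   \<or> p1 e = 1 \<and> p2 e = 0 \<and> y = Suc (p1 (xs - 1))
   \<or> p1 e = 2 \<and> (if p2 e = 0 then y = p1 (xs - 1) else J T (pr 2 (p2 e - 1)) (p2 (xs - 1)) y)
   \<or> p1 e = 3 \<and> p2 e = 0 \<and> p1 (xs - 1) < k \<and> y = (if p1 (xs - 1) \<in> A then 1 else 0)
   \<or> p1 e = 4 \<and> (\<exists>ys<k. J T (pr 7 (p2 (p2 e))) xs ys \<and> J T (p1 (p2 e)) ys y)
   \<or> p1 e = 5 \<and> xs \<noteq> 0 \<and>
       (if p1 (xs - 1) = 0 then J T (p1 (p2 e)) (p2 (xs - 1)) y
        else (\<exists>w<k. J T e (Suc (pr (p1 (xs - 1) - 1) (p2 (xs - 1)))) w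
               \<and> J T (p2 (p2 e)) (Suc (pr (p1 (xs - 1) - 1) (Suc (pr w (p2 (xs - 1)))))) y))
   \<or> p1 e = 6 \<and> J T (p2 e) (Suc (pr y xs)) 0 \<and> (\<forall>m<y. \<exists>w<k. w \<noteq> 0 \<and> J T (p2 e) (Suc (pr m xs)) w)
   \<or> p1 e = 7 \<and> (if p2 e = 0 then y = 0
        else y \<noteq> 0 \<and> J T (p1 (p2 e - 1)) xs (p1 (y - 1)) \<and> J T (pr 7 (p2 (p2 e - 1))) xs (p2 (y - 1)))
   \<or> p1 e = 8 \<and> xs = 0 \<and> y = 0 \<and>
       is_prog T (p2 e)"

text \<open>The judgements, the oracle queries and the searches of a stage are all bounded by it, so
  each stage is a finite set computed from a finite part of the oracle.\<close>

primrec sat :: "nat set \<Rightarrow> nat \<Rightarrow> nat set" where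
  "sat A 0 = {}"
| "sat A (Suc k) = {z. z < Suc k \<and> (z \<in> sat A k \<or> derivable A (sat A k) k (p1 z) (p1 (p2 z)) (p2 (p2 z)))}"

lemma sat_less: "z \<in> sat A k \<Longrightarrow> z < k"
  by (cases k) auto

lemma finite_sat [simp]: "finite (sat A k)"
  using sat_less finite_subset[of "sat A k" "{..<k}"] by blast

lemma sat_mono: "k \<le> k' \<Longrightarrow> sat A k \<subseteq> sat A k'"
proof (induction k')
  case (Suc k')
  have "sat A k' \<subseteq> sat A (Suc k')" using sat_less[of _ A k'] by (auto intro: less_SucI)
  then show ?case using Suc le_Suc_eq by blast
qed simp

lemma derivable_local:
  assumes "\<And>x. x < k \<Longrightarrow> x \<in> A \<longleftrightarrow> x \<in> B"
  shows "derivable A T k e xs y \<longleftrightarrow> derivable B T k e xs y"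
proof -
  have "(p1 (xs - 1) < k \<and> y = (if p1 (xs - 1) \<in> A then 1 else 0)) = (p1 (xs - 1) < k \<and> y = (if p1 (xs - 1) \<in> B then 1 else 0))"
    using assms by auto
  then show ?thesis unfolding derivable_def by (simp only:)
qed

lemma sat_local: "(\<And>x. x < k \<Longrightarrow> x \<in> A \<longleftrightarrow> x \<in> B) \<Longrightarrow> sat A k = sat B k"
proof (induction k)
  case (Suc k)
  then have "sat A k = sat B k" by simp
  then show ?case using derivable_local[of k A B] Suc.prems by simp
qed simp

lemma J_mono: "J T e xs y \<Longrightarrow> T \<subseteq> T' \<Longrightarrow> J T' e xs y"
  unfolding J_def by blast

text \<open>\<open>T\<close> occurs only positively and \<open>k\<close> only as an upper bound, so
  truncating the stages can delay a derivation but not destroy it.\<close>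

lemma derivable_mono:
  assumes d: "derivable A T k e xs y" and T: "T \<subseteq> T'" and k: "k \<le> k'"
  shows "derivable A T' k' e xs y"
proof -
  have J: "J T e xs y \<Longrightarrow> J T' e xs y" for e xs y by (rule J_mono[OF _ T])
  have ex: "\<exists>w<k. P w \<Longrightarrow> (\<And>w. P w \<Longrightarrow> Q w) \<Longrightarrow> \<exists>w<k'. Q w" for P Q :: "nat \<Rightarrow> bool"
    using k by (meson less_le_trans)
  consider "p1 e \<notin> {4, 5, 6}" | "p1 e = 4" | "p1 e = 5" | "p1 e = 6" by blast
  then show ?thesis
  proof cases
    case 1
    moreover have "p1 e < 9" using d unfolding derivable_def by (elim disjE conjE) simp_all
    ultimately consider "p1 e = 0" | "p1 e = 1" | "p1 e = 3" | "p1 e = 2" | "p1 e = 7" | "p1 e = 8" by force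
    then show ?thesis
    proof cases
      case 1 then show ?thesis using d unfolding derivable_def by simp
    next
      case 2 then show ?thesis using d unfolding derivable_def by simp
    next
      case 3 then show ?thesis using d k unfolding derivable_def by simp
    next
      case 4
      then have "if p2 e = 0 then y = p1 (xs - 1) else J T (pr 2 (p2 e - 1)) (p2 (xs - 1)) y"
        using d unfolding derivable_def by simp
      then have "if p2 e = 0 then y = p1 (xs - 1) else J T' (pr 2 (p2 e - 1)) (p2 (xs - 1)) y"
        using J by presburger
      then show ?thesis using 4 unfolding derivable_def by simp
    next
      case 5
      then have "if p2 e = 0 then y = 0
        else y \<noteq> 0 \<and> J T (p1 (p2 e - 1)) xs (p1 (y - 1)) \<and> J T (pr 7 (p2 (p2 e - 1))) xs (p2 (y - 1))"
        using d unfolding derivable_def by simp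
      then have "if p2 e = 0 then y = 0
        else y \<noteq> 0 \<and> J T' (p1 (p2 e - 1)) xs (p1 (y - 1)) \<and> J T' (pr 7 (p2 (p2 e - 1))) xs (p2 (y - 1))"
        using J by presburger
      then show ?thesis using 5 unfolding derivable_def by simp
    next
      case 6
      then have 7: "xs = 0" "y = 0" "is_prog T (p2 e)" using d unfolding derivable_def by simp_all
      have "is_prog T' (p2 e)" using 7(3) J unfolding is_prog_def by blast
      then show ?thesis using 6 7 unfolding derivable_def by simp
    qed
  next
    case 2
    then have "\<exists>ys<k. J T (pr 7 (p2 (p2 e))) xs ys \<and> J T (p1 (p2 e)) ys y" using d unfolding derivable_def by simp
    then have "\<exists>ys<k'. J T' (pr 7 (p2 (p2 e))) xs ys \<and> J T' (p1 (p2 e)) ys y" by (rule ex) (use J in blast)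
    then show ?thesis using 2 unfolding derivable_def by simp
  next
    case 3
    show ?thesis
    proof (cases "p1 (xs - 1) = 0")
      case True
      then show ?thesis using 3 d J unfolding derivable_def by auto
    next
      case False
      then have x: "xs \<noteq> 0" "\<exists>w<k. J T e (Suc (pr (p1 (xs - 1) - 1) (p2 (xs - 1)))) w
               \<and> J T (p2 (p2 e)) (Suc (pr (p1 (xs - 1) - 1) (Suc (pr w (p2 (xs - 1)))))) y"
        using 3 d unfolding derivable_def by auto
      from x(2) have "\<exists>w<k'. J T' e (Suc (pr (p1 (xs - 1) - 1) (p2 (xs - 1)))) w
               \<and> J T' (p2 (p2 e)) (Suc (pr (p1 (xs - 1) - 1) (Suc (pr w (p2 (xs - 1)))))) y"
        by (rule ex) (use J in blast)
      then show ?thesis using 3 False x(1) unfolding derivable_def by simp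
    qed
  next
    case 4
    then have x: "J T (p2 e) (Suc (pr y xs)) 0" "\<forall>m<y. \<exists>w<k. w \<noteq> 0 \<and> J T (p2 e) (Suc (pr m xs)) w"
      using d unfolding derivable_def by simp_all
    have "\<forall>m<y. \<exists>w<k'. w \<noteq> 0 \<and> J T' (p2 e) (Suc (pr m xs)) w"
    proof (intro allI impI)
      fix m assume "m < y"
      with x(2) have "\<exists>w<k. w \<noteq> 0 \<and> J T (p2 e) (Suc (pr m xs)) w" by blast
      then show "\<exists>w<k'. w \<noteq> 0 \<and> J T' (p2 e) (Suc (pr m xs)) w" by (rule ex) (use J in blast)
    qed
    then show ?thesis using 4 J[OF x(1)] unfolding derivable_def by simp
  qed
qed

lemma sat_intro: "derivable A (sat A k) k e xs y \<Longrightarrow> \<exists>k'. J (sat A k') e xs y"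
proof -
  assume d: "derivable A (sat A k) k e xs y"
  let ?k = "max k (pr e (pr xs y))"
  have "derivable A (sat A ?k) ?k e xs y" using d sat_mono by (rule derivable_mono) auto
  then have "J (sat A (Suc ?k)) e xs y" unfolding J_def by (simp add: less_Suc_eq_le)
  then show ?thesis by blast
qed

lemma J_sat_mono: "J (sat A k) e xs y \<Longrightarrow> k \<le> k' \<Longrightarrow> J (sat A k') e xs y"
  using J_mono sat_mono by blast

lemma ex_uniform_bound:
  fixes P :: "nat \<Rightarrow> nat \<Rightarrow> bool"
  assumes "\<And>i. i < n \<Longrightarrow> \<exists>k. P i k" and mono: "\<And>i k k'. P i k \<Longrightarrow> k \<le> k' \<Longrightarrow> P i k'"
  shows "\<exists>k. \<forall>i<n. P i k"
  using assms(1)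
proof (induction n)
  case (Suc n)
  then obtain k where k: "\<forall>i<n. P i k" by auto
  obtain k' where "P n k'" using Suc.prems by blast
  then have "\<forall>i<Suc n. P i (max k k')" using k mono by (auto simp: less_Suc_eq)
  then show ?case by blast
qed simp

text \<open>The components of a pair are bounded by its code, so a value derived by stage
  \<open>k\<close> lies within the range of the searches below \<open>k\<close>; bounding them loses
  nothing in the limit.\<close>

lemma J_bounds: "J T e xs y \<Longrightarrow> T \<subseteq> {..<k} \<Longrightarrow> xs < k \<and> y < k"
  unfolding J_def using le_prod_encode_1 le_prod_encode_2
  by (meson le_less_trans lessThan_iff subsetD order_trans)

lemma sat_sub: "sat A k \<subseteq> {..<k}" using sat_less by blast

lemma J_list:
  assumes "length ys = length gs" "\<And>i. i < length gs \<Longrightarrow> \<exists>k. J (sat A k) (enc (gs ! i)) xs (ys ! i)"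
  shows "\<exists>k. J (sat A k) (pr 7 (list_encode (map enc gs))) xs (list_encode ys)"
  using assms
proof (induction gs arbitrary: ys)
  case Nil
  have "derivable A (sat A 0) 0 (pr 7 0) xs 0" unfolding derivable_def by simp
  then show ?case using Nil sat_intro by fastforce
next
  case (Cons g gs)
  then obtain v vs where ys: "ys = v # vs" "length vs = length gs" by (cases ys) auto
  obtain k1 where k1: "J (sat A k1) (enc g) xs v" using Cons.prems(2)[of 0] ys by auto
  have "\<And>i. i < length gs \<Longrightarrow> \<exists>k. J (sat A k) (enc (gs ! i)) xs (vs ! i)"
    using Cons.prems(2)[of "Suc _"] ys by simp
  then obtain k2 where k2: "J (sat A k2) (pr 7 (list_encode (map enc gs))) xs (list_encode vs)"
    using Cons.IH ys(2) by blast
  let ?k = "max k1 k2"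
  have "derivable A (sat A ?k) ?k (pr 7 (list_encode (map enc (g # gs)))) xs (list_encode ys)"
    using J_sat_mono[OF k1, of ?k] J_sat_mono[OF k2, of ?k] ys(1) unfolding derivable_def by simp
  then show ?case by (rule sat_intro)
qed

lemma p_0 [simp]: "p1 0 = 0" "p2 0 = 0"
proof -
  have "prod_decode 0 = (0, 0)" using prod_encode_inverse[of "(0, 0)"] by (simp add: prod_encode_def)
  then show "p1 0 = 0" "p2 0 = 0" by simp_all
qed

lemma p1_list: "p1 (list_encode xs - 1) = arg 0 xs"
  by (cases xs) (auto simp: arg_def)

lemma p2_list: "p2 (list_encode xs - 1) = list_encode (tl xs)"
  by (cases xs) auto

lemma J_Proj: "\<exists>k. J (sat A k) (enc (Proj i)) (list_encode xs) (arg i xs)"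
proof (induction i arbitrary: xs)
  case 0
  have "derivable A (sat A 0) 0 (enc (Proj 0)) (list_encode xs) (arg 0 xs)"
    unfolding derivable_def p1_list by simp
  then show ?case by (rule sat_intro)
next
  case (Suc i)
  obtain k where k: "J (sat A k) (enc (Proj i)) (list_encode (tl xs)) (arg i (tl xs))" using Suc by blast
  have "arg (Suc i) xs = arg i (tl xs)" by (cases xs) (auto simp: arg_def)
  then have "derivable A (sat A k) k (enc (Proj (Suc i))) (list_encode xs) (arg (Suc i) xs)"
    using k unfolding derivable_def p2_list by simp
  then show ?case by (rule sat_intro)
qed

lemma sat_complete: "eval A p xs y \<Longrightarrow> \<exists>k. J (sat A k) (enc p) (list_encode xs) y"
proof (induction rule: eval.induct)
  case (ev_zero xs)
  have "derivable A (sat A 0) 0 (enc Zero) (list_encode xs) 0" unfolding derivable_def by simp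
  then show ?case by (rule sat_intro)
next
  case (ev_succ xs)
  have "derivable A (sat A 0) 0 (enc Succ) (list_encode xs) (Suc (arg 0 xs))"
    unfolding derivable_def p1_list by simp
  then show ?case by (rule sat_intro)
next
  case (ev_proj i xs) then show ?case by (rule J_Proj)
next
  case (ev_oracle xs)
  let ?k = "Suc (arg 0 xs)"
  have "derivable A (sat A ?k) ?k (enc Oracle) (list_encode xs) (if arg 0 xs \<in> A then 1 else 0)"
    unfolding derivable_def p1_list by (simp del: sat.simps)
  then show ?case by (rule sat_intro)
next
  case (ev_comp ys gs xs f z)
  have "\<exists>k. J (sat A k) (pr 7 (list_encode (map enc gs))) (list_encode xs) (list_encode ys)"
    using ev_comp by (intro J_list) auto
  then obtain k1 where k1: "J (sat A k1) (pr 7 (list_encode (map enc gs))) (list_encode xs) (list_encode ys)" by blast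
  from ev_comp obtain k2 where k2: "J (sat A k2) (enc f) (list_encode ys) z" by blast
  let ?k = "max k1 k2"
  have J: "J (sat A ?k) (pr 7 (list_encode (map enc gs))) (list_encode xs) (list_encode ys)"
    "J (sat A ?k) (enc f) (list_encode ys) z"
    using J_sat_mono[OF k1, of ?k] J_sat_mono[OF k2, of ?k] by simp_all
  moreover have "list_encode ys < ?k" using J_bounds[OF J(2) sat_sub] by blast
  ultimately have "derivable A (sat A ?k) ?k (enc (Comp f gs)) (list_encode xs) z"
    unfolding derivable_def by (auto simp: enc_list_eq simp del: max_less_iff_conj)
  then show ?case by (rule sat_intro)
next
  case (ev_prec0 f xs y g)
  then obtain k where "J (sat A k) (enc f) (list_encode xs) y" by blast
  then have "derivable A (sat A k) k (enc (PRec f g)) (list_encode (0 # xs)) y"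
    unfolding derivable_def by simp
  then show ?case by (rule sat_intro)
next
  case (ev_precS f g n xs y z)
  then obtain k1 k2 where k1: "J (sat A k1) (enc (PRec f g)) (list_encode (n # xs)) y"
    and k2: "J (sat A k2) (enc g) (list_encode (n # y # xs)) z" by blast
  let ?k = "max k1 k2"
  have J: "J (sat A ?k) (enc (PRec f g)) (list_encode (n # xs)) y" "J (sat A ?k) (enc g) (list_encode (n # y # xs)) z"
    using J_sat_mono[OF k1, of ?k] J_sat_mono[OF k2, of ?k] by simp_all
  moreover have "y < ?k" using J_bounds[OF J(1) sat_sub] by blast
  ultimately have "derivable A (sat A ?k) ?k (enc (PRec f g)) (list_encode (Suc n # xs)) z"
    unfolding derivable_def by (auto simp del: max_less_iff_conj)
  then show ?case by (rule sat_intro)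
next
  case (ev_mu f n xs)
  then obtain k1 where k1: "J (sat A k1) (enc f) (list_encode (n # xs)) 0" by blast
  have "\<exists>k. \<forall>m<n. \<exists>w<k. w \<noteq> 0 \<and> J (sat A k) (enc f) (list_encode (m # xs)) w"
  proof (rule ex_uniform_bound)
    fix m assume "m < n"
    then obtain w k where "w \<noteq> 0" "J (sat A k) (enc f) (list_encode (m # xs)) w" using ev_mu by blast
    then show "\<exists>k. \<exists>w<k. w \<noteq> 0 \<and> J (sat A k) (enc f) (list_encode (m # xs)) w"
      using J_bounds[OF _ sat_sub] by blast
  qed (meson J_sat_mono less_le_trans)
  then obtain k2 where k2: "\<forall>m<n. \<exists>w<k2. w \<noteq> 0 \<and> J (sat A k2) (enc f) (list_encode (m # xs)) w" by blast
  let ?k = "max k1 k2"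
  have "\<forall>m<n. \<exists>w<?k. w \<noteq> 0 \<and> J (sat A ?k) (enc f) (list_encode (m # xs)) w"
    using k2 by (meson J_sat_mono less_le_trans max.cobounded2)
  then have "derivable A (sat A ?k) ?k (enc (Mu f)) (list_encode xs) n"
    using J_sat_mono[OF k1, of ?k] unfolding derivable_def by (simp del: max_less_iff_conj)
  then show ?case by (rule sat_intro)
qed

section \<open>Soundness of the approximations\<close>

definition means :: "nat set \<Rightarrow> nat \<Rightarrow> nat \<Rightarrow> nat \<Rightarrow> bool" where
  "means A e xs y \<longleftrightarrow>
     (\<forall>p. e = enc p \<longrightarrow> eval A p (list_decode xs) y)
   \<and> (\<forall>gs. e = pr 7 (list_encode (map enc gs)) \<longrightarrow> length (list_decode y) = length gs \<and>
        (\<forall>i<length gs. eval A (gs ! i) (list_decode xs) (list_decode y ! i)))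
   \<and> (\<forall>c. e = pr 8 c \<longrightarrow> (\<exists>p. c = enc p) \<or> (\<exists>gs. c = pr 7 (list_encode (map enc gs))))"

lemma p1_enc: "p1 (enc p) < 7" by (cases p) auto

text \<open>Numbers that code neither a program, nor a list, nor a tag \<open>8\<close> assertion
  satisfy \<open>means\<close> vacuously, so the induction over stages never has to know that a code
  is well formed.\<close>

lemma derivable_means:
  assumes d: "derivable A T k e xs y" and T: "\<And>e xs y. J T e xs y \<Longrightarrow> means A e xs y"
  shows "means A e xs y"
  unfolding means_def
proof (intro conjI allI impI)
  have P: "J T (enc p) xs y \<Longrightarrow> eval A p (list_decode xs) y" for p xs y
    using T unfolding means_def by blast
  have L: "J T (pr 7 (list_encode (map enc gs))) xs y \<Longrightarrow> length (list_decode y) = length gs \<and>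
        (\<forall>i<length gs. eval A (gs ! i) (list_decode xs) (list_decode y ! i))" for gs xs y
    using T unfolding means_def by blast
  have V: "J T (pr 8 c) 0 0 \<Longrightarrow> (\<exists>p. c = enc p) \<or> (\<exists>gs. c = pr 7 (list_encode (map enc gs)))" for c
    using T unfolding means_def by blast
  have V1: "J T (pr 8 c) 0 0 \<Longrightarrow> p1 c < 7 \<Longrightarrow> \<exists>p. c = enc p" for c using V by fastforce
  \<comment> \<open>Programs have tags below \<open>7\<close>, so a validated code with tag
    \<open>7\<close> can only be a list.\<close>
  have V2: "J T (pr 8 (pr 7 c)) 0 0 \<Longrightarrow> \<exists>gs. c = list_encode (map enc gs)" for c
  proof -
    assume "J T (pr 8 (pr 7 c)) 0 0"
    then have "(\<exists>p. pr 7 c = enc p) \<or> (\<exists>gs. pr 7 c = pr 7 (list_encode (map enc gs)))" by (rule V)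
    moreover have "pr 7 c \<noteq> enc p" for p using p1_enc[of p] by (metis fst_conv less_irrefl prod_encode_inverse)
    ultimately show ?thesis by auto
  qed
  have hd: "p1 (xs - Suc 0) = arg 0 (list_decode xs)" using p1_list[of "list_decode xs"] by simp
  {
    fix p assume e: "e = enc p"
    show "eval A p (list_decode xs) y"
    proof (cases p)
      case Zero then show ?thesis using d e by (auto simp: derivable_def intro: ev_zero)
    next
      case Succ
      then have "y = Suc (arg 0 (list_decode xs))" using d e by (auto simp: derivable_def hd)
      then show ?thesis using Succ ev_succ by simp
    next
      case (Proj i)
      have "y = arg i (list_decode xs)"
      proof (cases i)
        case 0 then show ?thesis using d e Proj by (auto simp: derivable_def hd)
      next
        case (Suc j)
        then have "J T (enc (Proj j)) (p2 (xs - 1)) y" using d e Proj by (auto simp: derivable_def)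
        then have "eval A (Proj j) (list_decode (p2 (xs - 1))) y" by (rule P)
        then have "y = arg j (list_decode (p2 (xs - 1)))" by (auto elim: evProjE)
        moreover have "list_decode (p2 (xs - 1)) = tl (list_decode xs)"
          by (cases xs) (auto simp: case_prod_beta)
        ultimately show ?thesis using Suc by (cases "list_decode xs") (auto simp: arg_def)
      qed
      then show ?thesis using Proj ev_proj by simp
    next
      case Oracle
      then have "y = (if arg 0 (list_decode xs) \<in> A then 1 else 0)" using d e by (auto simp: derivable_def hd)
      then show ?thesis using Oracle ev_oracle by simp
    next
      case (Comp f gs)
      then obtain ys where "J T (pr 7 (list_encode (map enc gs))) xs ys" "J T (enc f) ys y"
        using d e by (auto simp: derivable_def enc_list_eq)
      then have "eval A (Comp f gs) (list_decode xs) y"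
        using L[of gs xs ys] P[of f ys y] by (intro ev_comp[of "list_decode ys"]) auto
      then show ?thesis using Comp by simp
    next
      case (PRec f g)
      then have xs: "xs \<noteq> 0" using d e by (auto simp: derivable_def)
      define n r where "n = p1 (xs - 1)" and "r = p2 (xs - 1)"
      have xs': "xs = Suc (pr n r)" using xs unfolding n_def r_def by (cases xs) auto
      then have lx: "list_decode xs = n # list_decode r" by simp
      show ?thesis
      proof (cases n)
        case 0
        then have "J T (enc f) r y" using d e PRec xs' by (auto simp: derivable_def)
        then show ?thesis using P PRec lx 0 by (auto intro: ev_prec0)
      next
        case (Suc m)
        then obtain w where "J T (enc (PRec f g)) (Suc (pr m r)) w" "J T (enc g) (Suc (pr m (Suc (pr w r)))) y"
          using d e PRec xs' by (auto simp: derivable_def)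
        from P[OF this(1)] P[OF this(2)] show ?thesis using PRec lx Suc by (auto intro: ev_precS)
      qed
    next
      case (Mu f)
      then have 1: "J T (enc f) (Suc (pr y xs)) 0" "\<forall>m<y. \<exists>w. w \<noteq> 0 \<and> J T (enc f) (Suc (pr m xs)) w"
        using d e by (auto simp: derivable_def)
      have "\<forall>m<y. \<exists>w. eval A f (m # list_decode xs) w \<and> w \<noteq> 0"
      proof (intro allI impI)
        fix m assume "m < y"
        with 1(2) obtain w where "w \<noteq> 0" "J T (enc f) (Suc (pr m xs)) w" by blast
        with P[OF this(2)] show "\<exists>w. eval A f (m # list_decode xs) w \<and> w \<noteq> 0" by auto
      qed
      then show ?thesis using P[OF 1(1)] Mu by (auto intro: ev_mu)
    qed
  }
  {
    fix gs assume e: "e = pr 7 (list_encode (map enc gs))"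
    have "length (list_decode y) = length gs \<and>
        (\<forall>i<length gs. eval A (gs ! i) (list_decode xs) (list_decode y ! i))"
    proof (cases gs)
      case Nil then show ?thesis using d e by (auto simp: derivable_def)
    next
      case (Cons g hs)
      then have 1: "y \<noteq> 0" "J T (enc g) xs (p1 (y - 1))" "J T (pr 7 (list_encode (map enc hs))) xs (p2 (y - 1))"
        using d e by (auto simp: derivable_def)
      have ly: "list_decode y = p1 (y - 1) # list_decode (p2 (y - 1))"
        using 1(1) by (cases y) (auto simp: case_prod_beta)
      show ?thesis
        using P[OF 1(2)] L[OF 1(3)] Cons ly by (auto simp: nth_Cons split: nat.split)
    qed
    then show "length (list_decode y) = length gs"
      and "\<And>i. i < length gs \<Longrightarrow> eval A (gs ! i) (list_decode xs) (list_decode y ! i)" by auto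
  }
  {
    fix c assume e: "e = pr 8 c"
    have c: "c = pr (p1 c) (p2 c)" by simp
    consider "p1 c = 0" "p2 c = 0" | "p1 c = 1" "p2 c = 0" | "p1 c = 3" "p2 c = 0" | "p1 c = 2"
      | "p1 c = 4" "J T (pr 8 (p1 (p2 c))) 0 0" "p1 (p1 (p2 c)) < 7" "J T (pr 8 (pr 7 (p2 (p2 c)))) 0 0"
      | "p1 c = 5" "J T (pr 8 (p1 (p2 c))) 0 0" "p1 (p1 (p2 c)) < 7" "J T (pr 8 (p2 (p2 c))) 0 0" "p1 (p2 (p2 c)) < 7"
      | "p1 c = 6" "J T (pr 8 (p2 c)) 0 0" "p1 (p2 c) < 7"
      | "p1 c = 7" "p2 c = 0"
      | "p1 c = 7" "p2 c \<noteq> 0" "J T (pr 8 (p1 (p2 c - 1))) 0 0" "p1 (p1 (p2 c - 1)) < 7" "J T (pr 8 (pr 7 (p2 (p2 c - 1)))) 0 0"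
      using d e by (auto simp: derivable_def is_prog_def)
    then show "(\<exists>p. c = enc p) \<or> (\<exists>gs. c = pr 7 (list_encode (map enc gs)))"
    proof cases
      case 1 then have "c = enc Zero" using c by simp then show ?thesis by blast
    next
      case 2 then have "c = enc Succ" using c by simp then show ?thesis by blast
    next
      case 3 then have "c = enc Oracle" using c by simp then show ?thesis by blast
    next
      case 4 then have "c = enc (Proj (p2 c))" using c by simp then show ?thesis by blast
    next
      case 5
      then obtain f gs where f: "p1 (p2 c) = enc f" and gs: "p2 (p2 c) = list_encode (map enc gs)"
        using V1 V2 by meson
      have "c = pr 4 (pr (p1 (p2 c)) (p2 (p2 c)))" using 5(1) c by simp
      then have "c = enc (Comp f gs)" unfolding f gs by (simp add: enc_list_eq)
      then show ?thesis by blast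
    next
      case 6
      then obtain f g where f: "p1 (p2 c) = enc f" and g: "p2 (p2 c) = enc g" using V1 by meson
      have "c = pr 5 (pr (p1 (p2 c)) (p2 (p2 c)))" using 6(1) c by simp
      then have "c = enc (PRec f g)" unfolding f g by simp
      then show ?thesis by blast
    next
      case 7
      then obtain f where f: "p2 c = enc f" using V1 by meson
      have "c = enc (Mu f)" using c 7(1) f by simp
      then show ?thesis by blast
    next
      case 8
      then have "c = pr 7 (list_encode (map enc []))" using c by simp
      then show ?thesis by blast
    next
      case 9
      then obtain g gs where g: "p1 (p2 c - 1) = enc g" and gs: "p2 (p2 c - 1) = list_encode (map enc gs)"
        using V1 V2 by meson
      have "p2 c = Suc (pr (p1 (p2 c - 1)) (p2 (p2 c - 1)))" using 9(2) by simp
      then have "p2 c = list_encode (map enc (g # gs))" unfolding g gs by simp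
      then have "c = pr 7 (list_encode (map enc (g # gs)))" using 9(1) c by simp
      then show ?thesis by blast
    qed
  }
qed

lemma sat_means: "J (sat A k) e xs y \<Longrightarrow> means A e xs y"
proof (induction k arbitrary: e xs y)
  case (Suc k)
  then have "J (sat A k) e xs y \<or> derivable A (sat A k) k e xs y" unfolding J_def by simp
  then show ?case using Suc.IH derivable_means by blast
qed (simp add: J_def)

lemma sat_sound: "J (sat A k) (enc p) (list_encode xs) y \<Longrightarrow> eval A p xs y"
  using sat_means unfolding means_def by fastforce

text \<open>A malformed code may also have derivable judgements, for instance a recursion evaluated
  at \<open>0\<close> whose step part is arbitrary, whereas \<open>W\<close> is empty at such a
  code. The tag \<open>8\<close> test separates the two.\<close>

lemma sat_prog_sound: "J (sat A k) (pr 8 c) 0 0 \<Longrightarrow> p1 c < 7 \<Longrightarrow> \<exists>p. c = enc p"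
  using sat_means[of A k "pr 8 c" 0 0] unfolding means_def by fastforce

lemma sat_prog_list:
  assumes "\<And>g. g \<in> set gs \<Longrightarrow> \<exists>k. J (sat A k) (pr 8 (enc g)) 0 0"
  shows "\<exists>k. J (sat A k) (pr 8 (pr 7 (list_encode (map enc gs)))) 0 0"
  using assms
proof (induction gs)
  case Nil
  have "derivable A (sat A 0) 0 (pr 8 (pr 7 0)) 0 0" unfolding derivable_def is_prog_def by simp
  then show ?case using sat_intro by fastforce
next
  case (Cons g gs)
  obtain k1 k2 where k1: "J (sat A k1) (pr 8 (enc g)) 0 0"
    and k2: "J (sat A k2) (pr 8 (pr 7 (list_encode (map enc gs)))) 0 0"
    using Cons by force
  have "derivable A (sat A (max k1 k2)) (max k1 k2) (pr 8 (pr 7 (list_encode (map enc (g # gs))))) 0 0"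
    using J_sat_mono[OF k1, of "max k1 k2"] J_sat_mono[OF k2, of "max k1 k2"] p1_enc[of g]
    unfolding derivable_def is_prog_def by simp
  then show ?case by (rule sat_intro)
qed

lemma sat_prog_complete: "\<exists>k. J (sat A k) (pr 8 (enc p)) 0 0"
proof (induction p)
  case Zero
  have "derivable A (sat A 0) 0 (pr 8 (enc Zero)) 0 0" unfolding derivable_def is_prog_def by simp
  then show ?case by (rule sat_intro)
next
  case Succ
  have "derivable A (sat A 0) 0 (pr 8 (enc Succ)) 0 0" unfolding derivable_def is_prog_def by simp
  then show ?case by (rule sat_intro)
next
  case (Proj i)
  have "derivable A (sat A 0) 0 (pr 8 (enc (Proj i))) 0 0" unfolding derivable_def is_prog_def by simp
  then show ?case by (rule sat_intro)
next
  case Oracle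
  have "derivable A (sat A 0) 0 (pr 8 (enc Oracle)) 0 0" unfolding derivable_def is_prog_def by simp
  then show ?case by (rule sat_intro)
next
  case (Comp f gs)
  obtain k1 where k1: "J (sat A k1) (pr 8 (enc f)) 0 0" using Comp by blast
  obtain k2 where k2: "J (sat A k2) (pr 8 (pr 7 (list_encode (map enc gs)))) 0 0"
    using sat_prog_list Comp by blast
  have "derivable A (sat A (max k1 k2)) (max k1 k2) (pr 8 (enc (Comp f gs))) 0 0"
    using J_sat_mono[OF k1, of "max k1 k2"] J_sat_mono[OF k2, of "max k1 k2"] p1_enc[of f]
    unfolding derivable_def is_prog_def by (simp add: enc_list_eq)
  then show ?case by (rule sat_intro)
next
  case (PRec f g)
  then obtain k1 k2 where k1: "J (sat A k1) (pr 8 (enc f)) 0 0" and k2: "J (sat A k2) (pr 8 (enc g)) 0 0" by blast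
  have "derivable A (sat A (max k1 k2)) (max k1 k2) (pr 8 (enc (PRec f g))) 0 0"
    using J_sat_mono[OF k1, of "max k1 k2"] J_sat_mono[OF k2, of "max k1 k2"] p1_enc
    unfolding derivable_def is_prog_def by simp
  then show ?case by (rule sat_intro)
next
  case (Mu f)
  then obtain k where "J (sat A k) (pr 8 (enc f)) 0 0" by blast
  then have "derivable A (sat A k) k (pr 8 (enc (Mu f))) 0 0" using p1_enc unfolding derivable_def is_prog_def by simp
  then show ?case by (rule sat_intro)
qed

section \<open>Stage approximations to the halting set\<close>

definition Kst :: "nat \<Rightarrow> nat set" where
  "Kst s = {e. e < s \<and> p1 e < 7 \<and> J (sat {} s) (pr 8 e) 0 0 \<and> (\<exists>y<s. J (sat {} s) e (Suc (pr e 0)) y)}"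

lemma halting_iff: "e \<in> halting_set \<longleftrightarrow> (\<exists>s. e \<in> Kst s)"
proof
  assume "e \<in> halting_set"
  then obtain p y where e: "e = enc p" and "eval {} p [e] y" unfolding halting_set_def W_def by auto
  then obtain k1 where k1: "J (sat {} k1) e (Suc (pr e 0)) y" using sat_complete by fastforce
  obtain k2 where k2: "J (sat {} k2) (pr 8 e) 0 0" using sat_prog_complete e by blast
  let ?k = "Suc (max k1 (max k2 e))"
  have "J (sat {} ?k) e (Suc (pr e 0)) y" by (rule J_sat_mono[OF k1]) auto
  moreover from this have "y < ?k" using J_bounds sat_sub by blast
  moreover have "J (sat {} ?k) (pr 8 e) 0 0" by (rule J_sat_mono[OF k2]) auto
  moreover have "e < ?k" by auto
  ultimately have "e \<in> Kst ?k" using p1_enc e unfolding Kst_def by blast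
  then show "\<exists>s. e \<in> Kst s" by blast
next
  assume "\<exists>s. e \<in> Kst s"
  then obtain s y where "p1 e < 7" "J (sat {} s) (pr 8 e) 0 0" "J (sat {} s) e (Suc (pr e 0)) y"
    unfolding Kst_def by blast
  moreover from this obtain p where "e = enc p" using sat_prog_sound by blast
  ultimately have "eval {} p [e] y" using sat_sound[of "{}" s p "[e]" y] by simp
  then show "e \<in> halting_set" unfolding halting_set_def W_def using \<open>e = enc p\<close> by blast
qed

lemma Kst_mono: "s \<le> s' \<Longrightarrow> Kst s \<subseteq> Kst s'"
  unfolding Kst_def using J_sat_mono by (auto intro: less_le_trans)

lemma finite_Kst [simp]: "finite (Kst s)"
  unfolding Kst_def by simp

lemma Kst_converges: "\<exists>s0. \<forall>s\<ge>s0. \<forall>x<k. x \<in> Kst s \<longleftrightarrow> x \<in> halting_set"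
proof -
  have "\<exists>s0. \<forall>x<k. \<forall>s\<ge>s0. x \<in> Kst s \<longleftrightarrow> x \<in> halting_set"
  proof (rule ex_uniform_bound)
    fix x show "\<exists>s0. \<forall>s\<ge>s0. x \<in> Kst s \<longleftrightarrow> x \<in> halting_set"
      using halting_iff Kst_mono by (metis subsetD)
  qed auto
  then show ?thesis by blast
qed

text \<open>A convergent computation consults a finite part of the oracle, and on it
  \<open>Kst s\<close> is eventually correct. Early stages may derive wrong values.\<close>

lemma sat_Kst_complete:
  assumes "eval halting_set q xs v"
  shows "\<exists>s0. \<forall>s\<ge>s0. J (sat (Kst s) s) (enc q) (list_encode xs) v"
proof -
  obtain k where k: "J (sat halting_set k) (enc q) (list_encode xs) v" using sat_complete assms by blast
  obtain s0 where s0: "\<forall>s\<ge>s0. \<forall>x<k. x \<in> Kst s \<longleftrightarrow> x \<in> halting_set" using Kst_converges by blast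
  have "J (sat (Kst s) s) (enc q) (list_encode xs) v" if "s \<ge> max s0 k" for s
  proof -
    have "sat halting_set k = sat (Kst s) k" using s0 that by (intro sat_local) auto
    then show ?thesis using k that J_sat_mono by auto
  qed
  then show ?thesis by blast
qed

section \<open>Computability of the approximations\<close>

lemma dp_derivable:
  assumes a: "cf Zs a" and t: "cf Zs t" and k: "cf Zs k" and e: "cf Zs e" and xs: "cf Zs xs" and y: "cf Zs y"
  shows "dp Zs (\<lambda>Z x. derivable (set_decode (a Z x)) (set_decode (t Z x)) (k Z x) (e Z x) (xs Z x) (y Z x))"
proof -
  let ?a = "\<lambda>x. p1 x" and ?t = "\<lambda>x. p1 (p2 x)" and ?k = "\<lambda>x. p1 (p2 (p2 x))"
    and ?e = "\<lambda>x. p1 (p2 (p2 (p2 x)))" and ?xs = "\<lambda>x. p1 (p2 (p2 (p2 (p2 x))))" and ?y = "\<lambda>x. p2 (p2 (p2 (p2 (p2 x))))"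
  \<comment> \<open>With all parameters as projections of one number, \<open>cf_rules\<close>
    decides the formula by its syntax; the actual parameters enter by substitution. The same pattern
    serves for the construction.\<close>
  have "dp Zs (\<lambda>Z x. derivable (set_decode (?a x)) (set_decode (?t x)) (?k x) (?e x) (?xs x) (?y x))"
    unfolding derivable_def is_prog_def J_def by (intro cf_rules)
  from dp_substitute[OF this, of "\<lambda>Z x. pr (a Z x) (pr (t Z x) (pr (k Z x) (pr (e Z x) (pr (xs Z x) (y Z x)))))"]
  show ?thesis by (simp add: cf_pr assms)
qed

lemma cf_sat:
  assumes a: "cf Zs a" and k: "cf Zs k"
  shows "cf Zs (\<lambda>Z x. set_encode (sat (set_decode (a Z x)) (k Z x)))"
proof -
  let ?g = "\<lambda>x k t. set_encode {z. z < Suc k \<and> (z \<in> set_decode t \<or>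
    derivable (set_decode (p1 x)) (set_decode t) k (p1 z) (p1 (p2 z)) (p2 (p2 z)))}"
  have "cf Zs (\<lambda>Z x. rec_nat 0 (\<lambda>k t. ?g x k t) (p2 x))"
    by (intro cf_rec cf_const cf_p2 cf_id cf_rules dp_derivable)
  moreover have "rec_nat 0 (\<lambda>k t. ?g x k t) k = set_encode (sat (set_decode (p1 x)) k)" for x k
  proof (induction k)
    case (Suc k)
    then show ?case by simp
  qed simp
  ultimately have "cf Zs (\<lambda>Z x. set_encode (sat (set_decode (p1 x)) (p2 x)))" by simp
  from cf_substitute[OF this cf_pr[OF assms]] show ?thesis by simp
qed

lemma dp_J_sat:
  assumes "cf Zs a" "cf Zs k" "cf Zs e" "cf Zs xs" "cf Zs y"
  shows "dp Zs (\<lambda>Z x. J (sat (set_decode (a Z x)) (k Z x)) (e Z x) (xs Z x) (y Z x))"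
proof -
  have "dp Zs (\<lambda>Z x. pr (e Z x) (pr (xs Z x) (y Z x)) \<in> set_decode (set_encode (sat (set_decode (a Z x)) (k Z x))))"
    by (intro cf_rules cf_sat assms)
  then show ?thesis unfolding J_def by simp
qed

lemma cf_Kst:
  assumes "cf Zs s" shows "cf Zs (\<lambda>Z x. set_encode (Kst (s Z x)))"
proof -
  have 1: "cf Zs (\<lambda>Z x. set_encode {e. e < x \<and> p1 e < 7 \<and> J (sat (set_decode 0) x) (pr 8 e) 0 0 \<and>
      (\<exists>y<x. J (sat (set_decode 0) x) e (Suc (pr e 0)) y)})"
    by (intro cf_rules dp_J_sat)
  from cf_substitute[OF 1 assms] show ?thesis unfolding Kst_def by simp
qed

section \<open>The construction\<close>

text \<open>In the definitions below \<open>A\<close> is the oracle (the part of \<open>C\<close> already built, or a guess at it) and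
  \<open>H\<close> is the table of what the whole construction enumerates from finite guesses:
  \<open>\<langle>s, \<langle>a, z\<rangle>\<rangle> \<in> H\<close> means that \<open>z\<close> is enumerated at stage \<open>s\<close> when the oracle below \<open>s\<close> has code \<open>a\<close>.
  Stage \<open>s\<close> consults \<open>H\<close> only at stages below \<open>s\<close>, which replaces the recursion theorem.

  A block for \<open>r = \<langle>\<Phi>, \<Psi>\<rangle>\<close> with base column \<open>n\<close> uses column \<open>n\<close> to diagonalise against \<open>\<Phi>\<close> as a
  computation of \<open>C\<close>; column \<open>n + 1\<close> for the matrix \<open>D\<close> of its search process; column \<open>n + 2\<close> for the rows
  of \<open>D\<close> with a hole; and column \<open>n + 3\<close> to record (by \<open>0\<close>) whether some row has no hole.
  A candidate \<open>F\<close> is an initial segment of \<open>C\<close> of length \<open>s\<close> under the assumption that exactly the rows from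
  \<open>p\<close> on will be full.\<close>

definition conv :: "nat set \<Rightarrow> nat \<Rightarrow> nat \<Rightarrow> nat set \<Rightarrow> bool" where
  "conv T e p U \<longleftrightarrow> (\<forall>x<p. J T e (Suc (pr x 0)) (if x \<in> U then 1 else 0))"

definition cand :: "nat set \<Rightarrow> nat set \<Rightarrow> nat \<Rightarrow> nat \<Rightarrow> nat \<Rightarrow> nat set \<Rightarrow> nat set \<Rightarrow> bool" where
  "cand H A n s p D F \<longleftrightarrow> (\<forall>z<s.
      (p1 z \<le> n \<longrightarrow> (z \<in> F \<longleftrightarrow> z \<in> A))
    \<and> (p1 z = n + 1 \<longrightarrow> (z \<in> F \<longleftrightarrow> p \<le> p1 (p2 z) \<or> p2 z \<in> D))
    \<and> (p1 z = n + 2 \<longrightarrow> (z \<in> F \<longleftrightarrow> p2 z < p))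
    \<and> (p1 z = n + 3 \<longrightarrow> (z \<in> F \<longleftrightarrow> p2 z = 0))
    \<and> (n + 4 \<le> p1 z \<longrightarrow> (\<forall>s'<s. z < s' \<and> pr s' (pr (set_encode {i. i < s' \<and> i \<in> F}) z) \<in> H \<longrightarrow> z \<in> F)))"

text \<open>A state of the search process consists of the confirmed level \<open>j\<close>, the stage \<open>tj\<close> at which the attempt that
  confirmed it began and its witness \<open>wj\<close>, the stage \<open>t\<close> at which the current attempt began, the current
  witness \<open>w\<close>, and the code of the finite set \<open>D\<close>. A witness is \<open>0\<close> (none) or \<open>Suc \<langle>F, \<langle>s, U\<rangle>\<rangle>\<close>, where the
  candidate \<open>F\<close> of length \<open>s\<close> makes \<open>\<Phi>\<close> compute \<open>U\<close>.\<close>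

abbreviation "mk j tj wj t w D \<equiv> pr j (pr tj (pr wj (pr t (pr w D))))"
abbreviation "sj x \<equiv> p1 x"
abbreviation "stj x \<equiv> p1 (p2 x)"
abbreviation "swj x \<equiv> p1 (p2 (p2 x))"
abbreviation "stt x \<equiv> p1 (p2 (p2 (p2 x)))"
abbreviation "sw x \<equiv> p1 (p2 (p2 (p2 (p2 x))))"
abbreviation "sD x \<equiv> p2 (p2 (p2 (p2 (p2 x))))"
abbreviation "wF w \<equiv> p1 (w - 1)"
abbreviation "wS w \<equiv> p1 (p2 (w - 1))"
abbreviation "wU w \<equiv> p2 (p2 (w - 1))"

definition addrow :: "nat \<Rightarrow> nat \<Rightarrow> nat \<Rightarrow> nat" where
  "addrow D j s = set_encode {q. q < D + Suc (pr j s) \<and> (q \<in> set_decode D \<or> p1 q = j \<and> p2 q < s)}"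

definition found :: "nat set \<Rightarrow> nat set \<Rightarrow> nat \<Rightarrow> nat \<Rightarrow> nat \<Rightarrow> nat \<Rightarrow> nat \<Rightarrow> bool" where
  "found H A r n s x q \<longleftrightarrow> p1 q < 2 ^ s
     \<and> cand H A n s (Suc (sj x)) (set_decode (sD x)) (set_decode (p1 q))
     \<and> conv (sat (set_decode (p1 q)) s) (p1 r) (Suc (sj x)) (set_decode (p2 q))"

text \<open>A candidate below \<open>s\<close> has a code below \<open>2 ^ s\<close>, and answers on
  the numbers up to the level have one below \<open>2 ^ Suc (sj x)\<close>; the bound exceeds every
  such pair, and it is the value of \<open>first\<close> when nothing is found.\<close>

definition fbound :: "nat \<Rightarrow> nat \<Rightarrow> nat" where
  "fbound s x = Suc (pr (2 ^ s) (2 ^ Suc (sj x)))"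

definition first :: "nat set \<Rightarrow> nat set \<Rightarrow> nat \<Rightarrow> nat \<Rightarrow> nat \<Rightarrow> nat \<Rightarrow> nat" where
  "first H A r n s x = (LEAST q. found H A r n s x q \<or> q = fbound s x)"

definition agree :: "nat \<Rightarrow> nat \<Rightarrow> nat \<Rightarrow> bool" where
  "agree r s x \<longleftrightarrow> conv (sat (Kst s) s) (p2 r) (Suc (sj x)) (set_decode (wU (sw x)))"

definition coherent :: "nat \<Rightarrow> bool" where
  "coherent x \<longleftrightarrow> (\<forall>i<sj x. i \<in> set_decode (wU (sw x)) \<longleftrightarrow> i \<in> set_decode (wU (swj x)))"

text \<open>Ending an attempt at stage \<open>s\<close> makes \<open>s\<close> the length of a row:
  of the next row after a confirmation, of the same row after a conflict. So row \<open>sj x\<close>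
  has length \<open>stt x\<close> and, above level \<open>0\<close>, the row before it has length
  \<open>stj x\<close>.\<close>

definition step :: "nat set \<Rightarrow> nat set \<Rightarrow> nat \<Rightarrow> nat \<Rightarrow> nat \<Rightarrow> nat \<Rightarrow> nat" where
  "step H A r n s x =
    (if sw x = 0 then
       if first H A r n s x < fbound s x
       then mk (sj x) (stj x) (swj x) (stt x) (Suc (pr (p1 (first H A r n s x)) (pr s (p2 (first H A r n s x))))) (sD x)
       else x
     else if agree r s x then
       if coherent x then mk (Suc (sj x)) (stt x) (sw x) s 0 (addrow (sD x) (Suc (sj x)) s)
       else mk (sj x) (stj x) (swj x) s 0 (addrow (sD x) (sj x) s)
     else x)"

primrec state :: "nat set \<Rightarrow> nat set \<Rightarrow> nat \<Rightarrow> nat \<Rightarrow> nat \<Rightarrow> nat" where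
  "state H A r n 0 = mk 0 0 0 0 0 0"
| "state H A r n (Suc s) = step H A r n (Suc s) (state H A r n s)"

text \<open>In a bounded outcome and at a late stage, this is the first full row, and
  \<open>hole\<close> is the length of the row before it. The value \<open>s\<close> is a
  default.\<close>

definition hole_row :: "nat set \<Rightarrow> nat \<Rightarrow> nat \<Rightarrow> nat" where
  "hole_row A n s = (LEAST i. pr (n + 2) i \<notin> A \<or> i = s)"

definition hole :: "nat set \<Rightarrow> nat \<Rightarrow> nat \<Rightarrow> nat" where
  "hole A n s = (LEAST y. pr (n + 1) (pr (hole_row A n s - 1) y) \<notin> A \<or> y = s)"

text \<open>\<open>p\<close> and \<open>t\<close> name an attempt by its target level and its
  starting stage; the state still knows the current attempt and the one that confirmed the present
  level.\<close>

definition lookup :: "nat \<Rightarrow> nat \<Rightarrow> nat \<Rightarrow> nat" where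
  "lookup p t x = (if p = Suc (sj x) \<and> t = stt x then sw x else if p = sj x \<and> t = stj x then swj x else 0)"

text \<open>\<open>info\<close> is \<open>0\<close> as long as the oracle below \<open>s\<close> does not show the outcome of the block; afterwards it is
  \<open>Suc \<langle>m, F\<rangle>\<close> with \<open>m\<close> the next base column and \<open>F\<close> the contents of the columns skipped.
  \<open>pos\<close> is likewise \<open>0\<close> or the successor of the base column of a block.\<close>

definition info :: "nat set \<Rightarrow> nat set \<Rightarrow> nat \<Rightarrow> nat \<Rightarrow> nat \<Rightarrow> nat" where
  "info H A r n s =
    (if s \<le> pr (n + 3) 0 then 0
     else if pr (n + 3) 0 \<notin> A then Suc (pr (n + 4) 0)
     else if s \<le> pr (n + 2) (hole_row A n s) then 0
     else if s \<le> pr (n + 1) (pr (hole_row A n s - 1) (hole A n s)) then 0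
     else if lookup (hole_row A n s) (hole A n s) (state H A r n s) = 0 then Suc (pr (n + 4) 0)
     else Suc (pr (max (n + 4) (wS (lookup (hole_row A n s) (hole A n s) (state H A r n s))))
                  (wF (lookup (hole_row A n s) (hole A n s) (state H A r n s)))))"

primrec pos :: "nat set \<Rightarrow> nat set \<Rightarrow> nat \<Rightarrow> nat \<Rightarrow> nat" where
  "pos H A s 0 = Suc 0"
| "pos H A s (Suc r) =
    (if pos H A s r = 0 \<or> info H A r (pos H A s r - 1) s = 0 then 0
     else Suc (p1 (info H A r (pos H A s r - 1) s - 1)))"

definition block :: "nat set \<Rightarrow> nat set \<Rightarrow> nat \<Rightarrow> nat \<Rightarrow> nat \<Rightarrow> nat \<Rightarrow> bool" where
  "block H A r n s z \<longleftrightarrow>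
      p1 z = n \<and> p2 z = 0 \<and> J (sat {} s) (p1 r) (Suc (pr z 0)) 0
    \<or> p1 z = n + 1 \<and> (sj (state H A r n s) < p1 (p2 z) \<and> p2 (p2 z) < s \<or> p2 z \<in> set_decode (sD (state H A r n s)))
    \<or> p1 z = n + 2 \<and> (\<exists>q<s. p1 q = n + 1 \<and> p1 (p2 q) = p2 z \<and> q \<notin> A)
    \<or> p1 z = n + 3 \<and> p2 z = 0 \<and> (\<exists>q<s. p1 q = n + 2 \<and> q \<notin> A)
    \<or> n + 4 \<le> p1 z \<and> info H A r n s \<noteq> 0 \<and> p1 z < p1 (info H A r n s - 1) \<and> z \<in> set_decode (p2 (info H A r n s - 1))"

text \<open>The bound on \<open>r\<close> loses nothing: by \<open>pos_ge\<close> the base column of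
  a block is at least its index, and a block acts only from its base column on.\<close>

definition enum :: "nat set \<Rightarrow> nat set \<Rightarrow> nat \<Rightarrow> nat \<Rightarrow> bool" where
  "enum H A s z \<longleftrightarrow> z < s \<and> (\<exists>r<Suc (p1 z). pos H A s r \<noteq> 0 \<and> block H A r (pos H A s r - 1) s z)"

text \<open>The explicit bound lies above every admissible \<open>w\<close> and keeps the table a
  finite set with a computable code.\<close>

primrec En :: "nat \<Rightarrow> nat set" where
  "En 0 = {}"
| "En (Suc s) = {w. w < Suc (pr s (pr (2 ^ s) s)) \<and> (w \<in> En s \<or>
     p1 w = s \<and> p1 (p2 w) < 2 ^ s \<and> p2 (p2 w) < s \<and> enum (En s) (set_decode (p1 (p2 w))) s (p2 (p2 w)))}"

section \<open>Computability of the construction\<close>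

lemma dp_cand:
  assumes "cf Zs h" "cf Zs a" "cf Zs n" "cf Zs s" "cf Zs p" "cf Zs D" "cf Zs F"
  shows "dp Zs (\<lambda>Z x. cand (set_decode (h Z x)) (set_decode (a Z x)) (n Z x) (s Z x) (p Z x) (set_decode (D Z x)) (set_decode (F Z x)))"
proof -
  let ?h = "\<lambda>x. p1 x" and ?a = "\<lambda>x. p1 (p2 x)" and ?n = "\<lambda>x. p1 (p2 (p2 x))"
    and ?s = "\<lambda>x. p1 (p2 (p2 (p2 x)))" and ?p = "\<lambda>x. p1 (p2 (p2 (p2 (p2 x))))"
    and ?D = "\<lambda>x. p1 (p2 (p2 (p2 (p2 (p2 x)))))" and ?F = "\<lambda>x. p2 (p2 (p2 (p2 (p2 (p2 x)))))"
  have "dp Zs (\<lambda>Z x. cand (set_decode (?h x)) (set_decode (?a x)) (?n x) (?s x) (?p x) (set_decode (?D x)) (set_decode (?F x)))"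
    unfolding cand_def by (intro cf_rules)
  from dp_substitute[OF this, of "\<lambda>Z x. pr (h Z x) (pr (a Z x) (pr (n Z x) (pr (s Z x) (pr (p Z x) (pr (D Z x) (F Z x))))))"]
  show ?thesis by (simp add: cf_pr assms)
qed

lemma dp_conv_sat:
  assumes "cf Zs a" "cf Zs s" "cf Zs e" "cf Zs p" "cf Zs U"
  shows "dp Zs (\<lambda>Z x. conv (sat (set_decode (a Z x)) (s Z x)) (e Z x) (p Z x) (set_decode (U Z x)))"
proof -
  have "dp Zs (\<lambda>Z x. conv (sat (set_decode (p1 x)) (p1 (p2 x))) (p1 (p2 (p2 x))) (p1 (p2 (p2 (p2 x)))) (set_decode (p2 (p2 (p2 (p2 x))))))"
    unfolding conv_def by (intro cf_rules dp_J_sat)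
  from dp_substitute[OF this, of "\<lambda>Z x. pr (a Z x) (pr (s Z x) (pr (e Z x) (pr (p Z x) (U Z x))))"]
  show ?thesis by (simp add: cf_pr assms)
qed

lemma cf_addrow:
  assumes "cf Zs D" "cf Zs j" "cf Zs s"
  shows "cf Zs (\<lambda>Z x. addrow (D Z x) (j Z x) (s Z x))"
proof -
  have "cf Zs (\<lambda>Z x. addrow (p1 x) (p1 (p2 x)) (p2 (p2 x)))"
    unfolding addrow_def by (intro cf_rules)
  from cf_substitute[OF this, of "\<lambda>Z x. pr (D Z x) (pr (j Z x) (s Z x))"]
  show ?thesis by (simp add: cf_pr assms)
qed

lemma dp_found:
  assumes "cf Zs h" "cf Zs a" "cf Zs r" "cf Zs n" "cf Zs s" "cf Zs x" "cf Zs q"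
  shows "dp Zs (\<lambda>Z y. found (set_decode (h Z y)) (set_decode (a Z y)) (r Z y) (n Z y) (s Z y) (x Z y) (q Z y))"
  unfolding found_def by (intro cf_rules dp_cand dp_conv_sat assms)

lemma cf_fbound: "cf Zs s \<Longrightarrow> cf Zs x \<Longrightarrow> cf Zs (\<lambda>Z y. fbound (s Z y) (x Z y))"
  unfolding fbound_def by (intro cf_rules)

lemma cf_first:
  assumes "cf Zs h" "cf Zs a" "cf Zs r" "cf Zs n" "cf Zs s" "cf Zs x"
  shows "cf Zs (\<lambda>Z y. first (set_decode (h Z y)) (set_decode (a Z y)) (r Z y) (n Z y) (s Z y) (x Z y))"
proof -
  have "cf Zs (\<lambda>Z y. first (set_decode (p1 y)) (set_decode (p1 (p2 y))) (p1 (p2 (p2 y))) (p1 (p2 (p2 (p2 y))))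
    (p1 (p2 (p2 (p2 (p2 y))))) (p2 (p2 (p2 (p2 (p2 y))))))"
    unfolding first_def by (intro cf_bounded_Least cf_rules dp_found cf_fbound)
  from cf_substitute[OF this, of "\<lambda>Z y. pr (h Z y) (pr (a Z y) (pr (r Z y) (pr (n Z y) (pr (s Z y) (x Z y)))))"]
  show ?thesis by (simp add: cf_pr assms)
qed

lemma dp_agree:
  assumes "cf Zs r" "cf Zs s" "cf Zs x"
  shows "dp Zs (\<lambda>Z y. agree (r Z y) (s Z y) (x Z y))"
proof -
  have "dp Zs (\<lambda>Z y. conv (sat (set_decode (set_encode (Kst (s Z y)))) (s Z y)) (p2 (r Z y)) (Suc (sj (x Z y)))
      (set_decode (wU (sw (x Z y)))))"
    by (intro cf_rules dp_conv_sat cf_Kst assms)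
  then show ?thesis unfolding agree_def by simp
qed

lemma dp_coherent:
  assumes "cf Zs x" shows "dp Zs (\<lambda>Z y. coherent (x Z y))"
proof -
  have "dp Zs (\<lambda>Z y. coherent y)" unfolding coherent_def by (intro cf_rules)
  from dp_substitute[OF this assms] show ?thesis .
qed

lemma cf_step:
  assumes "cf Zs h" "cf Zs a" "cf Zs r" "cf Zs n" "cf Zs s" "cf Zs x"
  shows "cf Zs (\<lambda>Z y. step (set_decode (h Z y)) (set_decode (a Z y)) (r Z y) (n Z y) (s Z y) (x Z y))"
  unfolding step_def by (intro cf_rules cf_first cf_fbound dp_agree dp_coherent cf_addrow assms)

lemma cf_state:
  assumes "cf Zs h" "cf Zs a" "cf Zs r" "cf Zs n" "cf Zs s"
  shows "cf Zs (\<lambda>Z y. state (set_decode (h Z y)) (set_decode (a Z y)) (r Z y) (n Z y) (s Z y))"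
proof -
  let ?h = "\<lambda>x. p1 x" and ?a = "\<lambda>x. p1 (p2 x)" and ?r = "\<lambda>x. p1 (p2 (p2 x))"
    and ?n = "\<lambda>x. p1 (p2 (p2 (p2 x)))" and ?s = "\<lambda>x. p2 (p2 (p2 (p2 x)))"
  have "cf Zs (\<lambda>Z y. rec_nat (mk 0 0 0 0 0 0) (\<lambda>s x. step (set_decode (?h y)) (set_decode (?a y)) (?r y) (?n y) (Suc s) x) (?s y))"
    by (intro cf_rec cf_rules cf_step)
  moreover have "rec_nat (mk 0 0 0 0 0 0) (\<lambda>s x. step H A r n (Suc s) x) s = state H A r n s" for H A r n s
    by (induction s) simp_all
  ultimately have "cf Zs (\<lambda>Z y. state (set_decode (?h y)) (set_decode (?a y)) (?r y) (?n y) (?s y))" by simp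
  from cf_substitute[OF this, of "\<lambda>Z y. pr (h Z y) (pr (a Z y) (pr (r Z y) (pr (n Z y) (s Z y))))"]
  show ?thesis by (simp add: cf_pr assms)
qed

lemma cf_hole_row:
  assumes "cf Zs a" "cf Zs n" "cf Zs s"
  shows "cf Zs (\<lambda>Z y. hole_row (set_decode (a Z y)) (n Z y) (s Z y))"
proof -
  have "cf Zs (\<lambda>Z y. hole_row (set_decode (p1 y)) (p1 (p2 y)) (p2 (p2 y)))"
    unfolding hole_row_def by (intro cf_bounded_Least cf_rules)
  from cf_substitute[OF this, of "\<lambda>Z y. pr (a Z y) (pr (n Z y) (s Z y))"]
  show ?thesis by (simp add: cf_pr assms)
qed

lemma cf_hole:
  assumes "cf Zs a" "cf Zs n" "cf Zs s"
  shows "cf Zs (\<lambda>Z y. hole (set_decode (a Z y)) (n Z y) (s Z y))"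
proof -
  have "cf Zs (\<lambda>Z y. hole (set_decode (p1 y)) (p1 (p2 y)) (p2 (p2 y)))"
    unfolding hole_def by (intro cf_bounded_Least cf_rules cf_hole_row)
  from cf_substitute[OF this, of "\<lambda>Z y. pr (a Z y) (pr (n Z y) (s Z y))"]
  show ?thesis by (simp add: cf_pr assms)
qed

lemma cf_lookup: "cf Zs p \<Longrightarrow> cf Zs t \<Longrightarrow> cf Zs x \<Longrightarrow> cf Zs (\<lambda>Z y. lookup (p Z y) (t Z y) (x Z y))"
  unfolding lookup_def by (intro cf_rules)

lemma cf_info:
  assumes "cf Zs h" "cf Zs a" "cf Zs r" "cf Zs n" "cf Zs s"
  shows "cf Zs (\<lambda>Z y. info (set_decode (h Z y)) (set_decode (a Z y)) (r Z y) (n Z y) (s Z y))"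
  unfolding info_def by (intro cf_rules cf_hole_row cf_hole cf_lookup cf_state assms)

lemma cf_pos:
  assumes "cf Zs h" "cf Zs a" "cf Zs s" "cf Zs r"
  shows "cf Zs (\<lambda>Z y. pos (set_decode (h Z y)) (set_decode (a Z y)) (s Z y) (r Z y))"
proof -
  let ?h = "\<lambda>x. p1 x" and ?a = "\<lambda>x. p1 (p2 x)" and ?s = "\<lambda>x. p1 (p2 (p2 x))"
    and ?r = "\<lambda>x. p2 (p2 (p2 x))"
  let ?g = "\<lambda>H A s r v. if v = 0 \<or> info H A r (v - 1) s = 0 then 0 else Suc (p1 (info H A r (v - 1) s - 1))"
  have "cf Zs (\<lambda>Z y. rec_nat (Suc 0) (\<lambda>r v. ?g (set_decode (?h y)) (set_decode (?a y)) (?s y) r v) (?r y))"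
    by (intro cf_rec cf_rules cf_info)
  moreover have "rec_nat (Suc 0) (\<lambda>r v. ?g H A s r v) r = pos H A s r" for H A s r
    by (induction r) simp_all
  ultimately have "cf Zs (\<lambda>Z y. pos (set_decode (?h y)) (set_decode (?a y)) (?s y) (?r y))" by simp
  from cf_substitute[OF this, of "\<lambda>Z y. pr (h Z y) (pr (a Z y) (pr (s Z y) (r Z y)))"]
  show ?thesis by (simp add: cf_pr assms)
qed

lemma dp_block:
  assumes "cf Zs h" "cf Zs a" "cf Zs r" "cf Zs n" "cf Zs s" "cf Zs z"
  shows "dp Zs (\<lambda>Z y. block (set_decode (h Z y)) (set_decode (a Z y)) (r Z y) (n Z y) (s Z y) (z Z y))"
proof -
  let ?h = "\<lambda>x. p1 x" and ?a = "\<lambda>x. p1 (p2 x)" and ?r = "\<lambda>x. p1 (p2 (p2 x))"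
    and ?n = "\<lambda>x. p1 (p2 (p2 (p2 x)))" and ?s = "\<lambda>x. p1 (p2 (p2 (p2 (p2 x))))" and ?z = "\<lambda>x. p2 (p2 (p2 (p2 (p2 x))))"
  have J: "dp Zs (\<lambda>Z y. J (sat {} (?s y)) (p1 (?r y)) (Suc (pr (?z y) 0)) 0)"
    using dp_J_sat[OF cf_const[of Zs 0], of "\<lambda>Z y. ?s y" "\<lambda>Z y. p1 (?r y)" "\<lambda>Z y. Suc (pr (?z y) 0)" "\<lambda>Z y. 0"]
    by (simp add: cf_rules)
  have "dp Zs (\<lambda>Z y. block (set_decode (?h y)) (set_decode (?a y)) (?r y) (?n y) (?s y) (?z y))"
    unfolding block_def by (intro J cf_rules cf_info cf_state)
  from dp_substitute[OF this, of "\<lambda>Z y. pr (h Z y) (pr (a Z y) (pr (r Z y) (pr (n Z y) (pr (s Z y) (z Z y)))))"]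
  show ?thesis by (simp add: cf_pr assms)
qed

lemma dp_enum:
  assumes "cf Zs h" "cf Zs a" "cf Zs s" "cf Zs z"
  shows "dp Zs (\<lambda>Z y. enum (set_decode (h Z y)) (set_decode (a Z y)) (s Z y) (z Z y))"
proof -
  have "dp Zs (\<lambda>Z y. enum (set_decode (p1 y)) (set_decode (p1 (p2 y))) (p1 (p2 (p2 y))) (p2 (p2 (p2 y))))"
    unfolding enum_def by (intro cf_rules cf_pos dp_block)
  from dp_substitute[OF this, of "\<lambda>Z y. pr (h Z y) (pr (a Z y) (pr (s Z y) (z Z y)))"]
  show ?thesis by (simp add: cf_pr assms)
qed

lemma finite_En [simp]: "finite (En s)"
  by (cases s) auto

lemma cf_En:
  assumes "cf Zs s" shows "cf Zs (\<lambda>Z x. set_encode (En (s Z x)))"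
proof -
  let ?g = "\<lambda>s t. set_encode {w. w < Suc (pr s (pr (2 ^ s) s)) \<and> (w \<in> set_decode t \<or>
     p1 w = s \<and> p1 (p2 w) < 2 ^ s \<and> p2 (p2 w) < s \<and> enum (set_decode t) (set_decode (p1 (p2 w))) s (p2 (p2 w)))}"
  have "cf Zs (\<lambda>Z x. rec_nat 0 (\<lambda>s t. ?g s t) x)"
    by (intro cf_rec cf_rules dp_enum)
  moreover have "rec_nat 0 (\<lambda>s t. ?g s t) s = set_encode (En s)" for s
  proof (induction s)
    case (Suc s) then show ?case by simp
  qed simp
  ultimately have "cf Zs (\<lambda>Z x. set_encode (En x))" by simp
  from cf_substitute[OF this assms] show ?thesis .
qed

section \<open>Locality and the set C\<close>

lemma pr_mono: "a \<le> a' \<Longrightarrow> b \<le> b' \<Longrightarrow> pr a b \<le> pr a' b'"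
  unfolding prod_encode_def using triangle_mono[of "a + b" "a' + b'"] by simp

lemma p_le: "p1 z \<le> z" "p2 z \<le> z"
  using le_prod_encode_1[of "p1 z" "p2 z"] le_prod_encode_2[of "p2 z" "p1 z"] by simp_all

lemma mem_set_decode_less: "x \<in> set_decode a \<Longrightarrow> x < a"
proof -
  assume "x \<in> set_decode a"
  then have "a div 2 ^ x \<noteq> 0" unfolding set_decode_def using odd_pos by force
  then have "2 ^ x \<le> a" by (metis div_less not_less)
  then show ?thesis using less_exp[of x] by linarith
qed

lemma set_encode_less: "set_encode {i. i < s \<and> P i} < 2 ^ s"
proof (induction s)
  case (Suc s)
  have "{i. i < Suc s \<and> P i} = (if P s then insert s {i. i < s \<and> P i} else {i. i < s \<and> P i})"
    by (auto simp: less_Suc_eq)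
  then show ?case using Suc by (simp add: set_encode_insert)
qed simp

lemma set_decode_subset: "a < 2 ^ s \<Longrightarrow> set_decode a \<subseteq> {..<s}"
proof
  fix x assume a: "a < 2 ^ s" and "x \<in> set_decode a"
  then have "a div 2 ^ x \<noteq> 0" unfolding set_decode_def using odd_pos by force
  then have "2 ^ x \<le> a" by (metis div_less not_less)
  then have "(2::nat) ^ x < 2 ^ s" using a by linarith
  then have "x < s" by (rule power_less_imp_less_exp[rotated]) simp
  then show "x \<in> {..<s}" by simp
qed

lemma Least_cong_below:
  fixes h :: nat
  assumes "h = (LEAST i. P i)" "\<exists>i. P i" "\<And>i. i \<le> h \<Longrightarrow> P i \<longleftrightarrow> Q i"
  shows "(LEAST i. Q i) = h"
proof (rule Least_equality)
  have "P h" unfolding assms(1) using assms(2) by (rule LeastI_ex)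
  then show "Q h" using assms(3)[of h] by blast
  fix y assume "Q y"
  show "h \<le> y"
  proof (rule ccontr)
    assume "\<not> h \<le> y"
    then have "P y" using \<open>Q y\<close> assms(3)[of y] by linarith
    then have "(LEAST i. P i) \<le> y" by (rule Least_le)
    then show False using \<open>\<not> h \<le> y\<close> unfolding assms(1) by blast
  qed
qed

definition hagr :: "nat \<Rightarrow> nat set \<Rightarrow> nat set \<Rightarrow> bool" where
  "hagr s H H' \<longleftrightarrow> (\<forall>w. p1 w < s \<longrightarrow> (w \<in> H \<longleftrightarrow> w \<in> H'))"

definition agr :: "nat \<Rightarrow> nat \<Rightarrow> nat set \<Rightarrow> nat set \<Rightarrow> bool" where
  "agr s m A A' \<longleftrightarrow> (\<forall>z<s. p1 z < m \<longrightarrow> (z \<in> A \<longleftrightarrow> z \<in> A'))"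

lemma hagr_mono: "hagr s H H' \<Longrightarrow> s' \<le> s \<Longrightarrow> hagr s' H H'"
  unfolding hagr_def by auto

lemma agr_mono: "agr s m A A' \<Longrightarrow> s' \<le> s \<Longrightarrow> m' \<le> m \<Longrightarrow> agr s' m' A A'"
  unfolding agr_def by auto

lemma agr_sym: "agr s m A A' \<Longrightarrow> agr s m A' A"
  unfolding agr_def by auto

lemma hagr_sym: "hagr s A A' \<Longrightarrow> hagr s A' A"
  unfolding hagr_def by auto

lemma cand_local:
  assumes H: "hagr s H H'" and A: "agr s (Suc n) A A'"
  shows "cand H A n s p D F \<longleftrightarrow> cand H' A' n s p D F"
proof -
  have 1: "(p1 z \<le> n \<longrightarrow> (z \<in> F \<longleftrightarrow> z \<in> A)) \<longleftrightarrow> (p1 z \<le> n \<longrightarrow> (z \<in> F \<longleftrightarrow> z \<in> A'))" if "z < s" for z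
    using A that unfolding agr_def by (auto simp: less_Suc_eq_le)
  have 2: "s' < s \<Longrightarrow> pr s' c \<in> H \<longleftrightarrow> pr s' c \<in> H'" for s' c
    using H unfolding hagr_def by simp
  have 3: "(\<forall>s'<s. z < s' \<and> pr s' (c s') \<in> H \<longrightarrow> Q) \<longleftrightarrow> (\<forall>s'<s. z < s' \<and> pr s' (c s') \<in> H' \<longrightarrow> Q)" for z c Q
    using 2 by blast
  show ?thesis unfolding cand_def using 1 3 by (simp cong: all_cong)
qed

lemma found_local:
  "hagr s H H' \<Longrightarrow> agr s (Suc n) A A' \<Longrightarrow> found H A r n s x q \<longleftrightarrow> found H' A' r n s x q"
  unfolding found_def using cand_local by blast

lemma step_local:
  "hagr s H H' \<Longrightarrow> agr s (Suc n) A A' \<Longrightarrow> step H A r n s x = step H' A' r n s x"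
  unfolding step_def first_def using found_local by presburger

lemma state_local:
  "hagr s H H' \<Longrightarrow> agr s (Suc n) A A' \<Longrightarrow> state H A r n s = state H' A' r n s"
proof (induction s)
  case (Suc s)
  then have "state H A r n s = state H' A' r n s" using hagr_mono[of "Suc s"] agr_mono[of "Suc s"] by auto
  then show ?case using step_local[OF Suc.prems] by simp
qed simp

lemma hole_row_local:
  assumes A: "agr s (n + 4) A A'" and v: "pr (n + 2) (hole_row A n s) < s"
  shows "hole_row A' n s = hole_row A n s"
proof -
  have "(LEAST i. pr (n + 2) i \<notin> A' \<or> i = s) = hole_row A n s"
  proof (rule Least_cong_below)
    show "hole_row A n s = (LEAST i. pr (n + 2) i \<notin> A \<or> i = s)" by (rule hole_row_def)
    fix i assume "i \<le> hole_row A n s"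
    then have "pr (n + 2) i < s" using v pr_mono[of "n + 2" "n + 2" i "hole_row A n s"] by linarith
    then show "(pr (n + 2) i \<notin> A \<or> i = s) = (pr (n + 2) i \<notin> A' \<or> i = s)" using A unfolding agr_def by simp
  qed blast
  then show ?thesis unfolding hole_row_def .
qed

lemma hole_local:
  assumes A: "agr s (n + 4) A A'" and h: "hole_row A' n s = hole_row A n s"
    and v: "pr (n + 1) (pr (hole_row A n s - 1) (hole A n s)) < s"
  shows "hole A' n s = hole A n s"
proof -
  let ?c = "\<lambda>i. pr (n + 1) (pr (hole_row A n s - 1) i)"
  have "(LEAST i. ?c i \<notin> A' \<or> i = s) = hole A n s"
  proof (rule Least_cong_below)
    show "hole A n s = (LEAST i. ?c i \<notin> A \<or> i = s)" by (rule hole_def)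
    fix i assume "i \<le> hole A n s"
    then have "?c i \<le> ?c (hole A n s)" by (intro pr_mono) auto
    then have "?c i < s" using v by linarith
    then show "(?c i \<notin> A \<or> i = s) = (?c i \<notin> A' \<or> i = s)" using A unfolding agr_def by simp
  qed blast
  then show ?thesis using h unfolding hole_def by simp
qed

lemma info_local:
  assumes H: "hagr s H H'" and A: "agr s (n + 4) A A'"
  shows "info H A r n s = info H' A' r n s"
proof -
  have st: "state H A r n s = state H' A' r n s" using H A by (intro state_local) (auto intro: agr_mono)
  have e: "pr (n + 3) 0 \<in> A \<longleftrightarrow> pr (n + 3) 0 \<in> A'" if "\<not> s \<le> pr (n + 3) 0"
    using A that unfolding agr_def by simp
  \<comment> \<open>Either both oracles show the same row, or in both the row found lies too far out
    to be verified, and then \<open>info\<close> is \<open>0\<close> for both.\<close>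
  have r: "hole_row A' n s = hole_row A n s \<or> s \<le> pr (n + 2) (hole_row A n s) \<and> s \<le> pr (n + 2) (hole_row A' n s)"
    using hole_row_local[OF A] hole_row_local[OF agr_sym[OF A]] by (metis not_less)
  have h: "hole A' n s = hole A n s \<or> s \<le> pr (n + 1) (pr (hole_row A n s - 1) (hole A n s))
      \<and> s \<le> pr (n + 1) (pr (hole_row A n s - 1) (hole A' n s))" if "hole_row A' n s = hole_row A n s"
    using hole_local[OF A that] hole_local[OF agr_sym[OF A] that[symmetric]] that by (metis not_less)
  show ?thesis
  proof (cases "s \<le> pr (n + 3) 0 \<or> pr (n + 3) 0 \<notin> A")
    case True then show ?thesis using e unfolding info_def by auto
  next
    case False
    then have e: "\<not> s \<le> pr (n + 3) 0" "pr (n + 3) 0 \<in> A" "pr (n + 3) 0 \<in> A'" using e by simp_all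
    show ?thesis
    proof (cases "hole_row A' n s = hole_row A n s")
      case False
      with r have "s \<le> pr (n + 2) (hole_row A n s)" "s \<le> pr (n + 2) (hole_row A' n s)" by blast+
      then show ?thesis using e by (simp only: info_def if_True if_False not_True_eq_False)
    next
      case True
      note R = True
      show ?thesis
      proof (cases "hole A' n s = hole A n s")
        case False
        with h[OF R] have "s \<le> pr (n + 1) (pr (hole_row A n s - 1) (hole A n s))"
          "s \<le> pr (n + 1) (pr (hole_row A n s - 1) (hole A' n s))" by blast+
        then show ?thesis using e by (simp only: info_def if_True if_False not_True_eq_False R)
      next
        case True then show ?thesis using e by (simp only: info_def if_True if_False not_True_eq_False R st)
      qed
    qed
  qed
qed

lemma info_ge: "info H A r n s \<noteq> 0 \<Longrightarrow> n + 4 \<le> p1 (info H A r n s - 1)"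
  unfolding info_def by (auto simp: Let_def split: if_splits)

lemma pos_Suc_ge: "pos H A s (Suc r) \<noteq> 0 \<Longrightarrow> pos H A s r \<noteq> 0 \<and> pos H A s r + 4 \<le> pos H A s (Suc r)"
  using info_ge[of H A r "pos H A s r - 1" s] by (auto split: if_splits)

lemma pos_mono:
  assumes "pos H A s r' \<noteq> 0" "r < r'" shows "pos H A s r \<noteq> 0 \<and> pos H A s (Suc r) \<noteq> 0 \<and> pos H A s (Suc r) \<le> pos H A s r'"
  using assms
proof (induction r')
  case (Suc r')
  then show ?case using pos_Suc_ge[OF Suc.prems(1)] less_Suc_eq by (metis le_add1 le_trans order_refl)
qed simp

lemma pos_ge: "pos H A s r \<noteq> 0 \<Longrightarrow> r < pos H A s r"
proof (induction r)
  case (Suc r) then show ?case using pos_Suc_ge[OF Suc.prems] by linarith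
qed simp

text \<open>A block occupies at least four columns from its base on, and \<open>info\<close> reads
  no further; so a base column is determined by the columns strictly below it.\<close>

lemma pos_local:
  assumes H: "hagr s H H'" and A: "agr s m A A'"
  shows "pos H A s r \<noteq> 0 \<Longrightarrow> pos H A s r \<le> Suc m \<Longrightarrow> pos H' A' s r = pos H A s r"
proof (induction r)
  case (Suc r)
  note g = pos_Suc_ge[OF Suc.prems(1)]
  then have eq: "pos H' A' s r = pos H A s r" using Suc by linarith
  let ?n = "pos H A s r - 1"
  have "agr s (?n + 4) A A'" by (rule agr_mono[OF A]) (use g Suc.prems(2) in linarith)+
  then have "info H A r ?n s = info H' A' r ?n s" by (rule info_local[OF H])
  then show ?case using eq by simp
qed simp

lemma block_local:
  assumes H: "hagr s H H'" and A: "agr s (p1 z) A A'" and n: "n \<le> p1 z"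
  shows "block H A r n s z \<longleftrightarrow> block H' A' r n s z"
proof -
  have 1: "state H A r n s = state H' A' r n s" if "p1 z = n + 1"
    using that H A by (intro state_local) auto
  have 2: "(\<exists>q<s. p1 q = n + 1 \<and> p1 (p2 q) = p2 z \<and> q \<notin> A) \<longleftrightarrow> (\<exists>q<s. p1 q = n + 1 \<and> p1 (p2 q) = p2 z \<and> q \<notin> A')"
    if "p1 z = n + 2" using A that unfolding agr_def by auto
  have 3: "(\<exists>q<s. p1 q = n + 2 \<and> q \<notin> A) \<longleftrightarrow> (\<exists>q<s. p1 q = n + 2 \<and> q \<notin> A')"
    if "p1 z = n + 3" using A that unfolding agr_def by auto
  have 4: "info H A r n s = info H' A' r n s" if "n + 4 \<le> p1 z"
    using that H A by (intro info_local) (auto intro: agr_mono)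
  consider "p1 z = n" | "p1 z = n + 1" | "p1 z = n + 2" | "p1 z = n + 3" | "n + 4 \<le> p1 z" using n by linarith
  then show ?thesis
    by cases (use 1 2 3 4 in \<open>auto simp: block_def\<close>)
qed

lemma block_ge: "block H A r n s z \<Longrightarrow> n \<le> p1 z"
  unfolding block_def by auto

lemma enum_local1:
  assumes H: "hagr s H H'" and A: "agr s (p1 z) A A'" and e: "enum H A s z"
  shows "enum H' A' s z"
proof -
  from e obtain r where r: "r < Suc (p1 z)" "pos H A s r \<noteq> 0" and b: "block H A r (pos H A s r - 1) s z" and z: "z < s"
    unfolding enum_def by blast
  have le: "pos H A s r - 1 \<le> p1 z" using block_ge[OF b] .
  then have "pos H A s r \<le> Suc (p1 z)" by linarith
  then have "pos H' A' s r = pos H A s r" by (rule pos_local[OF H A r(2)])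
  then show ?thesis unfolding enum_def using r z b block_local[OF H A le] by metis
qed

text \<open>A number is enumerated on the evidence of lower columns and of earlier stages of the
  table only. This justifies the recursion over columns in \<open>Cb\<close>, the one over stages in
  \<open>En\<close>, and the relative enumerability of each column.\<close>

lemma enum_local: "hagr s H H' \<Longrightarrow> agr s (p1 z) A A' \<Longrightarrow> enum H A s z \<longleftrightarrow> enum H' A' s z"
  using enum_local1 hagr_sym agr_sym by metis

section \<open>The table of enumerations and the set \<open>C\<close>\<close>

definition E :: "nat set" where "E = (\<Union>s. En s)"

lemma En_iff: "w \<in> En s \<longleftrightarrow> p1 w < s \<and> p1 (p2 w) < 2 ^ p1 w \<and> p2 (p2 w) < p1 w
    \<and> enum (En (p1 w)) (set_decode (p1 (p2 w))) (p1 w) (p2 (p2 w))"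
proof (induction s)
  case (Suc s)
  have bound: "w < Suc (pr s (pr (2 ^ s) s))" if "p1 w \<le> s" "p1 (p2 w) < 2 ^ p1 w" "p2 (p2 w) < p1 w"
  proof -
    have "(2::nat) ^ p1 w \<le> 2 ^ s" using that(1) by simp
    then have "pr (p1 w) (pr (p1 (p2 w)) (p2 (p2 w))) \<le> pr s (pr (2 ^ s) s)"
      using that by (intro pr_mono) linarith+
    then show ?thesis by (simp add: less_Suc_eq_le)
  qed
  show ?case using Suc bound unfolding En.simps mem_Collect_eq by (metis less_Suc_eq less_or_eq_imp_le)
qed simp

lemma hagr_En: "hagr s (En s) E"
  unfolding hagr_def E_def using En_iff by auto

lemma enum_E: "enum (En s) A s z \<longleftrightarrow> enum E A s z"
  by (rule enum_local[OF hagr_En]) (simp add: agr_def)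

text \<open>The fixed-point equation of the table: stage \<open>s\<close> consults earlier stages
  only, so the finished table may replace \<open>En s\<close>.\<close>

lemma mem_E: "pr s (pr a z) \<in> E \<longleftrightarrow> a < 2 ^ s \<and> z < s \<and> enum E (set_decode a) s z"
proof -
  have "pr s (pr a z) \<in> E \<longleftrightarrow> pr s (pr a z) \<in> En (Suc s)" unfolding E_def UN_iff En_iff[of "pr s (pr a z)"]
    by (auto intro: lessI)
  then show ?thesis using En_iff[of "pr s (pr a z)" "Suc s"] enum_E by (simp del: En.simps)
qed

primrec Cb :: "nat \<Rightarrow> nat set" where
  "Cb 0 = {}"
| "Cb (Suc m) = Cb m \<union> {z. p1 z = m \<and> (\<exists>s. enum E (Cb m) s z)}"

definition C :: "nat set" where "C = {z. z \<in> Cb (Suc (p1 z))}"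

lemma Cb_iff: "z \<in> Cb m \<longleftrightarrow> z \<in> C \<and> p1 z < m"
proof (induction m)
  case (Suc m)
  show ?case
  proof (cases "p1 z = m")
    case True
    then show ?thesis unfolding C_def by simp
  next
    case False
    then have "z \<in> Cb (Suc m) \<longleftrightarrow> z \<in> Cb m" by simp
    then show ?thesis using Suc False by (simp only: less_Suc_eq simp_thms)
  qed
qed simp

lemma below_C: "below C m = Cb m"
  using Cb_iff unfolding below_def by blast

lemma agr_Cb: "agr s m C (Cb m)"
  unfolding agr_def using Cb_iff by auto

text \<open>Each column was built from the columns below it, but by locality the finished set can be
  used as the oracle throughout.\<close>

lemma C_iff: "z \<in> C \<longleftrightarrow> (\<exists>s. enum E C s z)"
proof -
  have "z \<in> C \<longleftrightarrow> (\<exists>s. enum E (Cb (p1 z)) s z)" using Cb_iff[of z "p1 z"] unfolding C_def by simp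
  moreover have "enum E (Cb (p1 z)) s z \<longleftrightarrow> enum E C s z" for s
    by (rule enum_local[OF _ agr_sym[OF agr_Cb]]) (simp add: hagr_def)
  ultimately show ?thesis by simp
qed

definition restr :: "nat set \<Rightarrow> nat \<Rightarrow> nat" where
  "restr A s = set_encode {i. i < s \<and> i \<in> A}"

lemma agr_restr: "agr s m A (set_decode (restr A s))"
  unfolding agr_def restr_def by simp

lemma cf_restr:
  assumes "cf Zs s" shows "cf Zs (\<lambda>Z x. restr Z (s Z x))"
proof -
  have "cf Zs (\<lambda>Z x. restr Z x)" unfolding restr_def by (intro cf_rules)
  from cf_substitute[OF this assms] show ?thesis .
qed

lemma dp_enum_oracle:
  assumes "cf Zs s" "cf Zs z" shows "dp Zs (\<lambda>Z x. enum E Z (s Z x) (z Z x))"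
proof -
  have "dp Zs (\<lambda>Z x. enum (set_decode (set_encode (En (s Z x)))) (set_decode (restr Z (s Z x))) (s Z x) (z Z x))"
    by (intro dp_enum cf_En cf_restr assms)
  moreover have "enum (En s) (set_decode (restr Z s)) s z \<longleftrightarrow> enum E Z s z" for s z Z
    by (rule enum_local[OF hagr_En agr_sym[OF agr_restr]])
  ultimately show ?thesis by simp
qed

lemma cf_state_oracle:
  assumes "cf Zs s" shows "cf Zs (\<lambda>Z x. state E Z r n (s Z x))"
proof -
  have "cf Zs (\<lambda>Z x. state (set_decode (set_encode (En (s Z x)))) (set_decode (restr Z (s Z x))) r n (s Z x))"
    by (intro cf_state cf_En cf_restr cf_const assms)
  moreover have "state (En s) (set_decode (restr Z s)) r n s = state E Z r n s" for s Z
    by (rule state_local[OF hagr_En agr_sym[OF agr_restr]])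
  ultimately show ?thesis by simp
qed

theorem REA_omega_C: "REA_omega C"
proof -
  have "dp UNIV (\<lambda>Z w. \<not> enum E Z (p2 (p2 w)) (pr (p1 w) (p1 (p2 w))))"
    by (intro cf_rules dp_enum_oracle)
  then obtain g where g: "\<And>Z w. eval Z g [w] (if \<not> enum E Z (p2 (p2 w)) (pr (p1 w) (p1 (p2 w))) then 1 else 0)"
    unfolding dp_def cf_def by auto
  \<comment> \<open>The program \<open>g\<close> is uniform in column and oracle; hard-wiring the
    column by a constant program makes the index a computable function of \<open>m\<close>. The
    negation suits \<open>Mu\<close>, which searches for the value \<open>0\<close>.\<close>
  define h where "h m = Comp g [Comp prp [constp m, Comp prp [Proj 1, Proj 0]]]" for m
  have h: "eval Z (h m) [s, y] (if \<not> enum E Z s (pr m y) then 1 else 0)" for Z m s y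
  proof -
    have "eval Z (Comp prp [constp m, Comp prp [Proj 1, Proj 0]]) [s, y] (pr m (pr y s))"
      by (rule eval_Comp2[OF eval_constp eval_Comp2[OF _ _ eval_prp] eval_prp]) (auto intro: eval_Proj)
    moreover have "eval Z g [pr m (pr y s)] (if \<not> enum E Z s (pr m y) then 1 else 0)"
      using g[of Z "pr m (pr y s)"] by simp
    ultimately show ?thesis unfolding h_def by (rule eval_Comp1)
  qed
  have mu: "(\<exists>v. eval Z (Mu (h m)) [y] v) \<longleftrightarrow> (\<exists>s. enum E Z s (pr m y))" for Z m y
  proof
    assume "\<exists>v. eval Z (Mu (h m)) [y] v"
    then obtain v where "eval Z (h m) [v, y] 0" by (auto elim: evMuE)
    from eval_det[OF h this] show "\<exists>s. enum E Z s (pr m y)" by (auto split: if_splits)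
  next
    assume ex: "\<exists>s. enum E Z s (pr m y)"
    define s where "s = (LEAST s. enum E Z s (pr m y))"
    have "enum E Z s (pr m y)" unfolding s_def using ex by (rule LeastI_ex)
    then have "eval Z (h m) [s, y] 0" using h[of Z m s y] by simp
    moreover have "\<forall>t<s. \<exists>v. eval Z (h m) [t, y] v \<and> v \<noteq> 0"
    proof (intro allI impI)
      fix t assume "t < s"
      then have "\<not> enum E Z t (pr m y)" unfolding s_def by (rule not_less_Least)
      then have "eval Z (h m) [t, y] 1" using h[of Z m t y] by simp
      then show "\<exists>v. eval Z (h m) [t, y] v \<and> v \<noteq> 0" by (metis zero_neq_one)
    qed
    ultimately have "eval Z (Mu (h m)) [y] s" by (rule ev_mu)
    then show "\<exists>v. eval Z (Mu (h m)) [y] v" by blast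
  qed
  have "cf {{}} (\<lambda>Z m. enc (constp m))"
  proof -
    \<comment> \<open>\<open>pr 0 0\<close> codes \<open>Zero\<close>, and the step turns a code
      into that of its composition with \<open>Succ\<close>.\<close>
    have "cf {{}} (\<lambda>Z m. rec_nat (pr 0 0) (\<lambda>n c. pr 4 (pr (pr 1 0) (Suc (pr c 0)))) m)"
      by (intro cf_rec cf_rules)
    moreover have "rec_nat (pr 0 0) (\<lambda>n c. pr 4 (pr (pr 1 0) (Suc (pr c 0)))) m = enc (constp m)" for m
      by (induction m) simp_all
    ultimately show ?thesis by simp
  qed
  then have "cf {{}} (\<lambda>Z m. enc (Mu (h m)))"
    unfolding h_def enc.simps list.map enc_list.simps by (intro cf_rules)
  then have "computable_fun (\<lambda>m. enc (Mu (h m)))" unfolding computable_fun_def cf_def by simp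
  moreover have "column C m = W (enc (Mu (h m))) (below C m)" for m
  proof -
    have "y \<in> column C m \<longleftrightarrow> (\<exists>s. enum E (below C m) s (pr m y))" for y
      using Cb_iff[of "pr m y" m] Cb_iff[of "pr m y" "Suc m"] unfolding column_def below_C by simp
    then show ?thesis unfolding W_enc using mu by auto
  qed
  ultimately show ?thesis unfolding REA_omega_def by blast
qed

section \<open>The search process of a block\<close>

lemma set_decode_addrow: "set_decode (addrow D j s) = set_decode D \<union> {q. p1 q = j \<and> p2 q < s}"
proof -
  have "q < D + Suc (pr j s)" if "q \<in> set_decode D \<or> p1 q = j \<and> p2 q < s" for q
  proof (cases "q \<in> set_decode D")
    case True then show ?thesis using mem_set_decode_less[of q D] by simp
  next
    case False
    then have "pr (p1 q) (p2 q) \<le> pr j s" using that by (intro pr_mono) auto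
    then show ?thesis by simp
  qed
  then have eq: "{q. q < D + Suc (pr j s) \<and> (q \<in> set_decode D \<or> p1 q = j \<and> p2 q < s)}
      = set_decode D \<union> {q. p1 q = j \<and> p2 q < s}" by blast
  have fin: "finite {q. q < D + Suc (pr j s) \<and> (q \<in> set_decode D \<or> p1 q = j \<and> p2 q < s)}" by simp
  show ?thesis unfolding addrow_def set_encode_inverse[OF fin] by (rule eq)
qed

lemma step_cases:
  obtains (keep) "step H A r n s x = x" "sw x = 0 \<Longrightarrow> \<forall>q<fbound s x. \<not> found H A r n s x q"
      "sw x \<noteq> 0 \<Longrightarrow> \<not> agree r s x"
  | (find) F U where "sw x = 0" "found H A r n s x (pr F U)"
      "step H A r n s x = mk (sj x) (stj x) (swj x) (stt x) (Suc (pr F (pr s U))) (sD x)"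
  | (confirm) "sw x \<noteq> 0" "agree r s x" "coherent x"
      "step H A r n s x = mk (Suc (sj x)) (stt x) (sw x) s 0 (addrow (sD x) (Suc (sj x)) s)"
  | (conflict) "sw x \<noteq> 0" "agree r s x" "\<not> coherent x"
      "step H A r n s x = mk (sj x) (stj x) (swj x) s 0 (addrow (sD x) (sj x) s)"
proof -
  let ?q = "first H A r n s x"
  have l: "found H A r n s x ?q \<or> ?q = fbound s x"
    unfolding first_def by (rule LeastI[of _ "fbound s x"]) simp
  show ?thesis
  proof (cases "sw x = 0")
    case True
    show ?thesis
    proof (cases "?q < fbound s x")
      case True
      then have "found H A r n s x (pr (p1 ?q) (p2 ?q))" using l by simp
      moreover have "step H A r n s x = mk (sj x) (stj x) (swj x) (stt x) (Suc (pr (p1 ?q) (pr s (p2 ?q)))) (sD x)"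
        using \<open>sw x = 0\<close> True by (simp add: step_def)
      ultimately show ?thesis using find \<open>sw x = 0\<close> by blast
    next
      case False
      have "\<not> found H A r n s x q" if "q < fbound s x" for q
      proof
        assume "found H A r n s x q"
        then have "?q \<le> q" unfolding first_def by (intro Least_le) simp
        then show False using False that by simp
      qed
      then show ?thesis using keep \<open>sw x = 0\<close> False by (simp add: step_def)
    qed
  next
    case False
    show ?thesis
    proof (cases "agree r s x")
      case True
      then show ?thesis using False confirm conflict by (cases "coherent x") (simp_all add: step_def)
    next
      case False
      then show ?thesis using \<open>sw x \<noteq> 0\<close> keep by (simp add: step_def)
    qed
  qed
qed

locale process =
  fixes r n :: nat
begin

abbreviation st :: "nat \<Rightarrow> nat" where "st s \<equiv> state E C r n s"

text \<open>Only the rows below \<open>p\<close> count: a confirmation or conflict changes row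
  \<open>p\<close> or higher rows for the witness that is retained, which therefore stays
  valid.\<close>

definition valid :: "nat \<Rightarrow> nat \<Rightarrow> nat \<Rightarrow> bool" where
  "valid w p D \<longleftrightarrow> w \<noteq> 0 \<and> set_decode (wF w) \<subseteq> {..<wS w}
     \<and> cand E C n (wS w) p {q \<in> set_decode D. p1 q < p} (set_decode (wF w))
     \<and> conv (sat (set_decode (wF w)) (wS w)) (p1 r) p (set_decode (wU w))"

lemma valid_cong: "{q \<in> set_decode D. p1 q < p} = {q \<in> set_decode D'. p1 q < p} \<Longrightarrow> valid w p D \<longleftrightarrow> valid w p D'"
  unfolding valid_def by simp

definition inv :: "nat \<Rightarrow> nat \<Rightarrow> bool" where
  "inv s x \<longleftrightarrow> stt x \<le> s \<and> sj x \<le> s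
     \<and> (\<forall>q\<in>set_decode (sD x). p1 q \<le> sj x)
     \<and> (\<forall>y. pr (sj x) y \<in> set_decode (sD x) \<longleftrightarrow> y < stt x)
     \<and> (0 < sj x \<longrightarrow> (\<forall>y. pr (sj x - 1) y \<in> set_decode (sD x) \<longleftrightarrow> y < stj x) \<and> valid (swj x) (sj x) (sD x))
     \<and> (sw x \<noteq> 0 \<longrightarrow> valid (sw x) (Suc (sj x)) (sD x))"

lemma inv_state: "inv s (st s)"
proof (induction s)
  case 0 show ?case by (simp add: inv_def)
next
  case (Suc s)
  define x where "x = st s"
  have I: "inv s x" using Suc unfolding x_def .
  have st: "st (Suc s) = step E C r n (Suc s) x" unfolding x_def by simp
  have rows: "\<And>q. q \<in> set_decode (sD x) \<Longrightarrow> p1 q \<le> sj x"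
    and row: "\<And>y. pr (sj x) y \<in> set_decode (sD x) \<longleftrightarrow> y < stt x"
    and t: "stt x \<le> s" "sj x \<le> s" using I unfolding inv_def by auto
  show ?case
  proof (cases rule: step_cases[of E C r n "Suc s" x])
    case keep
    then show ?thesis using I st by (simp add: inv_def)
  next
    case (find F U)
    have "{q \<in> set_decode (sD x). p1 q < Suc (sj x)} = set_decode (sD x)" using rows by (auto simp: less_Suc_eq_le)
    moreover have "set_decode F \<subseteq> {..<Suc s}" using find(2) set_decode_subset[of F "Suc s"] by (simp add: found_def)
    ultimately have "valid (Suc (pr F (pr (Suc s) U))) (Suc (sj x)) (sD x)"
      using find(2) unfolding valid_def found_def by simp
    then show ?thesis using I st find(3) by (simp add: inv_def)
  next
    case confirm
    let ?D = "addrow (sD x) (Suc (sj x)) (Suc s)"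
    have "valid (sw x) (Suc (sj x)) (sD x)" using I confirm(1) unfolding inv_def by blast
    moreover have "{q \<in> set_decode (sD x). p1 q < Suc (sj x)} = {q \<in> set_decode ?D. p1 q < Suc (sj x)}"
      unfolding set_decode_addrow by auto
    ultimately have v: "valid (sw x) (Suc (sj x)) ?D" using valid_cong by blast
    have "pr (Suc (sj x)) y \<notin> set_decode (sD x)" for y using rows[of "pr (Suc (sj x)) y"] by auto
    then have 1: "pr (Suc (sj x)) y \<in> set_decode ?D \<longleftrightarrow> y < Suc s" for y unfolding set_decode_addrow by simp
    have 2: "pr (sj x) y \<in> set_decode ?D \<longleftrightarrow> y < stt x" for y unfolding set_decode_addrow using row by simp
    have 3: "\<forall>q\<in>set_decode ?D. p1 q \<le> Suc (sj x)"
      using rows unfolding set_decode_addrow by (auto intro: le_SucI)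
    show ?thesis unfolding st confirm(4) inv_def prod_encode_inverse fst_conv snd_conv
      by (intro conjI impI allI; (rule 3 | rule 1 | rule v | simp only: diff_Suc_1 2 | simp add: t))
  next
    case conflict
    let ?D = "addrow (sD x) (sj x) (Suc s)"
    have 1: "pr (sj x) y \<in> set_decode ?D \<longleftrightarrow> y < Suc s" for y
    proof -
      have "pr (sj x) y \<in> set_decode ?D \<longleftrightarrow> y < stt x \<or> y < Suc s" unfolding set_decode_addrow using row by simp
      then show ?thesis using t by linarith
    qed
    have 2: "pr (sj x - 1) y \<in> set_decode ?D \<longleftrightarrow> y < stj x" if "0 < sj x" for y
    proof -
      have "pr (sj x - 1) y \<in> set_decode (sD x) \<longleftrightarrow> y < stj x" using I that unfolding inv_def by blast
      moreover have "sj x - 1 \<noteq> sj x" using that by linarith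
      ultimately show ?thesis unfolding set_decode_addrow by simp
    qed
    have 3: "\<forall>q\<in>set_decode ?D. p1 q \<le> sj x"
      using rows unfolding set_decode_addrow by auto
    have "{q \<in> set_decode (sD x). p1 q < sj x} = {q \<in> set_decode ?D. p1 q < sj x}"
      unfolding set_decode_addrow by auto
    then have 4: "0 < sj x \<Longrightarrow> valid (swj x) (sj x) ?D"
      using I valid_cong unfolding inv_def by blast
    show ?thesis unfolding st conflict(4) inv_def prod_encode_inverse fst_conv snd_conv
      by (intro conjI impI allI; (rule 3 | rule 1 | erule 2 | erule 4 | (insert t, linarith) | simp))
  qed
qed

lemma st_cases:
  obtains (keep) "st (Suc s) = st s" "sw (st s) = 0 \<Longrightarrow> \<forall>q<fbound (Suc s) (st s). \<not> found E C r n (Suc s) (st s) q"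
      "sw (st s) \<noteq> 0 \<Longrightarrow> \<not> agree r (Suc s) (st s)"
  | (find) F U where "sw (st s) = 0"
      "st (Suc s) = mk (sj (st s)) (stj (st s)) (swj (st s)) (stt (st s)) (Suc (pr F (pr (Suc s) U))) (sD (st s))"
  | (confirm) "sw (st s) \<noteq> 0" "agree r (Suc s) (st s)" "coherent (st s)"
      "st (Suc s) = mk (Suc (sj (st s))) (stt (st s)) (sw (st s)) (Suc s) 0 (addrow (sD (st s)) (Suc (sj (st s))) (Suc s))"
  | (conflict) "sw (st s) \<noteq> 0" "agree r (Suc s) (st s)" "\<not> coherent (st s)"
      "st (Suc s) = mk (sj (st s)) (stj (st s)) (swj (st s)) (Suc s) 0 (addrow (sD (st s)) (sj (st s)) (Suc s))"
  by (rule step_cases[of E C r n "Suc s" "st s"]) (simp_all only: state.simps, blast+)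

lemma stt_le: "stt (st s) \<le> s" using inv_state unfolding inv_def by blast

lemma sj_Suc: "sj (st s) \<le> sj (st (Suc s))"
  by (cases rule: st_cases[of s]) simp_all

lemma sj_mono: "s \<le> s' \<Longrightarrow> sj (st s) \<le> sj (st s')"
  by (rule lift_Suc_mono_le[of "\<lambda>s. sj (st s)"]) (rule sj_Suc)

lemma stt_Suc: "stt (st s) \<le> stt (st (Suc s))"
  using stt_le[of s] by (cases rule: st_cases[of s]) simp_all

lemma stt_mono: "s \<le> s' \<Longrightarrow> stt (st s) \<le> stt (st s')"
  by (rule lift_Suc_mono_le[of "\<lambda>s. stt (st s)"]) (rule stt_Suc)

text \<open>The starting stage identifies an attempt, since both ways of ending it set
  \<open>stt\<close> to a stage not reached before.\<close>

lemma attempt: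
  assumes "s \<le> s'" "stt (st s) = stt (st s')"
  shows "sj (st s') = sj (st s) \<and> stj (st s') = stj (st s) \<and> swj (st s') = swj (st s) \<and> sD (st s') = sD (st s)
    \<and> (sw (st s) \<noteq> 0 \<longrightarrow> sw (st s') = sw (st s))"
  using assms
proof (induction s')
  case (Suc s')
  show ?case
  proof (cases "s = Suc s'")
    case False
    then have le: "s \<le> s'" using Suc.prems by simp
    then have eq: "stt (st s) = stt (st s')" "stt (st (Suc s')) = stt (st s')"
      using stt_mono[OF le] stt_Suc[of s'] Suc.prems(2) by linarith+
    note IH = Suc.IH[OF le eq(1)]
    show ?thesis
    proof (cases rule: st_cases[of s'])
      case keep then show ?thesis using IH by simp
    next
      case (find F U) then show ?thesis using IH by auto
    next
      case confirm then show ?thesis using eq(2) stt_le[of s'] by simp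
    next
      case conflict then show ?thesis using eq(2) stt_le[of s'] by simp
    qed
  qed simp
qed simp

text \<open>A witness records the stage at which it was found, so comparing a stage with
  \<open>wS\<close> decides whether the state shows the witness by then.\<close>

lemma witness_time:
  assumes "sw (st s) \<noteq> 0"
  shows "wS (sw (st s)) \<le> s \<and> (\<forall>s'\<le>s. (wS (sw (st s)) \<le> s' \<longrightarrow> stt (st s') = stt (st s) \<and> sw (st s') = sw (st s))
     \<and> (s' < wS (sw (st s)) \<longrightarrow> stt (st s') = stt (st s) \<longrightarrow> sw (st s') = 0))"
  using assms
proof (induction s)
  case (Suc s)
  show ?case
  proof (cases rule: st_cases[of s])
    case keep
    have "sw (st s) \<noteq> 0" using Suc.prems unfolding keep(1) .
    note IH = Suc.IH[OF this]
    show ?thesis unfolding keep(1)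
    proof (intro conjI allI impI)
      show "wS (sw (st s)) \<le> Suc s" using IH by linarith
      fix s' assume s': "s' \<le> Suc s"
      have 1: "stt (st s') = stt (st s) \<and> sw (st s') = sw (st s)" if "wS (sw (st s)) \<le> s'"
      proof (cases "s' = Suc s")
        case True show ?thesis unfolding True keep(1) by blast
      next
        case False
        then have "s' \<le> s" using s' by linarith
        then show ?thesis using IH that by blast
      qed
      show "stt (st s') = stt (st s)" "sw (st s') = sw (st s)" if "wS (sw (st s)) \<le> s'"
        using 1[OF that] by blast+
      show "sw (st s') = 0" if "s' < wS (sw (st s))" "stt (st s') = stt (st s)"
      proof -
        have "s' \<le> s" using that(1) IH by linarith
        then show ?thesis using IH that by blast
      qed
    qed
  next
    case (find F U)
    have 1: "wS (sw (st (Suc s))) = Suc s" "stt (st (Suc s)) = stt (st s)" using find by simp_all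
    have "sw (st s') = 0" if "s' < Suc s" "stt (st s') = stt (st (Suc s))" for s'
      using attempt[of s' s] that find(1) 1(2) by force
    then show ?thesis unfolding 1(1) by (metis le_antisym not_less order_refl)
  next
    case confirm then show ?thesis using Suc.prems by simp
  next
    case conflict then show ?thesis using Suc.prems by simp
  qed
qed simp

lemma level:
  assumes "s \<le> s'" "sj (st s') = sj (st s)"
  shows "stj (st s') = stj (st s) \<and> swj (st s') = swj (st s)"
  using assms
proof (induction s')
  case (Suc s')
  show ?case
  proof (cases "s = Suc s'")
    case False
    then have le: "s \<le> s'" using Suc.prems by simp
    then have eq: "sj (st s') = sj (st s)" "sj (st (Suc s')) = sj (st s')"
      using sj_mono[OF le] sj_Suc[of s'] Suc.prems(2) by linarith+
    note IH = Suc.IH[OF le eq(1)]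
    show ?thesis
      by (cases rule: st_cases[of s']) (use IH eq(2) in simp_all)
  qed simp
qed simp

lemma lower_rows:
  assumes "s \<le> s'" "p1 q < sj (st s)"
  shows "q \<in> set_decode (sD (st s')) \<longleftrightarrow> q \<in> set_decode (sD (st s))"
  using assms
proof (induction s')
  case (Suc s')
  show ?case
  proof (cases "s = Suc s'")
    case False
    then have le: "s \<le> s'" using Suc.prems by simp
    note IH = Suc.IH[OF le Suc.prems(2)]
    have "p1 q < sj (st s')" using sj_mono[OF le] Suc.prems(2) by linarith
    then show ?thesis
      by (cases rule: st_cases[of s']) (use IH in \<open>simp_all add: set_decode_addrow\<close>)
  qed simp
qed simp

lemma confirmed:
  assumes "sj (st s) = Suc j"
  shows "\<exists>c<s. sj (st c) = j \<and> sj (st (Suc c)) = Suc j \<and> sw (st c) \<noteq> 0 \<and> agree r (Suc c) (st c)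
    \<and> stj (st s) = stt (st c) \<and> swj (st s) = sw (st c)"
  using assms
proof (induction s)
  case (Suc s)
  show ?case
  proof (cases "sj (st s) = Suc j")
    case True
    moreover have "stj (st (Suc s)) = stj (st s) \<and> swj (st (Suc s)) = swj (st s)"
      by (rule level) (use Suc.prems True in simp_all)
    ultimately show ?thesis using Suc.IH less_SucI by metis
  next
    case False
    show ?thesis
    proof (cases rule: st_cases[of s])
      case confirm
      then have "sj (st s) = j" using Suc.prems by simp
      then show ?thesis using confirm Suc.prems by (intro exI[of _ s]) simp
    qed (use False Suc.prems in simp_all)
  qed
qed simp

section \<open>The matrix of a process and its possible outcomes\<close>

definition visible :: "nat \<Rightarrow> nat \<Rightarrow> bool" where
  "visible s q \<longleftrightarrow> sj (st s) < p1 q \<and> p2 q < s \<or> q \<in> set_decode (sD (st s))"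

definition Dcol :: "nat set" where "Dcol = {q. \<exists>s. visible s q}"

text \<open>Raising the level might hide the part of the next row that has already been enumerated;
  \<open>addrow\<close> fills that row up to the new stage, so nothing is retracted.\<close>

lemma visible_Suc: "visible s q \<Longrightarrow> visible (Suc s) q"
  unfolding visible_def
  by (cases rule: st_cases[of s]) (auto simp: set_decode_addrow simp del: state.simps)

lemma visible_mono: "visible s q \<Longrightarrow> s \<le> s' \<Longrightarrow> visible s' q"
  by (induction s') (auto simp: le_Suc_eq intro: visible_Suc)

lemma Dcol_row: "p1 q < sj (st s) \<Longrightarrow> q \<in> Dcol \<longleftrightarrow> q \<in> set_decode (sD (st s))"
proof
  assume j: "p1 q < sj (st s)" and "q \<in> Dcol"
  then obtain s' where "visible s' q" unfolding Dcol_def by blast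
  then have v: "visible (max s s') q" by (rule visible_mono) simp
  have "p1 q < sj (st (max s s'))" using j sj_mono[of s "max s s'"] by linarith
  then have "q \<in> set_decode (sD (st (max s s')))" using v unfolding visible_def by simp
  then show "q \<in> set_decode (sD (st s))" using lower_rows[of s "max s s'" q] j by simp
next
  assume "q \<in> set_decode (sD (st s))"
  then show "q \<in> Dcol" unfolding Dcol_def visible_def by blast
qed

text \<open>The data left behind by a process whose level stops increasing: from row \<open>p\<close> on all rows are full,
  \<open>T\<close> is the length of row \<open>p - 1\<close>, and the lookup retrieves the witness \<open>w\<close> from the stage on at which it
  was found (\<open>w = 0\<close> if there is none).\<close>

definition world :: "nat \<Rightarrow> nat \<Rightarrow> nat \<Rightarrow> nat \<Rightarrow> bool" where
  "world p T w D \<longleftrightarrow> 0 < p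
     \<and> (\<forall>q. q \<in> Dcol \<longleftrightarrow> p \<le> p1 q \<or> q \<in> set_decode D \<and> p1 q < p)
     \<and> (\<forall>y. pr (p - 1) y \<in> set_decode D \<longleftrightarrow> y < T)
     \<and> (\<forall>s. lookup p T (st s) = (if w \<noteq> 0 \<and> wS w \<le> s then w else 0))
     \<and> (w \<noteq> 0 \<longrightarrow> valid w p D)"

definition agreeK :: "nat \<Rightarrow> nat \<Rightarrow> nat set \<Rightarrow> bool" where
  "agreeK s p U \<longleftrightarrow> conv (sat (Kst s) s) (p2 r) p U"

text \<open>With level and attempt final, neither a confirmation nor a conflict occurs any more, so
  a witness, once present, is never agreed with again. The lookup is right at early stages too,
  because the starting stage tells the final attempt from all others.\<close>

lemma world_quiet:
  assumes j: "\<And>s. s0 \<le> s \<Longrightarrow> sj (st s) = j" and t: "\<And>s. s0 \<le> s \<Longrightarrow> stt (st s) = stt (st s0)"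
  obtains w where "world (Suc j) (stt (st s0)) w (sD (st s0))"
    "w = 0 \<Longrightarrow> \<forall>s\<ge>s0. sD (st s) = sD (st s0) \<and> (\<forall>q<fbound (Suc s) (st s). \<not> found E C r n (Suc s) (st s) q)"
    "w \<noteq> 0 \<Longrightarrow> \<exists>s1. \<forall>s\<ge>s1. \<not> agreeK s (Suc j) (set_decode (wU w))"
proof -
  have D: "sD (st s) = sD (st s0)" if "s0 \<le> s" for s using attempt[OF that] t[OF that] by simp
  have jle: "sj (st s) \<le> j" for s using sj_mono[of s "max s s0"] j[of "max s s0"] by simp
  have I: "inv s0 (st s0)" by (rule inv_state)
  obtain w S where S: "s0 \<le> S" "w = sw (st S)" and w0: "w = 0 \<Longrightarrow> \<forall>s\<ge>s0. sw (st s) = 0"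
  proof (cases "\<exists>s\<ge>s0. sw (st s) \<noteq> 0")
    case True then show ?thesis using that by blast
  next
    case False then show ?thesis using that[of s0 0] by auto
  qed
  have ww: "sw (st s) = w" if "S \<le> s" for s
  proof (cases "w = 0")
    case True then show ?thesis using w0 that S(1) by simp
  next
    case False
    have "stt (st S) = stt (st s)" using t[of S] t[of s] S(1) that by simp
    then show ?thesis using attempt[OF that] False S(2) by simp
  qed
  have "q \<in> Dcol \<longleftrightarrow> Suc j \<le> p1 q \<or> q \<in> set_decode (sD (st s0)) \<and> p1 q < Suc j" for q
  proof
    assume "q \<in> Dcol"
    then obtain s where "visible s q" unfolding Dcol_def by blast
    then have "visible (max s s0) q" by (rule visible_mono) simp
    then have "j < p1 q \<or> q \<in> set_decode (sD (st s0))" unfolding visible_def using j[of "max s s0"] D[of "max s s0"] by auto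
    then show "Suc j \<le> p1 q \<or> q \<in> set_decode (sD (st s0)) \<and> p1 q < Suc j"
      by (cases "Suc j \<le> p1 q") auto
  next
    assume "Suc j \<le> p1 q \<or> q \<in> set_decode (sD (st s0)) \<and> p1 q < Suc j"
    then show "q \<in> Dcol"
    proof
      assume "Suc j \<le> p1 q"
      then have "visible (max s0 (Suc (p2 q))) q" unfolding visible_def using j[of "max s0 (Suc (p2 q))"] by (auto simp: less_max_iff_disj)
      then show ?thesis unfolding Dcol_def by blast
    next
      assume "q \<in> set_decode (sD (st s0)) \<and> p1 q < Suc j"
      then have "visible s0 q" unfolding visible_def by blast
      then show ?thesis unfolding Dcol_def by blast
    qed
  qed
  moreover have "\<forall>y. pr (Suc j - 1) y \<in> set_decode (sD (st s0)) \<longleftrightarrow> y < stt (st s0)"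
    using I j[of s0] unfolding inv_def by simp
  moreover have "lookup (Suc j) (stt (st s0)) (st s) = (if w \<noteq> 0 \<and> wS w \<le> s then w else 0)" for s
  proof -
    define S' where "S' = max s S"
    have S': "s \<le> S'" "S \<le> S'" unfolding S'_def by simp_all
    then have w': "sw (st S') = w" "stt (st S') = stt (st s0)" using ww t[of S'] S(1) by simp_all
    show ?thesis
    proof (cases "stt (st s) = stt (st s0)")
      case True
      then have a: "sj (st s) = j" "sw (st s) \<noteq> 0 \<longrightarrow> w = sw (st s)"
        using attempt[OF S'(1)] w' j[of S'] S' S(1) by simp_all
      have l: "lookup (Suc j) (stt (st s0)) (st s) = sw (st s)" unfolding lookup_def using a True by simp
      show ?thesis
      proof (cases "w = 0")
        case True
        then have "sw (st s) = 0" using a(2) by metis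
        then show ?thesis using l True by simp
      next
        case False
        then have "sw (st s) = (if wS w \<le> s then w else 0)"
          using witness_time[of S'] w' \<open>stt (st s) = stt (st s0)\<close> S'(1) by auto
        then show ?thesis using l False by simp
      qed
    next
      case False
      \<comment> \<open>Neither case of \<open>lookup\<close> applies: the second one would need
        level \<open>Suc j\<close>, which is never reached.\<close>
      then have "lookup (Suc j) (stt (st s0)) (st s) = 0" unfolding lookup_def using jle[of s] by simp
      moreover have "w \<noteq> 0 \<Longrightarrow> \<not> wS w \<le> s"
        using witness_time[of S'] w' False S'(1) by auto
      ultimately show ?thesis by auto
    qed
  qed
  moreover have "valid w (Suc j) (sD (st s0))" if "w \<noteq> 0"
    using inv_state[of S] that S j[of S] D[of S] unfolding inv_def by simp
  ultimately have "world (Suc j) (stt (st s0)) w (sD (st s0))" unfolding world_def by simp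
  moreover have noev: "stt (st (Suc s)) = stt (st s)" if "s0 \<le> s" for s using t[of s] t[of "Suc s"] that by simp
  have "\<forall>q<fbound (Suc s) (st s). \<not> found E C r n (Suc s) (st s) q" if "w = 0" "s0 \<le> s" for s
  proof -
    have 0: "sw (st s) = 0" "sw (st (Suc s)) = 0" using w0[OF that(1)] that(2) le_SucI by blast+
    show ?thesis
    proof (cases rule: st_cases[of s])
      case keep then show ?thesis using keep(2)[OF 0(1)] by blast
    next
      case (find F U) then show ?thesis using 0(2) by simp
    next
      case confirm then show ?thesis using 0(1) by blast
    next
      case conflict then show ?thesis using 0(1) by blast
    qed
  qed
  moreover have "\<not> agreeK s (Suc j) (set_decode (wU w))" if "w \<noteq> 0" and s: "Suc S \<le> s" for s
  proof -
    obtain u where u: "s = Suc u" "S \<le> u" using s by (cases s) auto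
    then have x: "sw (st u) = w" "sj (st u) = j" "s0 \<le> u" using ww j S(1) by auto
    show ?thesis
    proof (cases rule: st_cases[of u])
      case keep
      then show ?thesis using x that(1) u(1) unfolding agree_def agreeK_def by simp
    next
      case (find F U) then show ?thesis using x that(1) by simp
    next
      case confirm then show ?thesis using noev[OF x(3)] stt_le[of u] by simp
    next
      case conflict then show ?thesis using noev[OF x(3)] stt_le[of u] by simp
    qed
  qed
  ultimately show ?thesis using that[of w] D by metis
qed

text \<open>Each conflict extends row \<open>j\<close>, so this row becomes full as well. That is
  the shape presumed by the witness which confirmed level \<open>j\<close>, hence
  \<open>p = j\<close> and not \<open>Suc j\<close>. Each conflict also exhibits answers given by
  the approximation to \<Psi> that contradict this witness.\<close>

lemma world_busy:
  assumes j: "\<And>s. s0 \<le> s \<Longrightarrow> sj (st s) = j" and t: "\<And>s1. s0 \<le> s1 \<Longrightarrow> \<exists>s\<ge>s1. stt (st s) \<noteq> stt (st s1)"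
  obtains T w D where "world j T w D" "w \<noteq> 0"
    "\<forall>s1. \<exists>s\<ge>s1. \<exists>U. agreeK s (Suc j) U \<and> (\<exists>i<j. (i \<in> U) \<noteq> (i \<in> set_decode (wU w)))"
proof -
  have jle: "sj (st s) \<le> j" for s using sj_mono[of s "max s s0"] j[of "max s s0"] by simp
  have conf: "\<exists>s\<ge>s1. sw (st s) \<noteq> 0 \<and> agree r (Suc s) (st s) \<and> \<not> coherent (st s)
      \<and> st (Suc s) = mk (sj (st s)) (stj (st s)) (swj (st s)) (Suc s) 0 (addrow (sD (st s)) (sj (st s)) (Suc s))"
    if s1: "s0 \<le> s1" for s1
  proof (rule ccontr)
    assume no: "\<not> ?thesis"
    have "stt (st s) = stt (st s1)" if "s1 \<le> s" for s
      using that
    proof (induction s)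
      case (Suc s)
      show ?case
      proof (cases "s1 = Suc s")
        case False
        then have le: "s1 \<le> s" using Suc.prems by simp
        show ?thesis
        proof (cases rule: st_cases[of s])
          case keep then show ?thesis using Suc.IH[OF le] by simp
        next
          case (find F U) then show ?thesis using Suc.IH[OF le] by simp
        next
          case confirm then show ?thesis using j[of s] j[of "Suc s"] le s1 by simp
        next
          case conflict
          then have "\<exists>s\<ge>s1. sw (st s) \<noteq> 0 \<and> agree r (Suc s) (st s) \<and> \<not> coherent (st s)
      \<and> st (Suc s) = mk (sj (st s)) (stj (st s)) (swj (st s)) (Suc s) 0 (addrow (sD (st s)) (sj (st s)) (Suc s))"
            using le by (intro exI[of _ s] conjI)
          then show ?thesis using no by (rule notE[rotated])
        qed
      qed simp
    qed simp
    then show False using t[OF s1] by blast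
  qed
  obtain c0 where "s0 \<le> c0" "\<not> coherent (st c0)" using conf[of s0] by blast
  \<comment> \<open>At level \<open>0\<close> nothing has been confirmed, so \<open>coherent\<close>
    holds vacuously and no conflict is possible.\<close>
  then have "0 < j" using j[of c0] unfolding coherent_def by auto
  then obtain i where ji: "j = Suc i" by (cases j) auto
  let ?w = "swj (st s0)" and ?T = "stj (st s0)" and ?D = "sD (st s0)"
  have wj: "swj (st s) = ?w" "stj (st s) = ?T" if "s0 \<le> s" for s
    using level[OF that] j[OF that] j[of s0] by simp_all
  have I: "inv s0 (st s0)" by (rule inv_state)
  then have v: "valid ?w j ?D" and T: "\<forall>y. pr (j - 1) y \<in> set_decode ?D \<longleftrightarrow> y < ?T"
    using \<open>0 < j\<close> j[of s0] unfolding inv_def by simp_all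
  then have w0: "?w \<noteq> 0" unfolding valid_def by blast
  have "q \<in> Dcol \<longleftrightarrow> j \<le> p1 q \<or> q \<in> set_decode ?D \<and> p1 q < j" for q
  proof (cases "p1 q < j")
    case True then show ?thesis using Dcol_row[of q s0] j[of s0] by auto
  next
    case False
    obtain s where s: "max s0 (Suc (p2 q)) \<le> s"
      "st (Suc s) = mk (sj (st s)) (stj (st s)) (swj (st s)) (Suc s) 0 (addrow (sD (st s)) (sj (st s)) (Suc s))"
      using conf[of "max s0 (Suc (p2 q))"] by auto
    have "visible (Suc s) q"
    proof (cases "p1 q = j")
      case True
      then have "q \<in> set_decode (sD (st (Suc s)))" using s j[of s] by (simp add: set_decode_addrow del: state.simps)
      then show ?thesis unfolding visible_def by blast
    next
      case False
      then show ?thesis using \<open>\<not> p1 q < j\<close> s(1) j[of "Suc s"] unfolding visible_def by simp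
    qed
    then show ?thesis using False unfolding Dcol_def by auto
  qed
  moreover have "lookup j ?T (st s) = (if ?w \<noteq> 0 \<and> wS ?w \<le> s then ?w else 0)" for s
  proof -
    obtain c where c: "c < s0" "sj (st c) = i" "sj (st (Suc c)) = j" "sw (st c) \<noteq> 0" "?T = stt (st c)" "?w = sw (st c)"
      using confirmed[of s0 i] j[of s0] ji by auto
    have wt: "wS ?w \<le> c" "\<And>s. s \<le> c \<Longrightarrow> wS ?w \<le> s \<Longrightarrow> stt (st s) = ?T \<and> sw (st s) = ?w"
      "\<And>s. s \<le> c \<Longrightarrow> s < wS ?w \<Longrightarrow> stt (st s) = ?T \<Longrightarrow> sw (st s) = 0"
      unfolding c(5,6) using witness_time[OF c(4)] by blast+
    show ?thesis
    proof (cases "s \<le> c")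
      case True
      then have le: "sj (st s) \<le> i" using sj_mono[OF True] c(2) by simp
      show ?thesis
      proof (cases "stt (st s) = ?T")
        case T: True
        then have "sj (st s) = i" using attempt[OF True] c by simp
        then have "lookup j ?T (st s) = sw (st s)" unfolding lookup_def using T ji by simp
        moreover have "sw (st s) = (if wS ?w \<le> s then ?w else 0)" using wt(2,3)[OF True] T by (cases "wS ?w \<le> s") auto
        ultimately show ?thesis using w0 by simp
      next
        case False
        then have "lookup j ?T (st s) = 0" unfolding lookup_def using le ji by simp
        moreover have "\<not> wS ?w \<le> s" using wt(2)[OF True] False by blast
        ultimately show ?thesis by simp
      qed
    next
      case False
      then have "j \<le> sj (st s)" using sj_mono[of "Suc c" s] c(3) by simp
      then have sj: "sj (st s) = j" using jle[of s] by simp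
      have "stj (st s) = ?T \<and> swj (st s) = ?w"
      proof (cases "s \<le> s0")
        case True then show ?thesis using level[OF True] sj j[of s0] by simp
      next
        case False then show ?thesis using wj[of s] by simp
      qed
      then have "lookup j ?T (st s) = ?w" unfolding lookup_def using sj by simp
      moreover have "wS ?w \<le> s" using wt(1) False by linarith
      ultimately show ?thesis using w0 by simp
    qed
  qed
  ultimately have "world j ?T ?w ?D" using \<open>0 < j\<close> T v unfolding world_def by simp
  moreover have "\<exists>s\<ge>s1. \<exists>U. agreeK s (Suc j) U \<and> (\<exists>i<j. (i \<in> U) \<noteq> (i \<in> set_decode (wU ?w)))" for s1
  proof -
    obtain s where s: "max s0 s1 \<le> s" "agree r (Suc s) (st s)" "\<not> coherent (st s)"
      using conf[OF max.cobounded1[of s0 s1]] by blast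
    have "s0 \<le> s" using s(1) by simp
    then have x: "sj (st s) = j" "swj (st s) = ?w" by (rule j, rule wj(1))
    have "agreeK (Suc s) (Suc j) (set_decode (wU (sw (st s))))"
      using s(2) x(1) unfolding agree_def agreeK_def by simp
    moreover have "\<exists>i<j. (i \<in> set_decode (wU (sw (st s)))) \<noteq> (i \<in> set_decode (wU ?w))"
      using s(3) x unfolding coherent_def by simp
    moreover have "s1 \<le> Suc s" using s(1) by simp
    ultimately show ?thesis by blast
  qed
  ultimately show ?thesis using that w0 by blast
qed

section \<open>Confirmed answers and the three outcomes\<close>

definition approx :: "nat \<Rightarrow> nat set" where "approx s = set_decode (wU (swj (st s)))"

text \<open>Only a confirmation replaces the confirmed witness, and coherence makes the new one keep
  all answers below the old level.\<close>

lemma approx_stable: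
  assumes "s \<le> s'" "i < sj (st s)" shows "i \<in> approx s' \<longleftrightarrow> i \<in> approx s"
  using assms
proof (induction s')
  case (Suc s')
  show ?case
  proof (cases "s = Suc s'")
    case False
    then have le: "s \<le> s'" using Suc.prems by simp
    note IH = Suc.IH[OF le Suc.prems(2)]
    have j: "i < sj (st s')" using sj_mono[OF le] Suc.prems(2) by linarith
    show ?thesis
    proof (cases rule: st_cases[of s'])
      case confirm
      then show ?thesis using IH j unfolding approx_def coherent_def by simp
    qed (use IH in \<open>simp_all add: approx_def\<close>)
  qed simp
qed simp

lemma approx_agrees:
  assumes "\<And>i. \<exists>s. i < sj (st s)"
  shows "\<exists>s\<ge>s1. i < sj (st s) \<and> agreeK s (sj (st s)) (approx s)"
proof -
  \<comment> \<open>The level never exceeds the stage, so a level beyond \<open>s1\<close> can only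
    be confirmed after stage \<open>s1\<close>.\<close>
  let ?j = "max s1 i"
  have "\<exists>s. sj (st s) = Suc ?j"
  proof -
    define m where "m = (LEAST s. ?j < sj (st s))"
    have m: "?j < sj (st m)" unfolding m_def using assms by (rule LeastI_ex)
    then obtain k where k: "m = Suc k" by (cases m) auto
    then have "\<not> ?j < sj (st k)" using not_less_Least[of k "\<lambda>s. ?j < sj (st s)"] unfolding m_def by simp
    then have "sj (st m) = Suc ?j" using m k by (cases rule: st_cases[of k]) auto
    then show ?thesis by blast
  qed
  then obtain s where "sj (st s) = Suc ?j" by blast
  from confirmed[OF this] obtain c where c: "sj (st c) = ?j" "sj (st (Suc c)) = Suc ?j" "agree r (Suc c) (st c)" by blast
  have "approx (Suc c) = set_decode (wU (sw (st c)))"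
    using c(1,2) unfolding approx_def by (cases rule: st_cases[of c]) simp_all
  then have "agreeK (Suc c) (sj (st (Suc c))) (approx (Suc c))"
    using c unfolding agree_def agreeK_def by simp
  moreover have "Suc ?j \<le> Suc c" using inv_state[of "Suc c"] c(2) unfolding inv_def by metis
  ultimately show ?thesis using c(2) by (intro exI[of _ "Suc c"]) auto
qed

lemma outcome:
  obtains (unbounded) "\<And>i. \<exists>s. i < sj (st s)"
  | (quiet) s0 j where "\<And>s. s0 \<le> s \<Longrightarrow> sj (st s) = j" "\<And>s. s0 \<le> s \<Longrightarrow> stt (st s) = stt (st s0)"
  | (busy) s0 j where "\<And>s. s0 \<le> s \<Longrightarrow> sj (st s) = j" "\<And>s1. s0 \<le> s1 \<Longrightarrow> \<exists>s\<ge>s1. stt (st s) \<noteq> stt (st s1)"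
proof (cases "\<forall>i. \<exists>s. i < sj (st s)")
  case True then show ?thesis using unbounded by blast
next
  case False
  then obtain i where i: "\<And>s. sj (st s) \<le> i" by (metis not_less)
  define j where "j = Max (range (\<lambda>s. sj (st s)))"
  have "range (\<lambda>s. sj (st s)) \<subseteq> {..i}" unfolding image_subset_iff atMost_iff using i by blast
  then have fin: "finite (range (\<lambda>s. sj (st s)))" by (rule finite_subset) simp
  have "j \<in> range (\<lambda>s. sj (st s))" unfolding j_def by (rule Max_in[OF fin]) simp
  then obtain s0 where s0: "j = sj (st s0)" by (rule rangeE)
  have j: "sj (st s) = j" if "s0 \<le> s" for s
  proof -
    have "sj (st s) \<le> j" unfolding j_def by (rule Max_ge[OF fin]) (rule rangeI)
    then show ?thesis using sj_mono[OF that] s0 by linarith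
  qed
  show ?thesis
  proof (cases "\<exists>s1\<ge>s0. \<forall>s\<ge>s1. stt (st s) = stt (st s1)")
    case True
    then obtain s1 where s1: "s1 \<ge> s0" "\<forall>s\<ge>s1. stt (st s) = stt (st s1)" by blast
    show ?thesis
    proof (rule quiet[of s1 j])
      fix s assume s: "s1 \<le> s"
      show "sj (st s) = j" by (rule j[OF order_trans[OF s1(1) s]])
      show "stt (st s) = stt (st s1)" using s1(2) s by blast
    qed
  next
    case False
    show ?thesis
    proof (rule busy[of s0 j])
      fix s1 assume "s0 \<le> s1"
      then show "\<exists>s\<ge>s1. stt (st s) \<noteq> stt (st s1)" using False by blast
    qed (rule j)
  qed
qed

end

section \<open>Blocks and their base columns\<close>

abbreviation Pos :: "nat \<Rightarrow> nat \<Rightarrow> nat" where "Pos s r \<equiv> pos E C s r"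
abbreviation Info :: "nat \<Rightarrow> nat \<Rightarrow> nat \<Rightarrow> nat" where "Info r n s \<equiv> info E C r n s"
abbreviation Block :: "nat \<Rightarrow> nat \<Rightarrow> nat \<Rightarrow> nat \<Rightarrow> bool" where "Block r n s z \<equiv> block E C r n s z"

text \<open>Stages below \<open>n\<close> are exempt, because a lower block may announce a wrong
  base column before its witness is found. For the columns from \<open>n\<close> on they are
  harmless: a number there is at least \<open>n\<close> and is enumerated only at a larger
  stage.\<close>

definition settled :: "nat \<Rightarrow> nat \<Rightarrow> bool" where
  "settled r n \<longleftrightarrow> (\<forall>s\<ge>n. Pos s r = 0 \<or> Pos s r = Suc n) \<and> (\<exists>s0. \<forall>s\<ge>s0. Pos s r = Suc n)"

lemma settled_unique: "settled r n \<Longrightarrow> settled r m \<Longrightarrow> n = m"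
proof -
  assume "settled r n" "settled r m"
  then obtain s0 s1 where "\<forall>s\<ge>s0. Pos s r = Suc n" "\<forall>s\<ge>s1. Pos s r = Suc m" unfolding settled_def by blast
  then have "Pos (max s0 s1) r = Suc n" "Pos (max s0 s1) r = Suc m"
    using max.cobounded1[of s0 s1] max.cobounded2[of s1 s0] by blast+
  then show ?thesis by simp
qed

lemma settled_less: "settled r n \<Longrightarrow> settled r' m \<Longrightarrow> r < r' \<Longrightarrow> n + 4 \<le> m"
proof -
  assume "settled r n" "settled r' m" and r: "r < r'"
  then obtain s0 s1 where "\<forall>s\<ge>s0. Pos s r = Suc n" "\<forall>s\<ge>s1. Pos s r' = Suc m" unfolding settled_def by blast
  then have 1: "Pos (max s0 s1) r = Suc n" "Pos (max s0 s1) r' = Suc m"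
    using max.cobounded1[of s0 s1] max.cobounded2[of s1 s0] by blast+
  then have "Pos (max s0 s1) (Suc r) \<noteq> 0" "Pos (max s0 s1) (Suc r) \<le> Suc m"
    using pos_mono[of E C "max s0 s1" r' r] r by simp_all
  then show ?thesis using pos_Suc_ge[of E C "max s0 s1" r] 1 by linarith
qed

lemma settled_le: "settled r n \<Longrightarrow> settled r' m \<Longrightarrow> r \<le> r' \<Longrightarrow> n \<le> m"
  using settled_less[of r n r' m] settled_unique[of r n m] by (cases "r = r'") auto

locale settled_block = process +
  assumes settled_below: "\<And>r'. r' \<le> r \<Longrightarrow> \<exists>m. settled r' m" and settled_here: "settled r n"
begin

text \<open>A block fills its own four columns and beyond them only copies into the columns skipped
  by its successor; both end before \<open>n\<close>.\<close>

lemma low_block: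
  assumes r': "r' < r" and s: "n \<le> s" and p: "Pos s r' \<noteq> 0" and b: "Block r' (Pos s r' - 1) s z"
  shows "p1 z < n"
proof -
  obtain m where m: "settled r' m" using settled_below r' by fastforce
  then have mn: "m + 4 \<le> n" using settled_less settled_here r' by blast
  then have pm: "Pos s r' = Suc m" using m s p unfolding settled_def by (meson le_trans le_add1)
  show ?thesis
  proof (cases "p1 z < m + 4")
    case True then show ?thesis using mn by linarith
  next
    case False
    then have i: "Info r' m s \<noteq> 0" "p1 z < p1 (Info r' m s - 1)" using b pm unfolding block_def by auto
    then have q: "Pos s (Suc r') = Suc (p1 (Info r' m s - 1))" using pm by simp
    obtain m' where m': "settled (Suc r') m'" using settled_below[of "Suc r'"] r' by auto
    then have le: "m' \<le> n" using settled_le settled_here r' by (meson Suc_leI)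
    then have "Pos s (Suc r') = Suc m'" using m' s q unfolding settled_def by (metis le_trans nat.distinct(1))
    then show ?thesis using q i le by simp
  qed
qed

lemma base_ge: "r \<le> n"
proof -
  obtain s where "Pos s r = Suc n" using settled_here unfolding settled_def by blast
  then show ?thesis using pos_ge[of E C s r] by simp
qed

lemma Pos_cases: "n \<le> s \<Longrightarrow> Pos s r = 0 \<or> Pos s r = Suc n"
  using settled_here unfolding settled_def by blast

lemma Pos_eventually: "\<exists>s0. \<forall>s\<ge>s0. Pos s r = Suc n"
  using settled_here unfolding settled_def by blast

lemma enum_cases:
  assumes z: "n \<le> p1 z" and e: "enum E C s z"
  shows "Pos s r = Suc n \<and> (Block r n s z \<or> (\<exists>r'>r. Pos s r' \<noteq> 0 \<and> Block r' (Pos s r' - 1) s z))"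
proof -
  from e obtain r' where zs: "z < s" and r': "Pos s r' \<noteq> 0" "Block r' (Pos s r' - 1) s z"
    unfolding enum_def by blast
  have s: "n \<le> s" using z zs p_le(1)[of z] by linarith
  have "\<not> r' < r" using low_block[OF _ s r'] z by linarith
  then consider "r' = r" | "r < r'" by linarith
  then show ?thesis
  proof cases
    case 1 then show ?thesis using r' Pos_cases[OF s] by auto
  next
    case 2
    then have "Pos s r \<noteq> 0" using pos_mono[OF r'(1) 2] by blast
    then have "Pos s r = Suc n" using Pos_cases[OF s] by (simp only: simp_thms)
    moreover have "\<exists>r'>r. Pos s r' \<noteq> 0 \<and> Block r' (Pos s r' - 1) s z"
      by (rule exI[of _ r'], intro conjI 2 r')
    ultimately show ?thesis by (intro conjI disjI2)
  qed
qed

lemma enum_role: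
  assumes "n \<le> p1 z" "p1 z < n + 4"
  shows "enum E C s z \<longleftrightarrow> z < s \<and> Pos s r = Suc n \<and> Block r n s z"
proof
  assume e: "enum E C s z"
  have "\<not> (r < r' \<and> Pos s r' \<noteq> 0 \<and> Block r' (Pos s r' - 1) s z)" if "Pos s r = Suc n" for r'
  proof
    assume a: "r < r' \<and> Pos s r' \<noteq> 0 \<and> Block r' (Pos s r' - 1) s z"
    then have "Pos s (Suc r) \<noteq> 0" "Pos s (Suc r) \<le> Pos s r'" using pos_mono[of E C s r' r] by blast+
    then have "n + 4 \<le> Pos s r' - 1" using pos_Suc_ge[of E C s r] that by linarith
    moreover have "Pos s r' - 1 \<le> p1 z" using a block_ge by blast
    ultimately show False using assms by linarith
  qed
  then show "z < s \<and> Pos s r = Suc n \<and> Block r n s z" using enum_cases[OF assms(1) e] e unfolding enum_def by blast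
next
  assume "z < s \<and> Pos s r = Suc n \<and> Block r n s z"
  then show "enum E C s z" unfolding enum_def using base_ge assms(1) by (intro conjI exI[of _ r]) auto
qed

lemma block_mono:
  assumes "Block r n s z" "s \<le> s'" "p1 z < n + 4" shows "Block r n s' z"
proof -
  have v: "(sj (st s) < p1 (p2 z) \<and> p2 (p2 z) < s \<or> p2 z \<in> set_decode (sD (st s))) \<Longrightarrow>
    (sj (st s') < p1 (p2 z) \<and> p2 (p2 z) < s' \<or> p2 z \<in> set_decode (sD (st s')))"
    using visible_mono[of s "p2 z" s'] assms(2) unfolding visible_def by blast
  have ex: "(\<exists>q<s. P q) \<Longrightarrow> (\<exists>q<s'. P q)" for P using assms(2) order_less_le_trans by blast
  consider "p1 z = n" | "p1 z = n + 1" | "p1 z = n + 2" | "p1 z = n + 3"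
    using block_ge[OF assms(1)] assms(3) by linarith
  then show ?thesis
  proof cases
    case 1
    then have "p2 z = 0 \<and> J (sat {} s) (p1 r) (Suc (pr z 0)) 0" using assms(1) unfolding block_def by linarith
    then show ?thesis using 1 J_sat_mono[OF _ assms(2)] unfolding block_def by blast
  next
    case 2
    then have "sj (st s) < p1 (p2 z) \<and> p2 (p2 z) < s \<or> p2 z \<in> set_decode (sD (st s))"
      using assms(1) unfolding block_def by linarith
    then show ?thesis using 2 v unfolding block_def by blast
  next
    case 3
    then have "\<exists>q<s. p1 q = n + 1 \<and> p1 (p2 q) = p2 z \<and> q \<notin> C" using assms(1) unfolding block_def by simp
    from ex[OF this] show ?thesis using 3 unfolding block_def by blast
  next
    case 4
    then have "p2 z = 0" and q: "\<exists>q<s. p1 q = n + 2 \<and> q \<notin> C" using assms(1) unfolding block_def by simp_all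
    then show ?thesis using 4 ex[OF q] unfolding block_def by blast
  qed
qed

text \<open>The block may be invisible at stages where \<open>Pos s r\<close> is still
  \<open>0\<close>; since its actions in these columns are monotone in the stage, nothing is
  missed.\<close>

lemma role:
  assumes "n \<le> p1 z" "p1 z < n + 4"
  shows "z \<in> C \<longleftrightarrow> (\<exists>s. Block r n s z)"
proof
  assume "z \<in> C" then show "\<exists>s. Block r n s z" using enum_role[OF assms] C_iff by blast
next
  assume "\<exists>s. Block r n s z"
  then obtain s where s: "Block r n s z" by blast
  obtain s0 where s0: "\<forall>s\<ge>s0. Pos s r = Suc n" using Pos_eventually by blast
  let ?s = "max s (max s0 (Suc z))"
  have "Block r n ?s z" by (rule block_mono[OF s _ assms(2)]) simp
  moreover have "Pos ?s r = Suc n" using s0 by simp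
  moreover have "z < ?s" by (simp add: less_max_iff_disj)
  ultimately have "enum E C ?s z" using enum_role[OF assms] by blast
  then show "z \<in> C" using C_iff by blast
qed

lemma column_0: "pr n y \<in> C \<longleftrightarrow> y = 0 \<and> (\<exists>s. J (sat {} s) (p1 r) (Suc (pr (pr n 0) 0)) 0)"
proof -
  have "pr n y \<in> C \<longleftrightarrow> (\<exists>s. y = 0 \<and> J (sat {} s) (p1 r) (Suc (pr (pr n y) 0)) 0)"
    unfolding role[of "pr n y", simplified] by (simp add: block_def)
  then show ?thesis by auto
qed

lemma column_1: "pr (n + 1) q \<in> C \<longleftrightarrow> q \<in> Dcol"
proof -
  have "n \<le> p1 (pr (n + 1) q)" "p1 (pr (n + 1) q) < n + 4" by simp_all
  from role[OF this] show ?thesis by (simp add: block_def Dcol_def visible_def)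
qed

lemma column_2: "pr (n + 2) i \<in> C \<longleftrightarrow> (\<exists>y. pr i y \<notin> Dcol)"
proof -
  have "n \<le> p1 (pr (n + 2) i)" "p1 (pr (n + 2) i) < n + 4" by simp_all
  from role[OF this] have "pr (n + 2) i \<in> C \<longleftrightarrow> (\<exists>s. \<exists>q<s. p1 q = n + 1 \<and> p1 (p2 q) = i \<and> q \<notin> C)"
    by (simp add: block_def)
  also have "\<dots> \<longleftrightarrow> (\<exists>q. p1 q = n + 1 \<and> p1 (p2 q) = i \<and> q \<notin> C)" by blast
  also have "\<dots> \<longleftrightarrow> (\<exists>y. pr (n + 1) (pr i y) \<notin> C)"
  proof
    assume "\<exists>q. p1 q = n + 1 \<and> p1 (p2 q) = i \<and> q \<notin> C"
    then obtain q where q: "p1 q = n + 1" "p1 (p2 q) = i" "q \<notin> C" by blast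
    have "q = pr (p1 q) (pr (p1 (p2 q)) (p2 (p2 q)))" by simp
    then show "\<exists>y. pr (n + 1) (pr i y) \<notin> C" using q by metis
  next
    assume "\<exists>y. pr (n + 1) (pr i y) \<notin> C"
    then obtain y where "pr (n + 1) (pr i y) \<notin> C" by blast
    then show "\<exists>q. p1 q = n + 1 \<and> p1 (p2 q) = i \<and> q \<notin> C" by (intro exI[of _ "pr (n + 1) (pr i y)"]) simp
  qed
  finally show ?thesis unfolding column_1 .
qed

lemma column_3: "pr (n + 3) y \<in> C \<longleftrightarrow> y = 0 \<and> (\<exists>i. pr (n + 2) i \<notin> C)"
proof -
  have "n \<le> p1 (pr (n + 3) y)" "p1 (pr (n + 3) y) < n + 4" by simp_all
  from role[OF this] have "pr (n + 3) y \<in> C \<longleftrightarrow> (\<exists>s. y = 0 \<and> (\<exists>q<s. p1 q = n + 2 \<and> q \<notin> C))"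
    by (simp add: block_def)
  also have "\<dots> \<longleftrightarrow> y = 0 \<and> (\<exists>q. p1 q = n + 2 \<and> q \<notin> C)" by blast
  also have "\<dots> \<longleftrightarrow> y = 0 \<and> (\<exists>i. pr (n + 2) i \<notin> C)"
    by (metis fst_conv prod_encode_inverse prod_decode_inverse prod.collapse)
  finally show ?thesis .
qed

lemma settled_Suc:
  assumes i: "\<And>s. m \<le> s \<Longrightarrow> Info r n s = 0 \<or> (\<exists>F. Info r n s = Suc (pr m F))"
    and e: "\<exists>s0. \<forall>s\<ge>s0. Info r n s \<noteq> 0" and nm: "n \<le> m"
  shows "settled (Suc r) m"
proof -
  have "Pos s (Suc r) = 0 \<or> Pos s (Suc r) = Suc m" if s: "m \<le> s" for s
  proof -
    have "Pos s r = 0 \<or> Pos s r = Suc n" using Pos_cases nm s by simp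
    then show ?thesis using i[OF s] by auto
  qed
  moreover obtain s0 where s0: "\<forall>s\<ge>s0. Info r n s \<noteq> 0" using e by blast
  obtain s1 where s1: "\<forall>s\<ge>s1. Pos s r = Suc n" using Pos_eventually by blast
  have "Pos s (Suc r) = Suc m" if s: "max m (max s0 s1) \<le> s" for s
  proof -
    have "Pos s r = Suc n" "Info r n s \<noteq> 0" using s s0 s1 by simp_all
    moreover from this obtain F where "Info r n s = Suc (pr m F)" using i[of s] s by auto
    ultimately show ?thesis by simp
  qed
  ultimately show ?thesis unfolding settled_def by blast
qed

lemma rows_unbounded:
  assumes "\<And>i. \<exists>s. i < sj (st s)"
  shows "pr (n + 2) i \<in> C"
proof -
  obtain s where s: "i < sj (st s)" using assms by blast
  \<comment> \<open>The code of a finite set exceeds all its elements, which yields an explicit hole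
    in row \<open>i\<close>.\<close>
  have "pr i (sD (st s)) \<notin> set_decode (sD (st s))"
    using mem_set_decode_less[of "pr i (sD (st s))" "sD (st s)"] le_prod_encode_2[of "sD (st s)" i] by linarith
  then have "pr i (sD (st s)) \<notin> Dcol" using Dcol_row[of "pr i (sD (st s))" s] s by simp
  then show ?thesis unfolding column_2 by blast
qed

text \<open>Every row has a hole, so column \<open>n + 3\<close> stays empty, and the absence of a
  single number reveals the next base column.\<close>

lemma settled_unbounded:
  assumes u: "\<And>i. \<exists>s. i < sj (st s)"
  shows "settled (Suc r) (n + 4)"
proof (rule settled_Suc)
  have c: "pr (n + 3) 0 \<notin> C" unfolding column_3 using rows_unbounded[OF u] by blast
  show "Info r n s = 0 \<or> (\<exists>F. Info r n s = Suc (pr (n + 4) F))" for s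
    unfolding info_def using c by simp
  have "\<forall>s\<ge>Suc (pr (n + 3) 0). Info r n s \<noteq> 0" unfolding info_def using c by simp
  then show "\<exists>s0. \<forall>s\<ge>s0. Info r n s \<noteq> 0" by blast
qed simp

end

section \<open>Bounded outcomes and their witness\<close>

locale block_world = settled_block +
  fixes p T w D :: nat
  assumes world: "world p T w D"
begin

lemma p_pos: "0 < p" using world unfolding world_def by blast

lemma col_1: "pr (n + 1) q \<in> C \<longleftrightarrow> p \<le> p1 q \<or> q \<in> set_decode D \<and> p1 q < p"
  unfolding column_1 using world unfolding world_def by blast

lemma col_2: "pr (n + 2) i \<in> C \<longleftrightarrow> i < p"
proof -
  have "pr i D \<notin> set_decode D"
    using mem_set_decode_less[of "pr i D" D] le_prod_encode_2[of D i] by linarith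
  then have "(\<exists>y. pr (n + 1) (pr i y) \<notin> C) \<longleftrightarrow> i < p" unfolding col_1 by auto
  then show ?thesis unfolding column_2 column_1[symmetric] .
qed

lemma col_3: "pr (n + 3) y \<in> C \<longleftrightarrow> y = 0"
  unfolding column_3 col_2 by auto

text \<open>A number below \<open>wS w\<close> also has its column index below \<open>wS w\<close>,
  so with these columns skipped the later blocks cannot disturb the initial segment that the witness
  predicts.\<close>

definition next_base :: nat where "next_base = (if w = 0 then n + 4 else max (n + 4) (wS w))"

lemma hole_row_C: "hole_row C n s = min p s"
  unfolding hole_row_def col_2 by (rule Least_equality) auto

lemma hole_C: "p < s \<Longrightarrow> hole C n s = min T s"
proof -
  assume "p < s"
  then have h: "hole_row C n s = p" using hole_row_C by simp
  have c: "pr (n + 1) (pr (p - 1) y) \<notin> C \<longleftrightarrow> T \<le> y" for y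
    unfolding col_1 using world p_pos unfolding world_def by auto
  show ?thesis unfolding hole_def h c by (rule Least_equality) auto
qed

lemma Info_cases:
  "Info r n s = 0 \<or> Info r n s = (if w \<noteq> 0 \<and> wS w \<le> s then Suc (pr next_base (wF w)) else Suc (pr (n + 4) 0))"
proof (cases "Info r n s = 0")
  case False
  then have v: "\<not> s \<le> pr (n + 2) (hole_row C n s)" "\<not> s \<le> pr (n + 1) (pr (hole_row C n s - 1) (hole C n s))"
    unfolding info_def using col_3[of 0] by (auto split: if_splits)
  \<comment> \<open>The default value \<open>s\<close> would fail the test that the position lies
    below \<open>s\<close>; so the row found is the true one, and likewise the hole.\<close>
  have "hole_row C n s < s" using v(1) le_prod_encode_2[of "hole_row C n s" "n + 2"] by linarith
  then have p: "p < s" "hole_row C n s = p" using hole_row_C by auto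
  have "hole C n s < s"
    using v(2) le_prod_encode_2[of "hole C n s" "hole_row C n s - 1"]
      le_prod_encode_2[of "pr (hole_row C n s - 1) (hole C n s)" "n + 1"] by linarith
  then have T: "hole C n s = T" using hole_C[OF p(1)] by auto
  have "lookup p T (st s) = (if w \<noteq> 0 \<and> wS w \<le> s then w else 0)" using world unfolding world_def by blast
  moreover have "pr (n + 3) 0 \<in> C" unfolding col_3 ..
  ultimately show ?thesis using False unfolding info_def p(2) T next_base_def by (auto split: if_splits)
qed simp

lemma Info_eventually: "\<exists>s0. \<forall>s\<ge>s0. Info r n s \<noteq> 0"
proof -
  define B where "B = Suc (max (pr (n + 3) 0) (max (pr (n + 2) p) (pr (n + 1) (pr (p - 1) T))))"
  have "Info r n s \<noteq> 0" if s: "B \<le> s" for s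
  proof -
    have b: "pr (n + 3) 0 < s" "pr (n + 2) p < s" "pr (n + 1) (pr (p - 1) T) < s"
      using s unfolding B_def by linarith+
    have "p < s" using b(2) le_prod_encode_2[of p "n + 2"] by linarith
    moreover have "T < s" using b(3) le_prod_encode_2[of T "p - 1"] le_prod_encode_2[of "pr (p - 1) T" "n + 1"] by linarith
    ultimately have "hole_row C n s = p" "hole C n s = T" using hole_row_C hole_C by simp_all
    then show ?thesis unfolding info_def using b by simp
  qed
  then show ?thesis by blast
qed

lemma settled_next: "settled (Suc r) next_base"
proof (rule settled_Suc)
  fix s assume "next_base \<le> s"
  then have "w \<noteq> 0 \<Longrightarrow> wS w \<le> s" "w = 0 \<Longrightarrow> next_base = n + 4" unfolding next_base_def by simp_all
  then have "(if w \<noteq> 0 \<and> wS w \<le> s then Suc (pr next_base (wF w)) else Suc (pr (n + 4) 0))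
      = Suc (pr next_base (if w = 0 then 0 else wF w))" by (cases "w = 0") simp_all
  then show "Info r n s = 0 \<or> (\<exists>F. Info r n s = Suc (pr next_base F))" using Info_cases[of s] by metis
next
  show "n \<le> next_base" unfolding next_base_def by auto
qed (rule Info_eventually)

text \<open>Once the witness can be looked up, every later block that has a position starts at
  \<open>next_base\<close> or beyond, so only copying is left for the skipped columns.\<close>

lemma late:
  assumes w: "w \<noteq> 0" and s: "wS w \<le> s" and e: "enum E C s z" and z: "n + 4 \<le> p1 z" "p1 z < next_base"
  shows "z \<in> set_decode (wF w)"
proof -
  have i: "Info r n s = 0 \<or> Info r n s = Suc (pr next_base (wF w))" using Info_cases[of s] w s by simp
  have nz: "n \<le> p1 z" using z(1) by simp
  have P: "Pos s r = Suc n" using enum_cases[OF nz e] by blast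
  have "\<not> (r < r' \<and> Pos s r' \<noteq> 0 \<and> Block r' (Pos s r' - 1) s z)" for r'
  proof
    assume a: "r < r' \<and> Pos s r' \<noteq> 0 \<and> Block r' (Pos s r' - 1) s z"
    then have 1: "Pos s (Suc r) \<noteq> 0" "Pos s (Suc r) \<le> Pos s r'" using pos_mono[of E C s r' r] by blast+
    then have "Pos s (Suc r) = Suc next_base" using i P by (auto split: if_splits)
    moreover have "Pos s r' - 1 \<le> p1 z" using a block_ge by blast
    ultimately show False using 1 z(2) by linarith
  qed
  then have "Block r n s z" using enum_cases[OF nz e] by blast
  then have "Info r n s \<noteq> 0" "z \<in> set_decode (p2 (Info r n s - 1))" using z(1) unfolding block_def by auto
  then show ?thesis using i by auto
qed

lemma early:
  assumes w: "w \<noteq> 0" and z: "n + 4 \<le> p1 z" "p1 z < next_base" and F: "z \<in> set_decode (wF w)"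
  shows "z \<in> C"
proof -
  obtain s0 where s0: "\<forall>s\<ge>s0. Info r n s \<noteq> 0" using Info_eventually by blast
  obtain s1 where s1: "\<forall>s\<ge>s1. Pos s r = Suc n" using Pos_eventually by blast
  define s where "s = max (max s0 s1) (max (wS w) (Suc z))"
  have s: "s0 \<le> s" "s1 \<le> s" "wS w \<le> s" "z < s" unfolding s_def by linarith+
  then have i: "Info r n s = Suc (pr next_base (wF w))" using Info_cases[of s] w s0 by auto
  have "Block r n s z" unfolding block_def using i z F by simp
  moreover have "Pos s r = Suc n" using s s1 by blast
  moreover have "r < Suc (p1 z)" using base_ge z(1) by simp
  ultimately have "enum E C s z" unfolding enum_def using s(4) by (metis diff_Suc_1 nat.distinct(1))
  then show ?thesis using C_iff by blast
qed

text \<open>The witness is frozen: its closure under the enumeration procedure absorbs everything that later blocks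
  enumerated before it was found, and afterwards the columns up to \<open>next_base\<close> copy it.\<close>

lemma frozen:
  assumes w: "w \<noteq> 0" shows "z < wS w \<Longrightarrow> z \<in> set_decode (wF w) \<longleftrightarrow> z \<in> C"
proof (induction "p1 z" arbitrary: z rule: less_induct)
  case less
  let ?F = "set_decode (wF w)"
  have "valid w p D" using world w unfolding world_def by blast
  then have cnd: "cand E C n (wS w) p {q \<in> set_decode D. p1 q < p} ?F" unfolding valid_def by blast
  have zz: "z = pr (p1 z) (p2 z)" by simp
  consider "p1 z \<le> n" | "p1 z = n + 1" | "p1 z = n + 2" | "p1 z = n + 3" | "n + 4 \<le> p1 z" by linarith
  then show ?case
  proof cases
    case 1 then show ?thesis using cnd less.prems unfolding cand_def by blast
  next
    case 2
    then have "z \<in> ?F \<longleftrightarrow> p \<le> p1 (p2 z) \<or> p2 z \<in> {q \<in> set_decode D. p1 q < p}"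
      using cnd less.prems unfolding cand_def by blast
    then show ?thesis using col_1[of "p2 z"] zz 2 by (metis (no_types, lifting) mem_Collect_eq)
  next
    case 3
    then have "z \<in> ?F \<longleftrightarrow> p2 z < p" using cnd less.prems unfolding cand_def by blast
    then show ?thesis using col_2[of "p2 z"] zz 3 by metis
  next
    case 4
    then have "z \<in> ?F \<longleftrightarrow> p2 z = 0" using cnd less.prems unfolding cand_def by blast
    then show ?thesis using col_3[of "p2 z"] zz 4 by metis
  next
    case 5
    have lt: "p1 z < next_base" using less.prems p_le(1)[of z] w unfolding next_base_def by simp
    show ?thesis
    proof
      assume "z \<in> ?F" then show "z \<in> C" by (rule early[OF w 5 lt])
    next
      assume "z \<in> C"
      then obtain s where e: "enum E C s z" using C_iff by blast
      then have zs: "z < s" unfolding enum_def by blast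
      show "z \<in> ?F"
      proof (cases "s < wS w")
        case False
        then show ?thesis using late[OF w _ e 5 lt] by simp
      next
        case True
        \<comment> \<open>By induction on the column, \<open>C\<close> and the candidate agree below
          \<open>s\<close> on the lower columns, which are all that the enumeration of
          \<open>z\<close> depends on. So it also takes place with the candidate as oracle, where
          the closure clause catches it.\<close>
        let ?a = "set_encode {i. i < s \<and> i \<in> ?F}"
        have "set_decode ?a = {i. i < s \<and> i \<in> ?F}" by simp
        then have "agr s (p1 z) C (set_decode ?a)"
          using less.hyps True unfolding agr_def by auto
        then have "enum E (set_decode ?a) s z" using e enum_local[of s E E z C "set_decode ?a"] by (simp add: hagr_def)
        then have "pr s (pr ?a z) \<in> E" unfolding mem_E by (intro conjI set_encode_less zs)
        moreover have "\<forall>s'<wS w. z < s' \<and> pr s' (pr (set_encode {i. i < s' \<and> i \<in> ?F}) z) \<in> E \<longrightarrow> z \<in> ?F"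
          using cnd less.prems 5 unfolding cand_def by blast
        ultimately show ?thesis using True zs by blast
      qed
    qed
  qed
qed

lemma column_frozen:
  assumes z: "n + 4 \<le> p1 z" "p1 z < next_base" and "z \<in> C"
  shows "z \<in> set_decode (wF w)"
proof -
  have w: "w \<noteq> 0" using z unfolding next_base_def by (auto split: if_splits)
  have nb: "next_base = wS w" using z w unfolding next_base_def by auto
  show ?thesis
  proof (cases "z < wS w")
    case True then show ?thesis using frozen[OF w] \<open>z \<in> C\<close> by blast
  next
    case False
    obtain s where e: "enum E C s z" using C_iff \<open>z \<in> C\<close> by blast
    then have "z < s" unfolding enum_def by blast
    then show ?thesis using late[OF w _ e z] False by simp
  qed
qed

text \<open>The full rows are the only infinite addition, and they form a computable set; the
  skipped columns hold nothing outside the finite candidate.\<close>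

lemma below_next:
  obtains X where "finite X" "below C next_base = below C n \<union> {z. p1 z = n + 1 \<and> p \<le> p1 (p2 z)} \<union> X"
proof -
  define X where "X = {z \<in> C. n \<le> p1 z \<and> p1 z < next_base \<and> \<not> (p1 z = n + 1 \<and> p \<le> p1 (p2 z))}"
  have "X \<subseteq> {pr n 0} \<union> pr (n + 1) ` set_decode D \<union> pr (n + 2) ` {..<p} \<union> {pr (n + 3) 0} \<union> set_decode (wF w)"
  proof
    fix z assume z: "z \<in> X"
    have zz: "z = pr (p1 z) (p2 z)" by simp
    have zC: "z \<in> C" "p1 z < next_base" and zn: "n \<le> p1 z" and np: "\<not> (p1 z = n + 1 \<and> p \<le> p1 (p2 z))"
      using z unfolding X_def by blast+
    consider "p1 z = n" | "p1 z = n + 1" | "p1 z = n + 2" | "p1 z = n + 3" | "n + 4 \<le> p1 z" using zn by linarith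
    then show "z \<in> {pr n 0} \<union> pr (n + 1) ` set_decode D \<union> pr (n + 2) ` {..<p} \<union> {pr (n + 3) 0} \<union> set_decode (wF w)"
    proof cases
      case 1
      then have "z = pr n (p2 z)" using zz by metis
      then have "z = pr n 0" using column_0 zC(1) by metis
      then show ?thesis by blast
    next
      case 2
      then have e: "z = pr (n + 1) (p2 z)" using zz by metis
      then have "p2 z \<in> set_decode D" using col_1[of "p2 z"] zC(1) np 2 by metis
      then show ?thesis using e by blast
    next
      case 3
      then have e: "z = pr (n + 2) (p2 z)" using zz by metis
      then have "p2 z < p" using col_2[of "p2 z"] zC(1) by metis
      then show ?thesis using e by blast
    next
      case 4
      then have "z = pr (n + 3) (p2 z)" using zz by metis
      then have "z = pr (n + 3) 0" using col_3 zC(1) by metis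
      then show ?thesis by blast
    next
      case 5 then show ?thesis using column_frozen zC by blast
    qed
  qed
  then have "finite X" by (rule finite_subset) simp
  moreover have "below C next_base = below C n \<union> {z. p1 z = n + 1 \<and> p \<le> p1 (p2 z)} \<union> X"
  proof -
    have "n + 4 \<le> next_base" unfolding next_base_def by auto
    moreover have "z \<in> C" if "p1 z = n + 1" "p \<le> p1 (p2 z)" for z
      using col_1[of "p2 z"] that by (metis prod.collapse prod_decode_inverse)
    ultimately show ?thesis unfolding below_def X_def by auto
  qed
  ultimately show ?thesis using that by blast
qed

end

section \<open>The minimal pair\<close>

lemma computable_dp: "computable_set X \<longleftrightarrow> dp {{}} (\<lambda>_ x. x \<in> X)"
  unfolding computable_set_def by (rule turing_le_dp)

lemma computable_Un: "computable_set X \<Longrightarrow> computable_set Y \<Longrightarrow> computable_set (X \<union> Y)"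
  unfolding computable_dp Un_iff by (rule dp_disj)

lemma computable_finite: "finite X \<Longrightarrow> computable_set X"
  using dp_set_decode[OF cf_id cf_const, of "{{}}" "set_encode X"] unfolding computable_dp by simp

lemma computable_column:
  assumes "computable_set D" shows "computable_set {z. p1 z = k \<and> p2 z \<in> D}"
proof -
  have "dp {{}} (\<lambda>_ x. p2 x \<in> D)"
    by (rule dp_substitute[OF assms[unfolded computable_dp] cf_p2[OF cf_id]])
  then show ?thesis unfolding computable_dp mem_Collect_eq by (intro dp_conj dp_eq cf_p1 cf_id cf_const)
qed

lemma J_det: "J (sat A k) (enc q) (Suc (pr x 0)) y \<Longrightarrow> J (sat A k') (enc q) (Suc (pr x 0)) y' \<Longrightarrow> y = y'"
  using sat_sound[of A k q "[x]" y] sat_sound[of A k' q "[x]" y'] eval_det by simp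

lemma of_bool_eq_iff: "(if P then 1 else 0) = (if Q then 1 else (0::nat)) \<Longrightarrow> P = Q"
  by (simp split: if_splits)

lemma eventually_J_Kst:
  assumes "\<And>x. eval halting_set q [x] (f x)"
  shows "\<exists>s0. \<forall>s\<ge>s0. \<forall>x<k. J (sat (Kst s) s) (enc q) (Suc (pr x 0)) (f x)"
proof -
  have "\<exists>s0. \<forall>x<k. \<forall>s\<ge>s0. J (sat (Kst s) s) (enc q) (Suc (pr x 0)) (f x)"
  proof (rule ex_uniform_bound)
    fix x show "\<exists>s0. \<forall>s\<ge>s0. J (sat (Kst s) s) (enc q) (Suc (pr x 0)) (f x)"
      using sat_Kst_complete[OF assms, of x] by simp
  next
    fix x k k' assume "\<forall>s\<ge>k. J (sat (Kst s) s) (enc q) (Suc (pr x 0)) (f x)" "k \<le> k'"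
    then show "\<forall>s\<ge>k'. J (sat (Kst s) s) (enc q) (Suc (pr x 0)) (f x)" using le_trans by blast
  qed
  then show ?thesis by blast
qed

lemma eventually_J:
  assumes "\<And>x. eval A q [x] (f x)"
  shows "\<exists>s0. \<forall>s\<ge>s0. \<forall>x<k. J (sat A s) (enc q) (Suc (pr x 0)) (f x)"
proof -
  have "\<exists>s0. \<forall>x<k. \<forall>s\<ge>s0. J (sat A s) (enc q) (Suc (pr x 0)) (f x)"
  proof (rule ex_uniform_bound)
    fix x
    obtain s0 where "J (sat A s0) (enc q) (list_encode [x]) (f x)" using sat_complete[OF assms] by blast
    then have "\<forall>s\<ge>s0. J (sat A s) (enc q) (Suc (pr x 0)) (f x)" using J_sat_mono by simp
    then show "\<exists>s0. \<forall>s\<ge>s0. J (sat A s) (enc q) (Suc (pr x 0)) (f x)" by blast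
  next
    fix x k k' assume "\<forall>s\<ge>k. J (sat A s) (enc q) (Suc (pr x 0)) (f x)" "k \<le> k'"
    then show "\<forall>s\<ge>k'. J (sat A s) (enc q) (Suc (pr x 0)) (f x)" using le_trans by blast
  qed
  then show ?thesis by blast
qed

context process
begin

lemma st_below: "state E (below C (Suc n)) r n s = st s"
  by (rule state_local) (auto simp: hagr_def agr_def below_def)

text \<open>The process reads only columns up to \<open>n\<close>, and the unbounded level makes the
  search for a late enough stage halt. This serves both for the matrix and for the confirmed
  answers.\<close>

lemma turing_le_limit:
  assumes "\<And>i. \<exists>s. i < sj (st s)" and X: "\<And>x s. h x < sj (st s) \<Longrightarrow> x \<in> X \<longleftrightarrow> x \<in> set_decode (g (st s))"
    and h: "cf {below C (Suc n)} (\<lambda>Z x. h x)" and g: "cf {below C (Suc n)} (\<lambda>Z x. g x)"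
  shows "turing_le X (below C (Suc n))"
proof -
  let ?Z = "below C (Suc n)"
  let ?m = "\<lambda>Z x. LEAST s. h x < sj (state E Z r n s)"
  have h': "cf {?Z} (\<lambda>Z w. h (p1 w))" by (rule cf_substitute[OF h cf_p1[OF cf_id]])
  have m: "cf {?Z} ?m"
  proof (rule cf_Least)
    show "dp {?Z} (\<lambda>Z w. h (p1 w) < sj (state E Z r n (p2 w)))"
      by (intro dp_less h' cf_p1 cf_state_oracle cf_p2 cf_id)
    fix Z x assume "Z \<in> {?Z}"
    then show "\<exists>s. h x < sj (state E Z r n s)" using assms(1) st_below by simp
  qed
  have d: "dp {?Z} (\<lambda>Z x. x \<in> set_decode (g (state E Z r n (?m Z x))))"
    by (intro dp_set_decode cf_id cf_substitute[OF g] cf_state_oracle m)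
  have "(x \<in> set_decode (g (state E Z r n (?m Z x)))) = (x \<in> X)" if "Z \<in> {?Z}" for Z x
  proof -
    have "h x < sj (st (LEAST s. h x < sj (st s)))" using assms(1) by (rule LeastI_ex)
    then show ?thesis using X that st_below by simp
  qed
  then have "dp {?Z} (\<lambda>Z x. x \<in> X)"
    unfolding dp_def by (intro cf_cong[OF d[unfolded dp_def]]) (simp only:)
  then show ?thesis unfolding turing_le_dp .
qed

end

context block_world
begin

text \<open>\<open>C\<close> is closed under its own enumeration, so its initial segments are
  candidates in a bounded outcome. A search that fails forever therefore refutes that \<Phi>
  computes a set from \<open>C\<close>.\<close>

lemma cand_C: "cand E C n s p (set_decode D) (set_decode (restr C s))"
  unfolding cand_def
proof (intro allI impI conjI)
  fix z assume z: "z < s"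
  have F: "z \<in> set_decode (restr C s) \<longleftrightarrow> z \<in> C" using z unfolding restr_def by simp
  have zz: "z = pr (p1 z) (p2 z)" by simp
  show "z \<in> set_decode (restr C s) \<longleftrightarrow> z \<in> C" by (rule F)
  show "z \<in> set_decode (restr C s) \<longleftrightarrow> p \<le> p1 (p2 z) \<or> p2 z \<in> set_decode D" if "p1 z = n + 1"
    unfolding F using col_1[of "p2 z"] zz that by (metis not_le)
  show "z \<in> set_decode (restr C s) \<longleftrightarrow> p2 z < p" if "p1 z = n + 2"
    unfolding F using col_2[of "p2 z"] zz that by metis
  show "z \<in> set_decode (restr C s) \<longleftrightarrow> p2 z = 0" if "p1 z = n + 3"
    unfolding F using col_3[of "p2 z"] zz that by metis
  fix s' assume s': "s' < s"
    and e: "z < s' \<and> pr s' (pr (set_encode {i. i < s' \<and> i \<in> set_decode (restr C s)}) z) \<in> E"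
  let ?a = "set_encode {i. i < s' \<and> i \<in> set_decode (restr C s)}"
  have "agr s' (p1 z) (set_decode ?a) C" using s' unfolding agr_def restr_def by simp
  moreover have "enum E (set_decode ?a) s' z" using e mem_E by blast
  ultimately have "enum E C s' z" using enum_local[of s' E E z "set_decode ?a" C] by (simp add: hagr_def)
  then show "z \<in> set_decode (restr C s)" unfolding F C_iff by blast
qed

text \<open>By \<open>frozen\<close> the candidate agrees with \<open>C\<close> on all numbers that
  a computation of \<open>wS w\<close> steps can query, so the answers of the witness are computed
  from \<open>C\<close>.\<close>

lemma witness_correct:
  assumes w: "w \<noteq> 0" and r: "p1 r = enc \<phi>" and X: "\<And>x. eval C \<phi> [x] (if x \<in> X then 1 else 0)"
    and x: "x < p"
  shows "x \<in> set_decode (wU w) \<longleftrightarrow> x \<in> X"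
proof -
  have "valid w p D" using world w unfolding world_def by blast
  then have "J (sat (set_decode (wF w)) (wS w)) (enc \<phi>) (Suc (pr x 0)) (if x \<in> set_decode (wU w) then 1 else 0)"
    using x r unfolding valid_def conv_def by simp
  moreover have "sat (set_decode (wF w)) (wS w) = sat C (wS w)" by (rule sat_local) (rule frozen[OF w])
  ultimately have "eval C \<phi> [x] (if x \<in> set_decode (wU w) then 1 else 0)"
    using sat_sound[of C "wS w" \<phi> "[x]"] by simp
  then show ?thesis using eval_det[OF _ X] of_bool_eq_iff by blast
qed

end

context settled_block
begin

lemma computable_below_Suc:
  assumes "computable_set (below C n)" shows "computable_set (below C (Suc n))"
proof -
  have "z = pr n 0" if "z \<in> C" "p1 z = n" for z
    using column_0[of "p2 z"] that by (metis prod.collapse prod_decode_inverse)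
  then have "{z \<in> C. p1 z = n} \<subseteq> {pr n 0}" by blast
  then have "finite {z \<in> C. p1 z = n}" by (rule finite_subset) simp
  moreover have "below C (Suc n) = below C n \<union> {z \<in> C. p1 z = n}"
    unfolding below_def less_Suc_eq by blast
  ultimately show ?thesis using assms computable_finite computable_Un by simp
qed

lemma computable_below_unbounded:
  assumes u: "\<And>i. \<exists>s. i < sj (st s)" and c: "computable_set (below C n)"
  shows "computable_set (below C (n + 4))"
proof -
  \<comment> \<open>A row is final once the level has passed it.\<close>
  have "turing_le Dcol (below C (Suc n))"
    by (rule turing_le_limit[OF u, of p1 Dcol sD]; (erule Dcol_row | intro cf_p1 cf_p2 cf_id))
  then have "computable_set Dcol" using turing_le_trans computable_below_Suc[OF c] unfolding computable_set_def by blast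
  then have "computable_set (below C (Suc n) \<union> {z. p1 z = n + 1 \<and> p2 z \<in> Dcol} \<union> {z. p1 z = n + 2 \<and> p2 z \<in> UNIV})"
    using computable_below_Suc[OF c] dp_True[of "{{}}" True]
    by (intro computable_Un computable_column) (simp_all add: computable_dp)
  moreover have "below C (n + 4) = below C (Suc n) \<union> {z. p1 z = n + 1 \<and> p2 z \<in> Dcol} \<union> {z. p1 z = n + 2 \<and> p2 z \<in> UNIV}"
  proof -
    have 1: "z \<in> C \<longleftrightarrow> p2 z \<in> Dcol" if "p1 z = n + 1" for z
      using column_1[of "p2 z"] that by (metis prod.collapse prod_decode_inverse)
    have 2: "z \<in> C" if "p1 z = n + 2" for z
      using rows_unbounded[OF u, of "p2 z"] that by (metis prod.collapse prod_decode_inverse)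
    have 3: "z \<notin> C" if "p1 z = n + 3" for z
      using column_3[of "p2 z"] rows_unbounded[OF u] that by (metis prod.collapse prod_decode_inverse)
    have lt: "i < n + 4 \<longleftrightarrow> i < Suc n \<or> i = n + 1 \<or> i = n + 2 \<or> i = n + 3" for i by linarith
    show ?thesis unfolding below_def lt using 1 2 3 by blast
  qed
  ultimately show ?thesis by simp
qed

lemma computable_below_world:
  assumes "world p T w D" and c: "computable_set (below C n)"
  shows "\<exists>m. settled (Suc r) m \<and> computable_set (below C m)"
proof -
  interpret W: block_world r n p T w D using assms(1) by unfold_locales
  obtain Y where Y: "finite Y" "below C W.next_base = below C n \<union> {z. p1 z = n + 1 \<and> p \<le> p1 (p2 z)} \<union> Y"
    by (rule W.below_next)
  have "computable_set {z. p1 z = n + 1 \<and> p \<le> p1 (p2 z)}"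
    unfolding computable_dp mem_Collect_eq by (intro cf_rules)
  then have "computable_set (below C W.next_base)"
    unfolding Y(2) by (intro computable_Un c computable_finite[OF Y(1)])
  then show ?thesis using W.settled_next by blast
qed

lemma next_block:
  assumes c: "computable_set (below C n)"
  shows "\<exists>m. settled (Suc r) m \<and> computable_set (below C m)"
proof (cases rule: outcome)
  case unbounded
  then show ?thesis using settled_unbounded computable_below_unbounded[OF _ c] by blast
next
  case (quiet s0 j)
  then obtain w where "world (Suc j) (stt (st s0)) w (sD (st s0))" by (rule world_quiet)
  then show ?thesis using c by (rule computable_below_world)
next
  case (busy s0 j)
  then obtain T w D where "world j T w D" by (rule world_busy)
  then show ?thesis using c by (rule computable_below_world)
qed

lemma minimal_pair:
  assumes c: "computable_set (below C n)" and r: "r = pr (enc \<phi>) (enc \<psi>)"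
    and X: "\<And>x. eval C \<phi> [x] (if x \<in> X then 1 else 0)"
    and K: "\<And>x. eval halting_set \<psi> [x] (if x \<in> X then 1 else 0)"
  shows "computable_set X"
proof (cases rule: outcome)
  case unbounded
  have "x \<in> X \<longleftrightarrow> x \<in> approx s" if x: "x < sj (st s)" for x s
  proof -
    obtain s0 where s0: "\<forall>s\<ge>s0. \<forall>i<Suc x. J (sat (Kst s) s) (enc \<psi>) (Suc (pr i 0)) (if i \<in> X then 1 else 0)"
      using eventually_J_Kst[OF K] by blast
    \<comment> \<open>At this stage the approximation to \<Psi> is already correct at
      \<open>x\<close> and agrees with the confirmed answers; stability carries their correctness
      back to \<open>s\<close>.\<close>
    obtain s' where s': "max s s0 \<le> s'" "x < sj (st s')" "agreeK s' (sj (st s')) (approx s')"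
      using approx_agrees[OF unbounded, of "max s s0" x] by blast
    have "J (sat (Kst s') s') (enc \<psi>) (Suc (pr x 0)) (if x \<in> approx s' then 1 else 0)"
      using s'(2,3) r unfolding agreeK_def conv_def by simp
    moreover have "J (sat (Kst s') s') (enc \<psi>) (Suc (pr x 0)) (if x \<in> X then 1 else 0)"
      using s0 s'(1) by simp
    ultimately have "x \<in> approx s' \<longleftrightarrow> x \<in> X" by (rule of_bool_eq_iff[OF J_det])
    then show ?thesis using approx_stable[of s s' x] s'(1) x by simp
  qed
  then have "turing_le X (below C (Suc n))"
    by (intro turing_le_limit[OF unbounded, of "\<lambda>x. x" X "\<lambda>x. wU (swj x)"] cf_rules) (simp add: approx_def)
  then show ?thesis using turing_le_trans computable_below_Suc[OF c] unfolding computable_set_def by blast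
next
  case (quiet s0 j)
  have "\<exists>w. world (Suc j) (stt (st s0)) w (sD (st s0))
      \<and> (w = 0 \<longrightarrow> (\<forall>s\<ge>s0. sD (st s) = sD (st s0) \<and> (\<forall>q<fbound (Suc s) (st s). \<not> found E C r n (Suc s) (st s) q)))
      \<and> (w \<noteq> 0 \<longrightarrow> (\<exists>s1. \<forall>s\<ge>s1. \<not> agreeK s (Suc j) (set_decode (wU w))))"
  proof (rule world_quiet[of s0 j])
    fix w assume 1: "world (Suc j) (stt (st s0)) w (sD (st s0))"
      and 2: "w = 0 \<Longrightarrow> \<forall>s\<ge>s0. sD (st s) = sD (st s0) \<and> (\<forall>q<fbound (Suc s) (st s). \<not> found E C r n (Suc s) (st s) q)"
      and 3: "w \<noteq> 0 \<Longrightarrow> \<exists>s1. \<forall>s\<ge>s1. \<not> agreeK s (Suc j) (set_decode (wU w))"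
    show ?thesis by (rule exI[of _ w]) (intro conjI impI 1; (erule 2 | erule 3))
  qed (rule quiet, assumption)+
  then obtain w where w: "world (Suc j) (stt (st s0)) w (sD (st s0))"
    "w = 0 \<longrightarrow> (\<forall>s\<ge>s0. sD (st s) = sD (st s0) \<and> (\<forall>q<fbound (Suc s) (st s). \<not> found E C r n (Suc s) (st s) q))"
    "w \<noteq> 0 \<longrightarrow> (\<exists>s1. \<forall>s\<ge>s1. \<not> agreeK s (Suc j) (set_decode (wU w)))" by (elim exE conjE)
  interpret W: block_world r n "Suc j" "stt (st s0)" w "sD (st s0)" using w(1) by unfold_locales
  have False
  proof (cases "w = 0")
    case True
    obtain s1 where s1: "\<forall>s\<ge>s1. \<forall>x<Suc j. J (sat C s) (enc \<phi>) (Suc (pr x 0)) (if x \<in> X then 1 else 0)"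
      using eventually_J[OF X] by blast
    define s where "s = max s0 s1"
    have s: "s0 \<le> s" "s1 \<le> Suc s" unfolding s_def by simp_all
    \<comment> \<open>The true initial segment of \<open>C\<close> with the true answers from
      \<open>X\<close> is a pair that the search could not have missed.\<close>
    let ?f = "restr C (Suc s)" and ?u = "set_encode {i. i < Suc j \<and> i \<in> X}"
    have b: "?f < 2 ^ Suc s" "?u < 2 ^ Suc j" unfolding restr_def by (rule set_encode_less)+
    then have "pr ?f ?u \<le> pr (2 ^ Suc s) (2 ^ Suc j)" by (intro pr_mono) linarith+
    then have lt: "pr ?f ?u < fbound (Suc s) (st s)" unfolding fbound_def quiet(1)[OF s(1)] by linarith
    have se: "sat (set_decode ?f) (Suc s) = sat C (Suc s)" by (rule sat_local) (simp add: restr_def)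
    have "conv (sat (set_decode ?f) (Suc s)) (enc \<phi>) (Suc j) (set_decode ?u)"
      unfolding conv_def se using s1 s(2) by (simp del: sat.simps)
    moreover have "sD (st s) = sD (st s0)" using w(2) True s(1) by blast
    ultimately have "found E C r n (Suc s) (st s) (pr ?f ?u)"
      unfolding found_def using b(1) W.cand_C[of "Suc s"] quiet(1)[OF s(1)] r by (simp del: sat.simps power_Suc)
    then show False using w(2) True s(1) lt by blast
  next
    case False
    obtain s1 where s1: "\<forall>s\<ge>s1. \<not> agreeK s (Suc j) (set_decode (wU w))" using w(3)[THEN mp, OF False] by blast
    obtain s2 where s2: "\<forall>s\<ge>s2. \<forall>i<Suc j. J (sat (Kst s) s) (enc \<psi>) (Suc (pr i 0)) (if i \<in> X then 1 else 0)"
      using eventually_J_Kst[OF K] by blast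
    \<comment> \<open>The witness answers correctly by \<Phi>, and \<Psi> tends to the same values,
      so permanent disagreement is impossible.\<close>
    have "x \<in> set_decode (wU w) \<longleftrightarrow> x \<in> X" if "x < Suc j" for x
      by (rule W.witness_correct[OF False _ X that]) (simp add: r)
    then have "agreeK (max s1 s2) (Suc j) (set_decode (wU w))"
      unfolding agreeK_def conv_def using s2 r by simp
    then show False using s1 max.cobounded1 by blast
  qed
  then show ?thesis ..
next
  case (busy s0 j)
  then obtain T w D where w: "world j T w D" "w \<noteq> 0"
    "\<forall>s1. \<exists>s\<ge>s1. \<exists>U. agreeK s (Suc j) U \<and> (\<exists>i<j. (i \<in> U) \<noteq> (i \<in> set_decode (wU w)))" by (rule world_busy)
  interpret W: block_world r n j T w D using w(1) by unfold_locales
  obtain s2 where s2: "\<forall>s\<ge>s2. \<forall>i<Suc j. J (sat (Kst s) s) (enc \<psi>) (Suc (pr i 0)) (if i \<in> X then 1 else 0)"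
    using eventually_J_Kst[OF K] by blast
  obtain s U i where s: "s2 \<le> s" "agreeK s (Suc j) U" "i < j" "(i \<in> U) \<noteq> (i \<in> set_decode (wU w))" using w(3) by blast
  have "J (sat (Kst s) s) (enc \<psi>) (Suc (pr i 0)) (if i \<in> U then 1 else 0)"
    using s(2,3) r unfolding agreeK_def conv_def by simp
  moreover have "J (sat (Kst s) s) (enc \<psi>) (Suc (pr i 0)) (if i \<in> X then 1 else 0)" using s2 s(1,3) by simp
  \<comment> \<open>At a late conflict the answers \<open>U\<close> are correct by \<Psi>, while
    those confirmed earlier are correct by \<Phi>; yet the two differ at \<open>i\<close>.\<close>
  ultimately have "i \<in> U \<longleftrightarrow> i \<in> X" by (rule of_bool_eq_iff[OF J_det])
  moreover have "i \<in> set_decode (wU w) \<longleftrightarrow> i \<in> X"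
    by (rule W.witness_correct[OF w(2) _ X s(3)]) (simp add: r)
  ultimately show ?thesis using s(4) by blast
qed

end

text \<open>The induction splits into cases according to the outcome, so it gives no program for the
  lower columns uniformly in \<open>r\<close>; this is how each \<open>below C n\<close> can be
  computable while \<open>C\<close> is not.\<close>

lemma all_settled: "\<exists>n. settled r n \<and> computable_set (below C n)"
proof (induction r rule: less_induct)
  case (less r)
  show ?case
  proof (cases r)
    case 0
    have "settled 0 0" unfolding settled_def by simp
    moreover have "computable_set (below C 0)" unfolding below_def by (simp add: computable_finite)
    ultimately show ?thesis using 0 by blast
  next
    case (Suc r')
    then obtain n where n: "settled r' n" "computable_set (below C n)" using less by blast
    interpret settled_block r' n
      by unfold_locales (use less Suc n in \<open>auto simp: less_Suc_eq_le\<close>)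
    show ?thesis unfolding Suc by (rule next_block[OF n(2)])
  qed
qed

lemma block_exists: "\<exists>n. settled_block r n \<and> computable_set (below C n)"
proof -
  obtain n where n: "settled r n" "computable_set (below C n)" using all_settled by blast
  have "settled_block r n" by unfold_locales (use all_settled n in blast)+
  then show ?thesis using n(2) by blast
qed

lemma C_not_computable: "\<not> computable_set C"
proof
  assume "computable_set C"
  then obtain p where p: "\<And>x. eval {} p [x] (if x \<in> C then 1 else 0)"
    unfolding computable_set_def turing_le_def by blast
  \<comment> \<open>The base column of this block puts \<open>pr n 0\<close> into \<open>C\<close>
    exactly if the supposed decision program outputs \<open>0\<close> there.\<close>
  let ?r = "pr (enc p) 0"
  obtain n where "settled_block ?r n" using block_exists by blast
  then interpret settled_block ?r n .
  let ?z = "pr n 0"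
  have "?z \<in> C \<longleftrightarrow> (\<exists>s. J (sat {} s) (enc p) (list_encode [?z]) 0)" using column_0[of 0] by simp
  also have "\<dots> \<longleftrightarrow> eval {} p [?z] 0" using sat_sound sat_complete by blast
  also have "\<dots> \<longleftrightarrow> ?z \<notin> C" using p[of ?z] eval_det[OF p[of ?z]] by (auto split: if_splits)
  finally show False by blast
qed

theorem theorem1p2:
  shows "\<exists>C :: nat set. REA_omega C \<and> \<not> computable_set C \<and>
           (\<forall>X. turing_le X C \<and> turing_le X halting_set \<longrightarrow> computable_set X)"
proof (intro exI conjI allI impI)
  show "REA_omega C" by (rule REA_omega_C)
  show "\<not> computable_set C" by (rule C_not_computable)
  fix X assume "turing_le X C \<and> turing_le X halting_set"
  then obtain \<phi> \<psi> where X: "\<And>x. eval C \<phi> [x] (if x \<in> X then 1 else 0)"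
    and K: "\<And>x. eval halting_set \<psi> [x] (if x \<in> X then 1 else 0)"
    unfolding turing_le_def by blast
  obtain n where "settled_block (pr (enc \<phi>) (enc \<psi>)) n" and c: "computable_set (below C n)"
    using block_exists by blast
  then interpret settled_block "pr (enc \<phi>) (enc \<psi>)" n by blast
  show "computable_set X" by (rule minimal_pair[OF c refl X K])
qed

end
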